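(* Every symmetric special multiserial algebra with multiplicity function identically equal to one in its defining pair (that is, every symmetric special multiserial algebra $\Lambda=KQ_\Lambda/I_\Lambda$ defined by a defining pair $(\mathcal S,\mu)$ with $\mu\equiv1$) is a trivial extension $T(A)=A\rtimes\operatorname{Hom}_K(A,K)$ of an almost gentle algebra $A$. Equivalently, every Brauer configuration algebra with multiplicity function identically equal to one is the trivial extension of an almost gentle algebra.
   Context: $K$ is a field; all algebras are indecomposable and finite dimensional over $K$. Quivers are finite; $ab$ denotes the arrow $a$ followed by the arrow $b$ (and is $0$ if not composable). For a presentation $KQ/I$ the ideal $I$ is admissible. Condition (S1) on $KQ/I$: for every arrow $a$ there is at most one arrow $b$ with $ab\notin I$ and at most one arrow $c$ with $ca\notin I$. An algebra is special multiserial if it is Morita equivalent to some $KQ/I$ satisfying (S1), and almost gentle if it is Morita equivalent to some $KQ/I$ satisfying (S1) and (S0): $I$ is generated by paths of length 2. With $D(A)=\operatorname{Hom}_K(A,K)$, $T(A)$ is the vector space $A\oplus D(A)$ with multiplication $(a,f)(b,g)=(ab,ag+fb)$, where $(afb)(x)=f(bxa)$. A cycle is simple if it has no repeated arrows. A defining pair $(\mathcal S,\mu)$ in a quiver consists of a set $\mathcal S$ of simple cycles and a map $\mu\colon\mathcal S\to\mathbb Z_{>0}$ such that: (D0) if $C\in\mathcal S$ is a loop, then $\mu(C)>1$; (D1) if a simple cycle is in $\mathcal S$, every cyclic permutation of it is in $\mathcal S$; (D2) $\mu(C)=\mu(C')$ if $C'$ is a cyclic permutation of $C\in\mathcal S$;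 (D3) every arrow occurs in some cycle in $\mathcal S$; (D4) if an arrow occurs in two cycles in $\mathcal S$, these are cyclic permutations of each other. For $\mu\equiv1$, "$\Lambda=KQ_\Lambda/I_\Lambda$ is defined by $(\mathcal S,\mu)$" means that $I_\Lambda$ is generated by: $C-C'$ for $C,C'\in\mathcal S$ at the same vertex; $Ca$ for $C\in\mathcal S$ with first arrow $a$; and $ab$ for arrows $a,b$ such that $ab$ does not lie on any $C\in\mathcal S$. Brauer configuration: a tuple $\Gamma=(\Gamma_0,\Gamma_1,\nu,\mathfrak o)$ with $\Gamma_0$ a finite set of vertices, $\Gamma_1$ a finite collection of polygons, each a finite multiset of vertices with at least two elements counted with multiplicity, $\nu\colon\Gamma_0\to\mathbb Z_{>0}$ the multiplicity function, and $\mathfrak o$ an orientation, i.e. for each vertex $\alpha$ a cyclic ordering of the occurrences of $\alpha$ in the polygons. Let $\mathrm{val}(\alpha)$ be the total number of occurrences of $\alpha$ in polygons. Every vertex lies in some polygon and every polygon contains a vertex $\alpha$ with $\mathrm{val}(\alpha)\nu(\alpha)>1$. A vertex is truncated if $\mathrm{val}(\alpha)\nu(\alpha)=1$. The Brauer configuration algebra of $\Gamma$ is $KQ_\Gamma/I_\Gamma$: $Q_\Gamma$ has one vertex $v$ for each polygon $V$; for each non-truncated $\alpha$ with cyclic ordering $V_1<\cdots<V_n<V_1$, $n=\mathrm{val}(\alpha)$, there are arrows $a_i\colon v_i\to v_{i+1}$ ($1\le i\le n$, indices mod $n$), and the special $\alpha$-cycles are $a_i\cdots a_na_1\cdots a_{i-1}$.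 $I_\Gamma$ is generated by: $C^{\nu(\alpha)}-C'^{\nu(\beta)}$ for a special $\alpha$-cycle $C$ and a special $\beta$-cycle $C'$ at the same vertex; $C^{\nu(\alpha)}a$ for a special $\alpha$-cycle $C$ with first arrow $a$; and $ab$ for arrows $a,b$ with $ab$ not a subpath of any special cycle, except when $a=b$ is a loop that is itself a special cycle.
   Formalization: In the first claim the quiver of Λ is assumed to have at least one arrow; this excludes only Λ = K (one vertex, no arrows, empty defining pair), which has dimension 1 and so is not a trivial extension. *)

theory Defs
  imports
    "Graph_Theory.Arc_Walk"
    "Jordan_Normal_Form.VS_Connect"
    "HOL-Algebra.QuotRing"
    "HOL-Algebra.Ideal_Product"
    "HOL-Library.Poly_Mapping"
    "HOL-Library.Sublist"
    "HOL-Library.Multiset"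
    "HOL-Library.FuncSet"
begin

section \<open>Algebras over a field\<close>

text \<open>
  The ground field is a type of class \<open>field\<close>; algebras over it are (not necessarily commutative)
  rings with a carrier, stored in the record \<open>module\<close> of HOL-Algebra. (The locale \<open>algebra\<close> of
  HOL-Algebra demands commutativity and is therefore not used.)
\<close>

definition k_algebra :: "('k::field, 'a) module \<Rightarrow> bool" where
  "k_algebra A \<longleftrightarrow> ring A \<and> vectorspace class_ring A \<and>
    (\<forall>c. \<forall>x\<in>carrier A. \<forall>y\<in>carrier A.
       (c \<odot>\<^bsub>A\<^esub> x) \<otimes>\<^bsub>A\<^esub> y = c \<odot>\<^bsub>A\<^esub> (x \<otimes>\<^bsub>A\<^esub> y) \<and>
       x \<otimes>\<^bsub>A\<^esub> (c \<odot>\<^bsub>A\<^esub> y) = c \<odot>\<^bsub>A\<^esub> (x \<otimes>\<^bsub>A\<^esub> y))"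

definition fd_algebra :: "('k::field, 'a) module \<Rightarrow> bool" where
  "fd_algebra A \<longleftrightarrow> k_algebra A \<and> vectorspace.fin_dim class_ring A"

text \<open>An algebra is indecomposable iff it is nonzero and not a product of two nonzero algebras;
  such product decompositions correspond to central idempotents.\<close>

definition indecomposable_algebra :: "('k::field, 'a) module \<Rightarrow> bool" where
  "indecomposable_algebra A \<longleftrightarrow> \<zero>\<^bsub>A\<^esub> \<noteq> \<one>\<^bsub>A\<^esub> \<and>
    (\<forall>e\<in>carrier A. e \<otimes>\<^bsub>A\<^esub> e = e \<and> (\<forall>x\<in>carrier A. e \<otimes>\<^bsub>A\<^esub> x = x \<otimes>\<^bsub>A\<^esub> e)
       \<longrightarrow> e = \<zero>\<^bsub>A\<^esub> \<or> e = \<one>\<^bsub>A\<^esub>)"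

definition algebra_isomorphic :: "('k::field, 'a) module \<Rightarrow> ('k, 'b) module \<Rightarrow> bool" where
  "algebra_isomorphic A B \<longleftrightarrow>
    (\<exists>h\<in>ring_iso A B. \<forall>c. \<forall>x\<in>carrier A. h (c \<odot>\<^bsub>A\<^esub> x) = c \<odot>\<^bsub>B\<^esub> h x)"

definition quotient_algebra :: "('k::field, 'a) module \<Rightarrow> 'a set \<Rightarrow> ('k, 'a set) module" where
  "quotient_algebra A I = ring.extend (A Quot I)
     (module.fields (\<lambda>c X. \<Union>x\<in>X. I +>\<^bsub>A\<^esub> (c \<odot>\<^bsub>A\<^esub> x)))"


section \<open>Trivial extensions\<close>

text \<open>Linear functionals are represented by functions that are \<open>undefined\<close> outside the carrier.\<close>

definition dual_space :: "('k::field, 'a) module \<Rightarrow> ('a \<Rightarrow> 'k) set" where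
  "dual_space A = {f \<in> extensional (carrier A).
     (\<forall>x\<in>carrier A. \<forall>y\<in>carrier A. f (x \<oplus>\<^bsub>A\<^esub> y) = f x + f y) \<and>
     (\<forall>c. \<forall>x\<in>carrier A. f (c \<odot>\<^bsub>A\<^esub> x) = c * f x)}"

text \<open>The bimodule action on the dual: \<open>(a f b)(x) = f(b x a)\<close>.\<close>

definition dual_action :: "('k::field, 'a) module \<Rightarrow> 'a \<Rightarrow> ('a \<Rightarrow> 'k) \<Rightarrow> 'a \<Rightarrow> 'a \<Rightarrow> 'k" where
  "dual_action A a f b = (\<lambda>x\<in>carrier A. f ((b \<otimes>\<^bsub>A\<^esub> x) \<otimes>\<^bsub>A\<^esub> a))"

definition trivial_extension :: "('k::field, 'a) module \<Rightarrow> ('k, 'a \<times> ('a \<Rightarrow> 'k)) module" where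
  "trivial_extension A =
    \<lparr>carrier = carrier A \<times> dual_space A,
     mult = (\<lambda>(a, f) (b, g). (a \<otimes>\<^bsub>A\<^esub> b,
       \<lambda>x\<in>carrier A. dual_action A a g \<one>\<^bsub>A\<^esub> x + dual_action A \<one>\<^bsub>A\<^esub> f b x)),
     one = (\<one>\<^bsub>A\<^esub>, \<lambda>x\<in>carrier A. 0),
     zero = (\<zero>\<^bsub>A\<^esub>, \<lambda>x\<in>carrier A. 0),
     add = (\<lambda>(a, f) (b, g). (a \<oplus>\<^bsub>A\<^esub> b, \<lambda>x\<in>carrier A. f x + g x)),
     smult = (\<lambda>c (a, f). (c \<odot>\<^bsub>A\<^esub> a, \<lambda>x\<in>carrier A. c * f x))\<rparr>"


section \<open>Morita equivalence\<close>

text \<open>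
  The category of finite dimensional left modules, with underlying vector spaces \<open>K^n\<close>: a module
  \<open>(n, \<rho>)\<close> is an algebra homomorphism \<open>\<rho>\<close> from \<open>A\<close> to the \<open>n \<times> n\<close> matrices, a homomorphism from
  \<open>(n, \<rho>)\<close> to \<open>(m, \<sigma>)\<close> is an \<open>m \<times> n\<close> matrix intertwining \<open>\<rho>\<close> and \<open>\<sigma>\<close>. The zero module \<open>n = 0\<close>
  is included.
\<close>

type_synonym ('k, 'a) fd_module = "nat \<times> ('a \<Rightarrow> 'k mat)"

definition fd_modules :: "('k::field, 'a) module \<Rightarrow> ('k, 'a) fd_module set" where
  "fd_modules A = {(n, \<rho>).
     (\<forall>x\<in>carrier A. \<rho> x \<in> carrier_mat n n) \<and>
     \<rho> \<one>\<^bsub>A\<^esub> = 1\<^sub>m n \<and>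
     (\<forall>x\<in>carrier A. \<forall>y\<in>carrier A. \<rho> (x \<oplus>\<^bsub>A\<^esub> y) = \<rho> x + \<rho> y) \<and>
     (\<forall>x\<in>carrier A. \<forall>y\<in>carrier A. \<rho> (x \<otimes>\<^bsub>A\<^esub> y) = \<rho> x * \<rho> y) \<and>
     (\<forall>c. \<forall>x\<in>carrier A. \<rho> (c \<odot>\<^bsub>A\<^esub> x) = c \<cdot>\<^sub>m \<rho> x)}"

definition fd_homs ::
  "('k::field, 'a) module \<Rightarrow> ('k, 'a) fd_module \<Rightarrow> ('k, 'a) fd_module \<Rightarrow> 'k mat set" where
  "fd_homs A M N = {T \<in> carrier_mat (fst N) (fst M). \<forall>x\<in>carrier A. T * snd M x = snd N x * T}"

text \<open>Two finite dimensional algebras are Morita equivalent if there is a \<open>K\<close>-linear functor between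
  their categories of finite dimensional modules (on objects \<open>F\<close>, on homomorphisms \<open>\<Phi>\<close>) that is
  fully faithful and essentially surjective.\<close>

definition morita_equivalent :: "('k::field, 'a) module \<Rightarrow> ('k, 'b) module \<Rightarrow> bool" where
  "morita_equivalent A B \<longleftrightarrow>
    (\<exists>(F :: ('k, 'a) fd_module \<Rightarrow> ('k, 'b) fd_module)
      (\<Phi> :: ('k, 'a) fd_module \<Rightarrow> ('k, 'a) fd_module \<Rightarrow> 'k mat \<Rightarrow> 'k mat).
      (\<forall>M\<in>fd_modules A. F M \<in> fd_modules B) \<and>
      (\<forall>M\<in>fd_modules A. \<Phi> M M (1\<^sub>m (fst M)) = 1\<^sub>m (fst (F M))) \<and>
      (\<forall>M\<in>fd_modules A. \<forall>N\<in>fd_modules A. \<forall>P\<in>fd_modules A.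
         \<forall>S\<in>fd_homs A M N. \<forall>T\<in>fd_homs A N P. \<Phi> M P (T * S) = \<Phi> N P T * \<Phi> M N S) \<and>
      (\<forall>M\<in>fd_modules A. \<forall>N\<in>fd_modules A. \<forall>S\<in>fd_homs A M N. \<forall>T\<in>fd_homs A M N.
         \<Phi> M N (S + T) = \<Phi> M N S + \<Phi> M N T) \<and>
      (\<forall>M\<in>fd_modules A. \<forall>N\<in>fd_modules A. \<forall>c. \<forall>T\<in>fd_homs A M N.
         \<Phi> M N (c \<cdot>\<^sub>m T) = c \<cdot>\<^sub>m \<Phi> M N T) \<and>
      (\<forall>M\<in>fd_modules A. \<forall>N\<in>fd_modules A.
         bij_betw (\<Phi> M N) (fd_homs A M N) (fd_homs B (F M) (F N))) \<and>
      (\<forall>N\<in>fd_modules B. \<exists>M\<in>fd_modules A. \<exists>S\<in>fd_homs B (F M) N. \<exists>T\<in>fd_homs B N (F M).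
         T * S = 1\<^sub>m (fst (F M)) \<and> S * T = 1\<^sub>m (fst N)))"


section \<open>Path algebras and admissible ideals\<close>

text \<open>Quivers are the finite directed multigraphs \<^locale>\<open>fin_digraph\<close>. A path is a triple of its
  first vertex, its list of arrows and its last vertex; paths compose from left to right.\<close>

type_synonym ('v, 'e) path = "'v \<times> 'e list \<times> 'v"

definition paths :: "('v, 'e) pre_digraph \<Rightarrow> ('v, 'e) path set" where
  "paths Q = {(u, p, v). pre_digraph.awalk Q u p v}"

fun path_mult :: "('v, 'e) path \<Rightarrow> ('v, 'e) path \<Rightarrow> ('v, 'e) path \<Rightarrow>\<^sub>0 'k::field" where
  "path_mult (u, p, v) (v', q, w) = (if v = v' then Poly_Mapping.single (u, p @ q, w) 1 else 0)"

definition path_algebra ::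
  "('v, 'e) pre_digraph \<Rightarrow> ('k::field, ('v, 'e) path \<Rightarrow>\<^sub>0 'k) module" where
  "path_algebra Q =
    \<lparr>carrier = {x. Poly_Mapping.keys x \<subseteq> paths Q},
     mult = (\<lambda>x y. \<Sum>p\<in>Poly_Mapping.keys x. \<Sum>q\<in>Poly_Mapping.keys y.
       Poly_Mapping.map ((*) (Poly_Mapping.lookup x p * Poly_Mapping.lookup y q)) (path_mult p q)),
     one = (\<Sum>v\<in>verts Q. Poly_Mapping.single (v, [], v) 1),
     zero = 0,
     add = (+),
     smult = (\<lambda>c. Poly_Mapping.map ((*) c))\<rparr>"

text \<open>The element of the path algebra given by a nonempty composable list of arrows.\<close>

definition path_elem ::
  "('v, 'e) pre_digraph \<Rightarrow> 'e list \<Rightarrow> ('v, 'e) path \<Rightarrow>\<^sub>0 'k::field" where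
  "path_elem Q p = Poly_Mapping.single (tail Q (hd p), p, head Q (last p)) 1"

definition arrow_elem :: "('v, 'e) pre_digraph \<Rightarrow> 'e \<Rightarrow> ('v, 'e) path \<Rightarrow>\<^sub>0 'k::field" where
  "arrow_elem Q a = path_elem Q [a]"

definition arrow_ideal :: "('v, 'e) pre_digraph \<Rightarrow> (('v, 'e) path \<Rightarrow>\<^sub>0 'k::field) set" where
  "arrow_ideal Q = genideal (path_algebra Q) (arrow_elem Q ` arcs Q)"

primrec arrow_ideal_power ::
  "('v, 'e) pre_digraph \<Rightarrow> nat \<Rightarrow> (('v, 'e) path \<Rightarrow>\<^sub>0 'k::field) set" where
  "arrow_ideal_power Q 0 = carrier (path_algebra Q)"
| "arrow_ideal_power Q (Suc n) = ideal_prod (path_algebra Q) (arrow_ideal Q) (arrow_ideal_power Q n)"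

definition admissible_ideal ::
  "('v, 'e) pre_digraph \<Rightarrow> (('v, 'e) path \<Rightarrow>\<^sub>0 'k::field) set \<Rightarrow> bool" where
  "admissible_ideal Q I \<longleftrightarrow> ideal I (path_algebra Q) \<and>
     I \<subseteq> arrow_ideal_power Q 2 \<and> (\<exists>m\<ge>2. arrow_ideal_power Q m \<subseteq> I)"


section \<open>Almost gentle algebras\<close>

definition cond_S0 ::
  "('v, 'e) pre_digraph \<Rightarrow> (('v, 'e) path \<Rightarrow>\<^sub>0 'k::field) set \<Rightarrow> bool" where
  "cond_S0 Q I \<longleftrightarrow> (\<exists>P \<subseteq> {p \<in> paths Q. length (fst (snd p)) = 2}.
     I = genideal (path_algebra Q) ((\<lambda>p. Poly_Mapping.single p 1) ` P))"

text \<open>The product of two arrows in the path algebra is \<open>0\<close> if they are not composable.\<close>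

definition cond_S1 ::
  "('v, 'e) pre_digraph \<Rightarrow> (('v, 'e) path \<Rightarrow>\<^sub>0 'k::field) set \<Rightarrow> bool" where
  "cond_S1 Q I \<longleftrightarrow>
    (\<forall>a\<in>arcs Q. \<forall>b\<in>arcs Q. \<forall>b'\<in>arcs Q.
       arrow_elem Q a \<otimes>\<^bsub>path_algebra Q\<^esub> arrow_elem Q b \<notin> I \<and>
       arrow_elem Q a \<otimes>\<^bsub>path_algebra Q\<^esub> arrow_elem Q b' \<notin> I \<longrightarrow> b = b') \<and>
    (\<forall>a\<in>arcs Q. \<forall>c\<in>arcs Q. \<forall>c'\<in>arcs Q.
       arrow_elem Q c \<otimes>\<^bsub>path_algebra Q\<^esub> arrow_elem Q a \<notin> I \<and>
       arrow_elem Q c' \<otimes>\<^bsub>path_algebra Q\<^esub> arrow_elem Q a \<notin> I \<longrightarrow> c = c')"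

text \<open>Every finite quiver is isomorphic to one whose vertices and arrows are natural numbers, so
  quantifying over these is no restriction.\<close>

definition almost_gentle :: "('k::field, 'a) module \<Rightarrow> bool" where
  "almost_gentle A \<longleftrightarrow> fd_algebra A \<and> indecomposable_algebra A \<and>
    (\<exists>(Q :: (nat, nat) pre_digraph) (I :: ((nat, nat) path \<Rightarrow>\<^sub>0 'k) set).
       fin_digraph Q \<and> admissible_ideal Q I \<and> cond_S1 Q I \<and> cond_S0 Q I \<and>
       indecomposable_algebra (quotient_algebra (path_algebra Q) I) \<and>
       morita_equivalent A (quotient_algebra (path_algebra Q) I))"


section \<open>Algebras given by defining pairs\<close>

text \<open>
  A cycle is represented by its nonempty list of arrows. Pitfall: in the quiver with one vertex and
  no arrows the empty set is a defining pair, with algebra \<open>K\<close>; being of odd dimension, \<open>K\<close> is not a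
  trivial extension.
\<close>

definition simple_cycle :: "('v, 'e) pre_digraph \<Rightarrow> 'e list \<Rightarrow> bool" where
  "simple_cycle Q C \<longleftrightarrow> C \<noteq> [] \<and> distinct C \<and> (\<exists>v. pre_digraph.awalk Q v C v)"

definition defining_pair ::
  "('v, 'e) pre_digraph \<Rightarrow> 'e list set \<Rightarrow> ('e list \<Rightarrow> nat) \<Rightarrow> bool" where
  "defining_pair Q S \<mu> \<longleftrightarrow>
    (\<forall>C\<in>S. simple_cycle Q C \<and> \<mu> C > 0) \<and>
    (\<forall>C\<in>S. length C = 1 \<longrightarrow> \<mu> C > 1) \<and>
    (\<forall>C\<in>S. \<forall>n. rotate n C \<in> S) \<and>
    (\<forall>C\<in>S. \<forall>n. \<mu> (rotate n C) = \<mu> C) \<and>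
    (\<forall>a\<in>arcs Q. \<exists>C\<in>S. a \<in> set C) \<and>
    (\<forall>C\<in>S. \<forall>C'\<in>S. set C \<inter> set C' \<noteq> {} \<longrightarrow> (\<exists>n. C' = rotate n C))"

text \<open>The relations and the algebra defined by \<open>(S, \<mu>)\<close> in the case \<open>\<mu> \<equiv> 1\<close>.\<close>

definition defining_relations ::
  "('v, 'e) pre_digraph \<Rightarrow> 'e list set \<Rightarrow> (('v, 'e) path \<Rightarrow>\<^sub>0 'k::field) set" where
  "defining_relations Q S =
    {path_elem Q C - path_elem Q C' | C C'. C \<in> S \<and> C' \<in> S \<and> tail Q (hd C) = tail Q (hd C')} \<union>
    {path_elem Q (C @ [hd C]) | C. C \<in> S} \<union>
    {arrow_elem Q a \<otimes>\<^bsub>path_algebra Q\<^esub> arrow_elem Q b | a b.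
       a \<in> arcs Q \<and> b \<in> arcs Q \<and> \<not> (\<exists>C\<in>S. sublist [a, b] C)}"

definition defined_algebra ::
  "('v, 'e) pre_digraph \<Rightarrow> 'e list set \<Rightarrow> ('k::field, (('v, 'e) path \<Rightarrow>\<^sub>0 'k) set) module" where
  "defined_algebra Q S =
    quotient_algebra (path_algebra Q) (genideal (path_algebra Q) (defining_relations Q S))"


section \<open>Brauer configuration algebras\<close>

text \<open>
  Different polygons may have the same multiset of vertices, so polygons are labels and \<open>corners\<close>
  yields the multiset of vertices of a polygon. The occurrences of \<open>\<alpha>\<close> are the pairs \<open>(V, i)\<close> with
  \<open>i\<close> less than the multiplicity of \<open>\<alpha>\<close> in \<open>V\<close>; the list \<open>orientation \<Gamma> \<alpha>\<close> represents their cyclic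
  ordering, the last entry being followed by the first.
\<close>

record ('a, 'p) brauer_configuration =
  vertices :: "'a set"
  polygons :: "'p set"
  corners :: "'p \<Rightarrow> 'a multiset"
  multiplicity_fun :: "'a \<Rightarrow> nat"
  orientation :: "'a \<Rightarrow> ('p \<times> nat) list"

definition valency :: "('a, 'p) brauer_configuration \<Rightarrow> 'a \<Rightarrow> nat" where
  "valency \<Gamma> \<alpha> = (\<Sum>V\<in>polygons \<Gamma>. count (corners \<Gamma> V) \<alpha>)"

definition brauer_configuration :: "('a, 'p) brauer_configuration \<Rightarrow> bool" where
  "brauer_configuration \<Gamma> \<longleftrightarrow>
    finite (vertices \<Gamma>) \<and> finite (polygons \<Gamma>) \<and>
    (\<forall>V\<in>polygons \<Gamma>. set_mset (corners \<Gamma> V) \<subseteq> vertices \<Gamma> \<and> size (corners \<Gamma> V) \<ge> 2) \<and>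
    (\<forall>\<alpha>\<in>vertices \<Gamma>. multiplicity_fun \<Gamma> \<alpha> > 0) \<and>
    (\<forall>\<alpha>\<in>vertices \<Gamma>. distinct (orientation \<Gamma> \<alpha>) \<and>
       set (orientation \<Gamma> \<alpha>) = {(V, i). V \<in> polygons \<Gamma> \<and> i < count (corners \<Gamma> V) \<alpha>}) \<and>
    (\<forall>\<alpha>\<in>vertices \<Gamma>. \<exists>V\<in>polygons \<Gamma>. \<alpha> \<in># corners \<Gamma> V) \<and>
    (\<forall>V\<in>polygons \<Gamma>. \<exists>\<alpha>. \<alpha> \<in># corners \<Gamma> V \<and> valency \<Gamma> \<alpha> * multiplicity_fun \<Gamma> \<alpha> > 1)"

definition nontruncated :: "('a, 'p) brauer_configuration \<Rightarrow> 'a set" where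
  "nontruncated \<Gamma> = {\<alpha> \<in> vertices \<Gamma>. valency \<Gamma> \<alpha> * multiplicity_fun \<Gamma> \<alpha> \<noteq> 1}"

text \<open>The arrow \<open>(\<alpha>, i)\<close> leads from the \<open>i\<close>-th occurrence of \<open>\<alpha>\<close> to the cyclically next one;
  occurrences are numbered from \<open>0\<close>.\<close>

definition brauer_quiver ::
  "('a, 'p) brauer_configuration \<Rightarrow> ('p, 'a \<times> nat) pre_digraph" where
  "brauer_quiver \<Gamma> =
    \<lparr>verts = polygons \<Gamma>,
     arcs = {(\<alpha>, i). \<alpha> \<in> nontruncated \<Gamma> \<and> i < valency \<Gamma> \<alpha>},
     tail = (\<lambda>(\<alpha>, i). fst (orientation \<Gamma> \<alpha> ! i)),
     head = (\<lambda>(\<alpha>, i). fst (orientation \<Gamma> \<alpha> ! (Suc i mod valency \<Gamma> \<alpha>)))\<rparr>"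

definition special_cycles :: "('a, 'p) brauer_configuration \<Rightarrow> 'a \<Rightarrow> ('a \<times> nat) list set" where
  "special_cycles \<Gamma> \<alpha> =
    {rotate i (map (Pair \<alpha>) [0..<valency \<Gamma> \<alpha>]) | i. i < valency \<Gamma> \<alpha>}"

definition cycle_power :: "'e list \<Rightarrow> nat \<Rightarrow> 'e list" where
  "cycle_power C n = concat (replicate n C)"

definition brauer_relations ::
  "('a, 'p) brauer_configuration \<Rightarrow> (('p, 'a \<times> nat) path \<Rightarrow>\<^sub>0 'k::field) set" where
  "brauer_relations \<Gamma> =
    {path_elem (brauer_quiver \<Gamma>) (cycle_power C (multiplicity_fun \<Gamma> \<alpha>)) -
       path_elem (brauer_quiver \<Gamma>) (cycle_power C' (multiplicity_fun \<Gamma> \<beta>)) | \<alpha> \<beta> C C'.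
       \<alpha> \<in> nontruncated \<Gamma> \<and> \<beta> \<in> nontruncated \<Gamma> \<and>
       C \<in> special_cycles \<Gamma> \<alpha> \<and> C' \<in> special_cycles \<Gamma> \<beta> \<and>
       tail (brauer_quiver \<Gamma>) (hd C) = tail (brauer_quiver \<Gamma>) (hd C')} \<union>
    {path_elem (brauer_quiver \<Gamma>) (cycle_power C (multiplicity_fun \<Gamma> \<alpha>) @ [hd C]) | \<alpha> C.
       \<alpha> \<in> nontruncated \<Gamma> \<and> C \<in> special_cycles \<Gamma> \<alpha>} \<union>
    {arrow_elem (brauer_quiver \<Gamma>) a \<otimes>\<^bsub>path_algebra (brauer_quiver \<Gamma>)\<^esub>
       arrow_elem (brauer_quiver \<Gamma>) b | a b.
       a \<in> arcs (brauer_quiver \<Gamma>) \<and> b \<in> arcs (brauer_quiver \<Gamma>) \<and>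
       \<not> (\<exists>\<alpha>\<in>nontruncated \<Gamma>. \<exists>C\<in>special_cycles \<Gamma> \<alpha>. sublist [a, b] C) \<and>
       \<not> (a = b \<and> (\<exists>\<alpha>\<in>nontruncated \<Gamma>. [a] \<in> special_cycles \<Gamma> \<alpha>))}"

definition brauer_configuration_algebra ::
  "('a, 'p) brauer_configuration \<Rightarrow>
   ('k::field, (('p, 'a \<times> nat) path \<Rightarrow>\<^sub>0 'k) set) module" where
  "brauer_configuration_algebra \<Gamma> =
    quotient_algebra (path_algebra (brauer_quiver \<Gamma>))
      (genideal (path_algebra (brauer_quiver \<Gamma>)) (brauer_relations \<Gamma>))"

end

theory Submission
  imports Defs
begin

text \<open>
  Let \<open>\<Lambda>\<close> be the algebra of \<open>(S, \<mu>)\<close> with \<open>\<mu> \<equiv> 1\<close>. The sum \<open>t\<close> of the coefficients of the cycles in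
  \<open>S\<close> is a symmetric form on the path algebra whose radical is exactly the ideal of relations, so \<open>t\<close>
  is a symmetrizing form on \<open>\<Lambda>\<close>. Choose a set \<open>T\<close> containing one arrow of each cycle (up to rotation)
  and let \<open>A\<close> be the quotient of the path algebra of \<open>Q - T\<close> by the paths of length two that do not lie
  on a cycle in \<open>S\<close>. Counting arrows of \<open>T\<close> grades \<open>\<Lambda>\<close> with degree zero part \<open>A\<close>, and since every cycle
  in \<open>S\<close> has degree one, \<open>x \<mapsto> (x\<^sub>0, y \<mapsto> t (x y))\<close> is an isomorphism from \<open>\<Lambda>\<close> to \<open>T(A)\<close>. A central
  idempotent \<open>e\<close> of \<open>A\<close> gives the central idempotent \<open>(e, 0)\<close> of \<open>T(A)\<close>, whence \<open>A\<close> is indecomposable.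
\<close>

section \<open>Algebras and their quotients\<close>

text \<open>An ideal given by generators is easy to bound from above but hard to fill from below, so
  the inclusion of the radical in the ideal of relations is the delicate one. Modulo the relations
  every element becomes a combination of normal paths: trivial paths, proper pieces of cycles, and
  one chosen cycle per vertex. Each of them has a partner path that no other normal path completes
  to a cycle; pairing with the partner reads off a coefficient, so a normal form in the radical is
  zero. A trivial path has a partner only if some cycle passes through its vertex. Indecomposability
  together with the presence of an arrow guarantees this; without arrows the algebra
  \<open>K\<close> would occur.

  Relabelling by natural numbers is forced by the shape of \<open>almost_gentle\<close>, and it also
  provides the order by which the arrows of \<open>T\<close> are selected: the least arrow of a
  cycle is the same for all its rotations.

  For a Brauer configuration with multiplicities one, nontruncated vertices have valency at least
  two. Its special cycles are then a defining pair with literally the same relations.\<close>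

lemma k_algebraI:
  fixes A :: "('k::field, 'a) module"
  assumes "ring A"
    and "\<And>c x. x \<in> carrier A \<Longrightarrow> c \<odot>\<^bsub>A\<^esub> x \<in> carrier A"
    and "\<And>c d x. x \<in> carrier A \<Longrightarrow> (c + d) \<odot>\<^bsub>A\<^esub> x = c \<odot>\<^bsub>A\<^esub> x \<oplus>\<^bsub>A\<^esub> d \<odot>\<^bsub>A\<^esub> x"
    and "\<And>c x y. x \<in> carrier A \<Longrightarrow> y \<in> carrier A \<Longrightarrow>
      c \<odot>\<^bsub>A\<^esub> (x \<oplus>\<^bsub>A\<^esub> y) = c \<odot>\<^bsub>A\<^esub> x \<oplus>\<^bsub>A\<^esub> c \<odot>\<^bsub>A\<^esub> y"
    and "\<And>c d x. x \<in> carrier A \<Longrightarrow> (c * d) \<odot>\<^bsub>A\<^esub> x = c \<odot>\<^bsub>A\<^esub> (d \<odot>\<^bsub>A\<^esub> x)"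
    and "\<And>x. x \<in> carrier A \<Longrightarrow> 1 \<odot>\<^bsub>A\<^esub> x = x"
    and "\<And>c x y. x \<in> carrier A \<Longrightarrow> y \<in> carrier A \<Longrightarrow>
      (c \<odot>\<^bsub>A\<^esub> x) \<otimes>\<^bsub>A\<^esub> y = c \<odot>\<^bsub>A\<^esub> (x \<otimes>\<^bsub>A\<^esub> y)"
    and "\<And>c x y. x \<in> carrier A \<Longrightarrow> y \<in> carrier A \<Longrightarrow>
      x \<otimes>\<^bsub>A\<^esub> (c \<odot>\<^bsub>A\<^esub> y) = c \<odot>\<^bsub>A\<^esub> (x \<otimes>\<^bsub>A\<^esub> y)"
  shows "k_algebra A"
proof -
  interpret A: ring A by fact
  have "module class_ring A"
    using assms by (intro moduleI class_cring.is_cring A.is_abelian_group) auto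
  then have "vectorspace class_ring A"
    by (intro vectorspace.intro class_field.field_axioms)
  then show ?thesis
    using assms unfolding k_algebra_def by simp
qed

lemma k_algebraD:
  fixes A :: "('k::field, 'a) module"
  assumes "k_algebra A"
  shows "ring A"
    and "x \<in> carrier A \<Longrightarrow> c \<odot>\<^bsub>A\<^esub> x \<in> carrier A"
    and "x \<in> carrier A \<Longrightarrow> (c + d) \<odot>\<^bsub>A\<^esub> x = c \<odot>\<^bsub>A\<^esub> x \<oplus>\<^bsub>A\<^esub> d \<odot>\<^bsub>A\<^esub> x"
    and "x \<in> carrier A \<Longrightarrow> y \<in> carrier A \<Longrightarrow>
      c \<odot>\<^bsub>A\<^esub> (x \<oplus>\<^bsub>A\<^esub> y) = c \<odot>\<^bsub>A\<^esub> x \<oplus>\<^bsub>A\<^esub> c \<odot>\<^bsub>A\<^esub> y"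
    and "x \<in> carrier A \<Longrightarrow> (c * d) \<odot>\<^bsub>A\<^esub> x = c \<odot>\<^bsub>A\<^esub> (d \<odot>\<^bsub>A\<^esub> x)"
    and "x \<in> carrier A \<Longrightarrow> 1 \<odot>\<^bsub>A\<^esub> x = x"
    and "x \<in> carrier A \<Longrightarrow> y \<in> carrier A \<Longrightarrow>
      (c \<odot>\<^bsub>A\<^esub> x) \<otimes>\<^bsub>A\<^esub> y = c \<odot>\<^bsub>A\<^esub> (x \<otimes>\<^bsub>A\<^esub> y)"
    and "x \<in> carrier A \<Longrightarrow> y \<in> carrier A \<Longrightarrow>
      x \<otimes>\<^bsub>A\<^esub> (c \<odot>\<^bsub>A\<^esub> y) = c \<odot>\<^bsub>A\<^esub> (x \<otimes>\<^bsub>A\<^esub> y)"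
proof -
  have vs: "vectorspace class_ring A"
    using assms by (simp add: k_algebra_def)
  interpret vectorspace class_ring A by fact
  show "ring A" "x \<in> carrier A \<Longrightarrow> y \<in> carrier A \<Longrightarrow>
      (c \<odot>\<^bsub>A\<^esub> x) \<otimes>\<^bsub>A\<^esub> y = c \<odot>\<^bsub>A\<^esub> (x \<otimes>\<^bsub>A\<^esub> y)"
    "x \<in> carrier A \<Longrightarrow> y \<in> carrier A \<Longrightarrow>
      x \<otimes>\<^bsub>A\<^esub> (c \<odot>\<^bsub>A\<^esub> y) = c \<odot>\<^bsub>A\<^esub> (x \<otimes>\<^bsub>A\<^esub> y)"
    using assms by (simp_all add: k_algebra_def)
  show "x \<in> carrier A \<Longrightarrow> c \<odot>\<^bsub>A\<^esub> x \<in> carrier A"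
    "x \<in> carrier A \<Longrightarrow> (c + d) \<odot>\<^bsub>A\<^esub> x = c \<odot>\<^bsub>A\<^esub> x \<oplus>\<^bsub>A\<^esub> d \<odot>\<^bsub>A\<^esub> x"
    "x \<in> carrier A \<Longrightarrow> y \<in> carrier A \<Longrightarrow>
      c \<odot>\<^bsub>A\<^esub> (x \<oplus>\<^bsub>A\<^esub> y) = c \<odot>\<^bsub>A\<^esub> x \<oplus>\<^bsub>A\<^esub> c \<odot>\<^bsub>A\<^esub> y"
    "x \<in> carrier A \<Longrightarrow> (c * d) \<odot>\<^bsub>A\<^esub> x = c \<odot>\<^bsub>A\<^esub> (d \<odot>\<^bsub>A\<^esub> x)"
    "x \<in> carrier A \<Longrightarrow> 1 \<odot>\<^bsub>A\<^esub> x = x"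
    using smult_closed[of c x] smult_l_distr[of c d x] smult_r_distr[of c x y]
      smult_assoc1[of c d x] smult_one[of x]
    by simp_all
qed

section \<open>Quotients by ideals and maps out of them\<close>

lemma ring_extend:
  assumes "ring R"
  shows "ring (ring.extend R m)"
proof -
  interpret ring R by fact
  show ?thesis
    by (intro ringI abelian_groupI monoidI)
      (auto simp: ring.extend_def a_ac m_assoc l_distr r_distr intro: bexI[of _ "\<ominus>\<^bsub>R\<^esub> x" for x])
qed

lemma quotient_algebra_fields [simp]:
  "carrier (quotient_algebra A I) = carrier (A Quot I)"
  "mult (quotient_algebra A I) = mult (A Quot I)"
  "one (quotient_algebra A I) = one (A Quot I)"
  "zero (quotient_algebra A I) = zero (A Quot I)"
  "add (quotient_algebra A I) = add (A Quot I)"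
  "smult (quotient_algebra A I) = (\<lambda>c X. \<Union>x\<in>X. I +>\<^bsub>A\<^esub> (c \<odot>\<^bsub>A\<^esub> x))"
  by (simp_all add: quotient_algebra_def ring.extend_def module.fields_def)

locale algebra_ideal = ideal I R for I and R :: "('k::field, 'a) module" (structure) +
  assumes k_algebra: "k_algebra R"
begin

abbreviation "quot \<equiv> quotient_algebra R I"

text \<open>Scaling by \<open>c\<close> is multiplication by \<open>c\<close> times the unit, so
  two-sided ideals of the ring are automatically subspaces.\<close>

lemma ideal_smult: "x \<in> I \<Longrightarrow> c \<odot> x \<in> I"
proof -
  assume x: "x \<in> I"
  then have "c \<odot> x = (c \<odot> \<one>) \<otimes> x"
    using k_algebraD(7)[OF k_algebra, of \<one> x c] Icarr[OF x] by simp
  then show ?thesis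
    using I_l_closed[OF x] k_algebraD(2)[OF k_algebra, of \<one> c] by simp
qed

lemma coset_eq_iff: "x \<in> carrier R \<Longrightarrow> y \<in> carrier R \<Longrightarrow> I +> x = I +> y \<longleftrightarrow> x \<ominus> y \<in> I"
  using quotient_eq_iff_same_a_r_cos[OF is_ideal, of x y] by simp

lemma coset_eq_ideal_iff: "x \<in> carrier R \<Longrightarrow> I +> x = I \<longleftrightarrow> x \<in> I"
  using rcos_const_imp_mem a_coset_join2[of x] a_subgroup by blast

lemma coset_zero: "I +> \<zero> = I"
  using coset_eq_ideal_iff by simp

lemma quot_carrier: "carrier quot = (\<lambda>x. I +> x) ` carrier R"
  by (auto simp: FactRing_simps)

lemma quot_mult: "x \<in> carrier R \<Longrightarrow> y \<in> carrier R \<Longrightarrow> (I +> x) \<otimes>\<^bsub>quot\<^esub> (I +> y) = I +> x \<otimes> y"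
  by (simp add: FactRing_simps rcoset_mult_add)

lemma quot_add: "x \<in> carrier R \<Longrightarrow> y \<in> carrier R \<Longrightarrow> (I +> x) \<oplus>\<^bsub>quot\<^esub> (I +> y) = I +> x \<oplus> y"
  by (simp add: FactRing_simps a_rcos_sum)

lemma quot_one: "\<one>\<^bsub>quot\<^esub> = I +> \<one>"
  by (simp add: FactRing_simps)

lemma quot_zero: "\<zero>\<^bsub>quot\<^esub> = I +> \<zero>"
  by (simp add: FactRing_simps coset_zero)

text \<open>The scalar action on a coset is a union over all its representatives; they all
  contribute the same coset because the ideal is a subspace.\<close>

lemma quot_smult:
  assumes "x \<in> carrier R"
  shows "c \<odot>\<^bsub>quot\<^esub> (I +> x) = I +> c \<odot> x"
proof -
  have "I +> c \<odot> y = I +> c \<odot> x" if y: "y \<in> I +> x" for y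
  proof -
    obtain i where i: "i \<in> I" "y = i \<oplus> x"
      using y by (auto simp: a_r_coset_def r_coset_def)
    have "c \<odot> y = c \<odot> i \<oplus> c \<odot> x"
      using i assms k_algebraD(4)[OF k_algebra] Icarr by simp
    moreover have "c \<odot> i \<in> I" "c \<odot> x \<in> carrier R" "c \<odot> i \<in> carrier R"
      using i assms ideal_smult k_algebraD(2)[OF k_algebra] Icarr by auto
    ultimately show ?thesis
      by (subst coset_eq_iff) (simp_all add: a_minus_def a_assoc r_neg)
  qed
  then have "(\<Union>y\<in>I +> x. I +> c \<odot> y) = (\<Union>y\<in>I +> x. I +> c \<odot> x)"
    by (rule SUP_cong[OF refl])
  also have "\<dots> = I +> c \<odot> x"
    using a_rcos_self[OF assms] by (intro UN_constant_eq[of x]) simp_all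
  finally show ?thesis
    unfolding quotient_algebra_fields .
qed

lemmas quot_simps = quot_mult quot_add quot_one quot_zero quot_smult

lemma k_algebra_quot: "k_algebra quot"
proof (rule k_algebraI)
  show "ring quot"
    unfolding quotient_algebra_def by (rule ring_extend[OF quotient_is_ring])
qed (auto simp: quot_carrier quot_simps k_algebraD[OF k_algebra] simp del: quotient_algebra_fields)

text \<open>The first isomorphism theorem with the kernel expressed by the fibres of
  \<open>h\<close>. In this form it applies to a target such as the trivial extension, of which only
  the operations are given.\<close>

lemma quot_isomorphicI:
  assumes onto: "h ` carrier R = carrier B"
    and mult: "\<And>x y. x \<in> carrier R \<Longrightarrow> y \<in> carrier R \<Longrightarrow> h (x \<otimes> y) = h x \<otimes>\<^bsub>B\<^esub> h y"
    and add: "\<And>x y. x \<in> carrier R \<Longrightarrow> y \<in> carrier R \<Longrightarrow> h (x \<oplus> y) = h x \<oplus>\<^bsub>B\<^esub> h y"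
    and one: "h \<one> = \<one>\<^bsub>B\<^esub>"
    and smult: "\<And>c x. x \<in> carrier R \<Longrightarrow> h (c \<odot> x) = c \<odot>\<^bsub>B\<^esub> h x"
    and ker: "\<And>x y. x \<in> carrier R \<Longrightarrow> y \<in> carrier R \<Longrightarrow> h x = h y \<longleftrightarrow> x \<ominus> y \<in> I"
  shows "algebra_isomorphic quot B"
proof -
  \<comment> \<open>\<open>H\<close> evaluates \<open>h\<close> at an arbitrary representative; by
    \<open>ker\<close> the value depends on the coset alone.\<close>
  define H where "H X = h (SOME x. x \<in> carrier R \<and> X = I +> x)" for X
  have H: "H (I +> x) = h x" if x: "x \<in> carrier R" for x
  proof -
    define y where "y = (SOME y. y \<in> carrier R \<and> I +> x = I +> y)"
    have "\<exists>y. y \<in> carrier R \<and> I +> x = I +> y"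
      using x by blast
    from someI_ex[OF this] have "y \<in> carrier R \<and> I +> x = I +> y"
      unfolding y_def .
    then show ?thesis
      unfolding H_def y_def[symmetric] using x ker[of y x] coset_eq_iff[of y x] by simp
  qed
  have "H \<in> Ring.ring_hom quot B"
    using onto
    by (intro ring_hom_memI)
      (auto simp: quot_carrier quot_simps H mult add one simp del: quotient_algebra_fields)
  moreover have "bij_betw H (carrier quot) (carrier B)"
    unfolding bij_betw_def inj_on_def quot_carrier onto[symmetric] image_image
    using ker coset_eq_iff by (auto simp: H image_iff)
  moreover have "\<forall>c. \<forall>X\<in>carrier quot. H (c \<odot>\<^bsub>quot\<^esub> X) = c \<odot>\<^bsub>B\<^esub> H X"
    using k_algebraD(2)[OF k_algebra]
    by (auto simp: quot_carrier quot_simps H smult simp del: quotient_algebra_fields)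
  ultimately show ?thesis
    unfolding algebra_isomorphic_def ring_iso_def by blast
qed

end

lemma algebra_isomorphic_trans:
  assumes "algebra_isomorphic A B" "algebra_isomorphic B C"
  shows "algebra_isomorphic A C"
proof -
  obtain g where g: "g \<in> ring_iso A B" "\<forall>c. \<forall>x\<in>carrier A. g (c \<odot>\<^bsub>A\<^esub> x) = c \<odot>\<^bsub>B\<^esub> g x"
    using assms(1) unfolding algebra_isomorphic_def by blast
  obtain h where h: "h \<in> ring_iso B C" "\<forall>c. \<forall>x\<in>carrier B. h (c \<odot>\<^bsub>B\<^esub> x) = c \<odot>\<^bsub>C\<^esub> h x"
    using assms(2) unfolding algebra_isomorphic_def by blast
  have "h \<circ> g \<in> ring_iso A C"
    using g h ring_iso_set_trans by blast
  moreover have "g x \<in> carrier B" if "x \<in> carrier A" for x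
    using g(1) that unfolding ring_iso_def Ring.ring_hom_def by auto
  ultimately show ?thesis
    unfolding algebra_isomorphic_def using g(2) h(2) by (intro bexI[of _ "h \<circ> g"]) auto
qed

section \<open>Trivial extensions, indecomposability, Morita equivalence and dimension\<close>

lemma trivial_extension_mult:
  fixes A :: "('k::field, 'a) module"
  assumes "ring A" "a \<in> carrier A" "b \<in> carrier A"
  shows "(a, f) \<otimes>\<^bsub>trivial_extension A\<^esub> (b, g) =
    (a \<otimes>\<^bsub>A\<^esub> b, \<lambda>x\<in>carrier A. g (x \<otimes>\<^bsub>A\<^esub> a) + f (b \<otimes>\<^bsub>A\<^esub> x))"
proof -
  interpret ring A by fact
  show ?thesis
    using assms(2,3) unfolding trivial_extension_def
    by (simp add: dual_action_def cong: restrict_cong)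
qed

lemma indecomposable_if_trivial_extension:
  fixes A :: "('k::field, 'a) module" and B :: "('k, 'b) module"
  assumes A: "k_algebra A" and iso: "algebra_isomorphic B (trivial_extension A)"
    and B: "indecomposable_algebra B"
    and ring: "ring B"
  shows "indecomposable_algebra A"
proof -
  interpret A: ring A using k_algebraD(1)[OF A] .
  interpret B: ring B by fact
  let ?T = "trivial_extension A"
  obtain h where h: "h \<in> ring_iso B ?T"
    using iso unfolding algebra_isomorphic_def by blast
  have hom: "h (x \<otimes>\<^bsub>B\<^esub> y) = h x \<otimes>\<^bsub>?T\<^esub> h y" "h (x \<oplus>\<^bsub>B\<^esub> y) = h x \<oplus>\<^bsub>?T\<^esub> h y"
    "h \<one>\<^bsub>B\<^esub> = \<one>\<^bsub>?T\<^esub>"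
    if "x \<in> carrier B" "y \<in> carrier B" for x y
    using h that unfolding ring_iso_def Ring.ring_hom_def by auto
  have bij: "bij_betw h (carrier B) (carrier ?T)"
    using h unfolding ring_iso_def by auto
  then have inj: "inj_on h (carrier B)" and onto: "h ` carrier B = carrier ?T"
    by (auto simp: bij_betw_def)
  \<comment> \<open>The first component of the image of zero equals its own double in the ring
    \<open>A\<close>, so it vanishes.\<close>
  have h0: "fst (h \<zero>\<^bsub>B\<^esub>) = \<zero>\<^bsub>A\<^esub>"
  proof -
    have "h \<zero>\<^bsub>B\<^esub> \<in> carrier ?T" using onto by blast
    moreover have "h \<zero>\<^bsub>B\<^esub> = h \<zero>\<^bsub>B\<^esub> \<oplus>\<^bsub>?T\<^esub> h \<zero>\<^bsub>B\<^esub>"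
      using hom(2)[of "\<zero>\<^bsub>B\<^esub>" "\<zero>\<^bsub>B\<^esub>"] by simp
    ultimately have "fst (h \<zero>\<^bsub>B\<^esub>) \<in> carrier A" "fst (h \<zero>\<^bsub>B\<^esub>) = fst (h \<zero>\<^bsub>B\<^esub>) \<oplus>\<^bsub>A\<^esub> fst (h \<zero>\<^bsub>B\<^esub>)"
      by (auto simp: trivial_extension_def split: prod.splits)
    then show ?thesis
      by (metis A.add.r_cancel_one)
  qed
  have h1: "fst (h \<one>\<^bsub>B\<^esub>) = \<one>\<^bsub>A\<^esub>"
    using hom(3)[of "\<zero>\<^bsub>B\<^esub>" "\<zero>\<^bsub>B\<^esub>"] by (simp add: trivial_extension_def)
  let ?z = "\<lambda>x\<in>carrier A. 0 :: 'k"
  have z: "?z \<in> dual_space A"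
    by (auto simp: dual_space_def k_algebraD[OF A])
  \<comment> \<open>If \<open>A\<close> were zero, its dual would be zero as well, and the trivial
    extension would have a single element, against \<zero> \<noteq> \<one> in
    \<open>B\<close>.\<close>
  have nz: "\<zero>\<^bsub>A\<^esub> \<noteq> \<one>\<^bsub>A\<^esub>"
  proof
    assume *: "\<zero>\<^bsub>A\<^esub> = \<one>\<^bsub>A\<^esub>"
    then have car: "carrier A = {\<zero>\<^bsub>A\<^esub>}"
      using A.one_zeroD by simp
    have "f = ?z" if f: "f \<in> dual_space A" for f
    proof
      fix x
      have "f \<zero>\<^bsub>A\<^esub> = f \<zero>\<^bsub>A\<^esub> + f \<zero>\<^bsub>A\<^esub>"
        using f unfolding dual_space_def by (metis (mono_tags, lifting) A.r_zero A.zero_closed mem_Collect_eq)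
      then have "f \<zero>\<^bsub>A\<^esub> = 0"
        by (simp only: add_cancel_right_right)
      moreover have "f \<in> extensional (carrier A)" using f by (simp add: dual_space_def)
      ultimately show "f x = ?z x"
        using car by (cases "x \<in> carrier A") (auto simp: extensional_def)
    qed
    then have *: "y = (\<zero>\<^bsub>A\<^esub>, ?z)" if "y \<in> carrier ?T" for y
      using car that by (auto simp: trivial_extension_def)
    have "h \<zero>\<^bsub>B\<^esub> \<in> carrier ?T" "h \<one>\<^bsub>B\<^esub> \<in> carrier ?T"
      unfolding onto[symmetric] by simp_all
    then have "h \<zero>\<^bsub>B\<^esub> = h \<one>\<^bsub>B\<^esub>"
      by (metis *)
    then have "\<zero>\<^bsub>B\<^esub> = \<one>\<^bsub>B\<^esub>"
      using inj by (simp add: inj_on_eq_iff)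
    then show False using B by (simp add: indecomposable_algebra_def)
  qed
  have "e = \<zero>\<^bsub>A\<^esub> \<or> e = \<one>\<^bsub>A\<^esub>"
    if e: "e \<in> carrier A" "e \<otimes>\<^bsub>A\<^esub> e = e"
      and c: "\<And>x. x \<in> carrier A \<Longrightarrow> e \<otimes>\<^bsub>A\<^esub> x = x \<otimes>\<^bsub>A\<^esub> e" for e
  proof -
    have eT: "(e, ?z) \<in> carrier ?T"
      using e z by (simp add: trivial_extension_def)
    then have "(e, ?z) \<in> h ` carrier B"
      unfolding onto .
    then obtain b where "(e, ?z) = h b" and b: "b \<in> carrier B"
      by (rule imageE)
    then have hb: "h b = (e, ?z)"
      by simp
    have idem: "(e, ?z) \<otimes>\<^bsub>?T\<^esub> (e, ?z) = (e, ?z)"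
      unfolding trivial_extension_mult[OF A.ring_axioms e(1) e(1)]
      by (simp add: e cong: restrict_cong)
    \<comment> \<open>The functionals of the two products are \<open>f\<close> applied to the
      argument times \<open>e\<close> and to \<open>e\<close> times the argument; these agree
      because \<open>e\<close> is central.\<close>
    have cent: "(e, ?z) \<otimes>\<^bsub>?T\<^esub> y = y \<otimes>\<^bsub>?T\<^esub> (e, ?z)" if y: "y \<in> carrier ?T" for y
    proof (cases y)
      case (Pair a f)
      then have a: "a \<in> carrier A"
        using y by (simp add: trivial_extension_def)
      show ?thesis
        unfolding Pair trivial_extension_mult[OF A.ring_axioms e(1) a]
          trivial_extension_mult[OF A.ring_axioms a e(1)]
        by (simp add: e(1) a c cong: restrict_cong)
    qed
    have "b \<otimes>\<^bsub>B\<^esub> b = b"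
      using hom(1)[of b b] b hb idem inj_onD[OF inj, of "b \<otimes>\<^bsub>B\<^esub> b" b] by simp
    moreover have "b \<otimes>\<^bsub>B\<^esub> x = x \<otimes>\<^bsub>B\<^esub> b" if x: "x \<in> carrier B" for x
    proof -
      have "h (b \<otimes>\<^bsub>B\<^esub> x) = h (x \<otimes>\<^bsub>B\<^esub> b)"
        using hom(1)[of b x] hom(1)[of x b] b x cent[of "h x"] hb onto[symmetric] by simp
      then show ?thesis
        using b x inj_onD[OF inj, of "b \<otimes>\<^bsub>B\<^esub> x" "x \<otimes>\<^bsub>B\<^esub> b"] by simp
    qed
    ultimately have "b = \<zero>\<^bsub>B\<^esub> \<or> b = \<one>\<^bsub>B\<^esub>"
      using B b unfolding indecomposable_algebra_def by blast
    then show ?thesis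
      using h0 h1 hb by auto
  qed
  then show ?thesis
    unfolding indecomposable_algebra_def using nz by blast
qed

lemma morita_equivalent_refl: "morita_equivalent A A"
  unfolding morita_equivalent_def
proof (intro exI conjI ballI allI)
  fix N assume N: "N \<in> fd_modules A"
  have "1\<^sub>m (fst N) \<in> fd_homs A N N"
    using N by (auto simp: fd_modules_def fd_homs_def)
  then show "\<exists>M\<in>fd_modules A. \<exists>S\<in>fd_homs A (id M) N. \<exists>T\<in>fd_homs A N (id M).
      T * S = 1\<^sub>m (fst (id M)) \<and> S * T = 1\<^sub>m (fst N)"
    using N by (intro bexI[of _ N] bexI[of _ "1\<^sub>m (fst N)"]) auto
qed (auto intro: bij_betw_id[unfolded id_def])

text \<open>Spanning is phrased as minimality among sets closed under the linear operations, so that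
  it can be checked by induction on elements rather than with explicit linear combinations.\<close>

lemma fd_algebraI:
  fixes A :: "('k::field, 'a) module"
  assumes A: "k_algebra A" and B: "finite B" "B \<subseteq> carrier A"
    and gen: "\<And>N. \<lbrakk>B \<subseteq> N; \<zero>\<^bsub>A\<^esub> \<in> N; \<And>x y. x \<in> N \<Longrightarrow> y \<in> N \<Longrightarrow> x \<oplus>\<^bsub>A\<^esub> y \<in> N;
      \<And>c x. x \<in> N \<Longrightarrow> c \<odot>\<^bsub>A\<^esub> x \<in> N\<rbrakk> \<Longrightarrow> carrier A \<subseteq> N"
  shows "fd_algebra A"
proof -
  interpret vectorspace class_ring A
    using A by (simp add: k_algebra_def)
  have sub: "submodule class_ring (span B) A"
    using B(2) by (rule span_is_submodule)
  have "carrier A \<subseteq> span B"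
    using in_own_span[OF B(2)] sub by (intro gen) (auto simp: submodule_def)
  then have "span B = carrier A"
    using span_is_subset2[OF B(2)] by (rule subset_antisym[rotated])
  then show ?thesis
    using A B unfolding fd_algebra_def fin_dim_def by blast
qed

section \<open>The multiplication of paths\<close>

abbreviation lookup :: "('a \<Rightarrow>\<^sub>0 'b::zero) \<Rightarrow> 'a \<Rightarrow> 'b" where
  "lookup \<equiv> Poly_Mapping.lookup"

abbreviation single :: "'a \<Rightarrow> 'b \<Rightarrow> 'a \<Rightarrow>\<^sub>0 'b::zero" where
  "single \<equiv> Poly_Mapping.single"

abbreviation keys :: "('a \<Rightarrow>\<^sub>0 'b::zero) \<Rightarrow> 'a set" where
  "keys \<equiv> Poly_Mapping.keys"

abbreviation scal :: "'k::field \<Rightarrow> ('a \<Rightarrow>\<^sub>0 'k) \<Rightarrow> 'a \<Rightarrow>\<^sub>0 'k" where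
  "scal c \<equiv> Poly_Mapping.map ((*) c)"

lemma lookup_scal [simp]: "lookup (scal c x) k = c * lookup x k"
  by (simp add: Poly_Mapping.map.rep_eq when_def)

lemma keys_scal: "keys (scal c x) \<subseteq> keys x"
  by (auto simp: in_keys_iff)

lemma keys_scal_closed: "keys x \<subseteq> P \<Longrightarrow> keys (scal c x) \<subseteq> P"
  by (rule order_trans[OF keys_scal])

lemma keys_uminus [simp]: "keys (- x) = keys (x :: 'a \<Rightarrow>\<^sub>0 'k::field)"
  by (auto simp: in_keys_iff)

lemma keys_diff_closed:
  fixes x :: "'a \<Rightarrow>\<^sub>0 'k::field"
  assumes "keys x \<subseteq> P" "keys y \<subseteq> P"
  shows "keys (x - y) \<subseteq> P"
proof -
  have "keys (x - y) \<subseteq> keys x \<union> keys y"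
    using keys_add[of x "- y"] by simp
  then show ?thesis using assms by blast
qed

lemma scal_simps [simp]:
  "scal 1 x = x" "scal 0 x = 0" "scal c 0 = 0"
  "scal c (scal d x) = scal (c * d) x"
  by (rule poly_mapping_eqI; simp)+

lemma scal_single [simp]: "scal c (single p d) = single p (c * d)"
  by (rule poly_mapping_eqI) (simp add: lookup_single when_def)

lemma scal_add: "scal c (x + y) = scal c x + scal c y"
  by (rule poly_mapping_eqI) (simp add: lookup_add algebra_simps)

lemma add_scal: "scal (c + d) x = scal c x + scal d x"
  by (rule poly_mapping_eqI) (simp add: lookup_add algebra_simps)

lemma poly_mapping_sum_singles: "(x :: 'a \<Rightarrow>\<^sub>0 'k::field) = (\<Sum>p\<in>keys x. single p (lookup x p))"
proof (rule poly_mapping_eqI)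
  fix r
  show "lookup x r = lookup (\<Sum>p\<in>keys x. single p (lookup x p)) r"
    by (cases "r \<in> keys x")
      (simp_all add: lookup_sum lookup_single when_def in_keys_iff sum.delta if_distrib cong: if_cong)
qed

text \<open>Reduces linear statements to single paths. Nested once per argument, it also handles
  bilinear and trilinear statements.\<close>

lemma keys_subset_induct [consumes 1, case_names zero single add]:
  fixes x :: "'a \<Rightarrow>\<^sub>0 'k::field"
  assumes x: "keys x \<subseteq> P"
    and zero: "Q 0"
    and single: "\<And>p c. p \<in> P \<Longrightarrow> Q (single p c)"
    and add: "\<And>x y. keys x \<subseteq> P \<Longrightarrow> keys y \<subseteq> P \<Longrightarrow> Q x \<Longrightarrow> Q y \<Longrightarrow> Q (x + y)"
  shows "Q x"
proof -
  \<comment> \<open>The partial sums of the expansion of \<open>x\<close> into singles stay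
    supported in \<open>P\<close>; this is carried along because \<open>add\<close> asks for
    it.\<close>
  have "keys (\<Sum>p\<in>F. single p (lookup x p)) \<subseteq> P \<and> Q (\<Sum>p\<in>F. single p (lookup x p))"
    if "finite F" "F \<subseteq> P" for F
    using that
  proof (induction F)
    case (insert q F)
    have "keys (single q (lookup x q)) \<subseteq> P"
      using insert.prems by simp
    moreover have "keys (single q (lookup x q) + (\<Sum>p\<in>F. single p (lookup x p))) \<subseteq>
        keys (single q (lookup x q)) \<union> keys (\<Sum>p\<in>F. single p (lookup x p))"
      by (rule keys_add)
    ultimately show ?case
      using insert single add by auto
  qed (simp add: zero)
  from this[of "keys x"] show ?thesis
    using x poly_mapping_sum_singles[of x] by simp
qed

lemma poly_mapping_single_induct [case_names zero single add]:
  fixes x :: "'a \<Rightarrow>\<^sub>0 'k::field"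
  assumes "Q 0" "\<And>p c. Q (single p c)" "\<And>x y. Q x \<Longrightarrow> Q y \<Longrightarrow> Q (x + y)"
  shows "Q x"
  using assms by (rule keys_subset_induct[OF subset_UNIV])

text \<open>The product of the path algebra, freed from the quiver: composability is read off from
  the endpoints stored in the paths. Hence a quiver and its subquivers share one and the same
  operation.\<close>

definition pmul ::
  "(('v, 'e) path \<Rightarrow>\<^sub>0 'k::field) \<Rightarrow> (('v, 'e) path \<Rightarrow>\<^sub>0 'k) \<Rightarrow> ('v, 'e) path \<Rightarrow>\<^sub>0 'k"  (infixl \<open>\<star>\<close> 70)
  where "x \<star> y = (\<Sum>p\<in>keys x. \<Sum>q\<in>keys y. scal (lookup x p * lookup y q) (path_mult p q))"

text \<open>Indices outside the supports add only zeros, so several products can be expanded over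
  one common index set. This is what additivity in each argument requires.\<close>

lemma lookup_pmul:
  assumes "finite P" "keys x \<subseteq> P" "finite R" "keys y \<subseteq> R"
  shows "lookup (x \<star> y) r = (\<Sum>p\<in>P. \<Sum>q\<in>R. lookup x p * lookup y q * lookup (path_mult p q) r)"
proof -
  have "lookup (x \<star> y) r =
      (\<Sum>p\<in>keys x. \<Sum>q\<in>keys y. lookup x p * lookup y q * lookup (path_mult p q) r)"
    by (simp add: pmul_def lookup_sum)
  also have "\<dots> = (\<Sum>p\<in>keys x. \<Sum>q\<in>R. lookup x p * lookup y q * lookup (path_mult p q) r)"
    using assms by (intro sum.cong sum.mono_neutral_left refl) (auto simp: in_keys_iff)
  also have "\<dots> = (\<Sum>p\<in>P. \<Sum>q\<in>R. lookup x p * lookup y q * lookup (path_mult p q) r)"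
    using assms by (intro sum.mono_neutral_left) (auto simp: in_keys_iff)
  finally show ?thesis .
qed

lemma pmul_add_left: "(x + x') \<star> y = x \<star> y + x' \<star> y"
proof (rule poly_mapping_eqI)
  fix r
  have *: "lookup (z \<star> y) r =
      (\<Sum>p\<in>keys x \<union> keys x'. \<Sum>q\<in>keys y. lookup z p * lookup y q * lookup (path_mult p q) r)"
    if "keys z \<subseteq> keys x \<union> keys x'" for z
    using that by (intro lookup_pmul) auto
  show "lookup ((x + x') \<star> y) r = lookup (x \<star> y + x' \<star> y) r"
    unfolding lookup_add *[OF keys_add] *[OF Un_upper1] *[OF Un_upper2]
    by (simp add: distrib_right sum.distrib)
qed

lemma pmul_add_right: "x \<star> (y + y') = x \<star> y + x \<star> y'"
proof (rule poly_mapping_eqI)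
  fix r
  have *: "lookup (x \<star> z) r =
      (\<Sum>p\<in>keys x. \<Sum>q\<in>keys y \<union> keys y'. lookup x p * lookup z q * lookup (path_mult p q) r)"
    if "keys z \<subseteq> keys y \<union> keys y'" for z
    using that by (intro lookup_pmul) auto
  show "lookup (x \<star> (y + y')) r = lookup (x \<star> y + x \<star> y') r"
    unfolding lookup_add *[OF keys_add] *[OF Un_upper1] *[OF Un_upper2]
    by (simp add: distrib_left distrib_right sum.distrib)
qed

lemma pmul_scal_left: "scal c x \<star> y = scal c (x \<star> y)"
proof (rule poly_mapping_eqI)
  fix r
  show "lookup (scal c x \<star> y) r = lookup (scal c (x \<star> y)) r"
    using keys_scal[of c x]
    by (simp add: lookup_pmul[of "keys x" _ "keys y"] sum_distrib_left mult.assoc)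
qed

lemma pmul_scal_right: "x \<star> scal c y = scal c (x \<star> y)"
proof (rule poly_mapping_eqI)
  fix r
  show "lookup (x \<star> scal c y) r = lookup (scal c (x \<star> y)) r"
    using keys_scal[of c y]
    by (simp add: lookup_pmul[of "keys x" _ "keys y"] sum_distrib_left mult_ac)
qed

lemma pmul_zero [simp]: "0 \<star> x = 0" "x \<star> 0 = 0"
  by (simp_all add: pmul_def)

lemma pmul_sum_left: "(\<Sum>i\<in>F. f i) \<star> y = (\<Sum>i\<in>F. f i \<star> y)"
  by (induction F rule: infinite_finite_induct) (simp_all add: pmul_add_left)

lemma pmul_sum_right: "x \<star> (\<Sum>i\<in>F. f i) = (\<Sum>i\<in>F. x \<star> f i)"
  by (induction F rule: infinite_finite_induct) (simp_all add: pmul_add_right)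

lemma pmul_diff_left: "(x - x') \<star> y = x \<star> y - x' \<star> y"
  using pmul_add_left[of "x - x'" x' y] by simp

lemma pmul_diff_right: "x \<star> (y - y') = x \<star> y - x \<star> y'"
  using pmul_add_right[of x "y - y'" y'] by simp

lemma pmul_single [simp]:
  "single (u, p, v) a \<star> single (v', q, w) b = (if v = v' then single (u, p @ q, w) (a * b) else 0)"
  by (cases "a = 0"; cases "b = 0") (simp_all add: pmul_def)

lemma pmul_assoc: "(x \<star> y) \<star> z = x \<star> (y \<star> z)"
proof (induction x rule: poly_mapping_single_induct)
  case (single p a)
  show ?case
  proof (induction y rule: poly_mapping_single_induct)
    case (single q b)
    show ?case
    proof (induction z rule: poly_mapping_single_induct)
      case (single r c)
      show ?case
        by (cases p; cases q; cases r) (simp add: mult.assoc)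
    qed (simp_all add: pmul_add_left pmul_add_right)
  qed (simp_all add: pmul_add_left pmul_add_right)
qed (simp_all add: pmul_add_left pmul_add_right)

lemma keys_pmul:
  assumes "r \<in> keys (x \<star> y)"
  shows "\<exists>u p v q w. (u, p, v) \<in> keys x \<and> (v, q, w) \<in> keys y \<and> r = (u, p @ q, w)"
proof -
  have "(\<Sum>p\<in>keys x. \<Sum>q\<in>keys y. lookup x p * lookup y q * lookup (path_mult p q) r) \<noteq> 0"
    using assms lookup_pmul[of "keys x" x "keys y" y r] by (simp add: in_keys_iff)
  then obtain p where p: "p \<in> keys x"
    "(\<Sum>q\<in>keys y. lookup x p * lookup y q * lookup (path_mult p q) r) \<noteq> 0"
    by (rule sum.not_neutral_contains_not_neutral)
  from p(2) obtain q where q: "q \<in> keys y"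
    "lookup x p * lookup y q * lookup (path_mult p q) r \<noteq> 0"
    by (rule sum.not_neutral_contains_not_neutral)
  obtain u p' v where p': "p = (u, p', v)" by (cases p)
  obtain v' q' w where q': "q = (v', q', w)" by (cases q)
  have "v = v' \<and> r = (u, p' @ q', w)"
    using q(2) by (auto simp: p' q' lookup_single when_def split: if_splits)
  then show ?thesis
    using p(1) q(1) p' q' by blast
qed

lemma keys_pmul_subsetI:
  assumes "\<And>u p v q w. (u, p, v) \<in> keys x \<Longrightarrow> (v, q, w) \<in> keys y \<Longrightarrow> (u, p @ q, w) \<in> N"
  shows "keys (x \<star> y) \<subseteq> N"
proof
  fix r assume "r \<in> keys (x \<star> y)"
  from keys_pmul[OF this] obtain u p v q w
    where "(u, p, v) \<in> keys x" "(v, q, w) \<in> keys y" "r = (u, p @ q, w)"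
    by blast
  then show "r \<in> N" using assms by simp
qed

section \<open>Path algebras\<close>

lemma path_algebra_simps [simp]:
  "carrier (path_algebra Q) = {x. keys x \<subseteq> paths Q}"
  "mult (path_algebra Q) = pmul"
  "add (path_algebra Q) = (+)"
  "zero (path_algebra Q) = 0"
  "smult (path_algebra Q) = (\<lambda>c. scal c)"
  "one (path_algebra Q) = (\<Sum>v\<in>verts Q. single (v, [], v) 1)"
  by (simp_all add: path_algebra_def pmul_def fun_eq_iff)

lemma mem_paths_iff: "(u, p, v) \<in> paths Q \<longleftrightarrow> pre_digraph.awalk Q u p v"
  by (simp add: paths_def)

lemma keys_add_closed: "keys x \<subseteq> P \<Longrightarrow> keys y \<subseteq> P \<Longrightarrow> keys (x + y) \<subseteq> P"
  using keys_add[of x y] by blast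

context fin_digraph
begin

lemma paths_Nil: "(u, [], v) \<in> paths G \<longleftrightarrow> u = v \<and> u \<in> verts G"
  by (simp add: mem_paths_iff awalk_Nil_iff)

lemma paths_appendI: "(u, p, v) \<in> paths G \<Longrightarrow> (v, q, w) \<in> paths G \<Longrightarrow> (u, p @ q, w) \<in> paths G"
  by (auto simp: mem_paths_iff intro: awalk_appendI)

lemma paths_verts: "(u, p, v) \<in> paths G \<Longrightarrow> u \<in> verts G \<and> v \<in> verts G"
  by (auto simp: mem_paths_iff dest: awalk_hd_in_verts awalk_last_in_verts)

lemma keys_pmul_closed: "keys x \<subseteq> paths G \<Longrightarrow> keys y \<subseteq> paths G \<Longrightarrow> keys (x \<star> y) \<subseteq> paths G"
  by (rule keys_pmul_subsetI) (blast intro: paths_appendI)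

lemma one_pmul:
  assumes "keys x \<subseteq> paths G"
  shows "(\<Sum>v\<in>verts G. single (v, [], v) 1) \<star> x = x"
  using assms
proof (induction x rule: keys_subset_induct)
  case (single p c)
  obtain u q w where "p = (u, q, w)" by (cases p)
  with single show ?case
    using paths_verts by (auto simp: pmul_sum_left sum.delta' cong: if_cong)
qed (simp_all add: pmul_add_right)

lemma pmul_one:
  assumes "keys x \<subseteq> paths G"
  shows "x \<star> (\<Sum>v\<in>verts G. single (v, [], v) 1) = x"
  using assms
proof (induction x rule: keys_subset_induct)
  case (single p c)
  obtain u q w where "p = (u, q, w)" by (cases p)
  with single show ?case
    using paths_verts by (auto simp: pmul_sum_right sum.delta cong: if_cong)
qed (simp_all add: pmul_add_left)

lemma keys_one: "keys (\<Sum>v\<in>verts G. single (v, [] :: 'b list, v) (1 :: 'k::field)) \<subseteq> paths G"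
proof
  fix r assume r: "r \<in> keys (\<Sum>v\<in>verts G. single (v, [] :: 'b list, v) (1 :: 'k))"
  then have "(\<Sum>v\<in>verts G. lookup (single (v, [] :: 'b list, v) (1 :: 'k)) r) \<noteq> 0"
    by (simp add: in_keys_iff lookup_sum)
  then obtain v where "v \<in> verts G" "lookup (single (v, [] :: 'b list, v) (1 :: 'k)) r \<noteq> 0"
    by (rule sum.not_neutral_contains_not_neutral)
  then show "r \<in> paths G"
    by (auto simp: lookup_single when_def paths_Nil split: if_splits)
qed

lemma k_algebra_path_algebra: "k_algebra (path_algebra G :: ('k::field, _) module)"
proof (rule k_algebraI)
  show "ring (path_algebra G :: ('k, _) module)"
  proof (intro ringI abelian_groupI monoidI)
    fix x :: "('a, 'b) path \<Rightarrow>\<^sub>0 'k"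
    assume "x \<in> carrier (path_algebra G)"
    then show "\<exists>y\<in>carrier (path_algebra G). y \<oplus>\<^bsub>path_algebra G\<^esub> x = \<zero>\<^bsub>path_algebra G\<^esub>"
      by (intro bexI[of _ "- x"]) auto
  qed (use keys_one in \<open>auto simp: keys_pmul_closed keys_add_closed pmul_assoc one_pmul pmul_one
      pmul_add_left pmul_add_right add_ac\<close>)
qed (simp_all add: keys_scal_closed pmul_scal_left pmul_scal_right scal_add add_scal)

lemma ring_path_algebra: "ring (path_algebra G :: ('k::field, _) module)"
  using k_algebraD(1)[OF k_algebra_path_algebra] .

lemma path_algebra_minus:
  fixes x y :: "('a, 'b) path \<Rightarrow>\<^sub>0 'k::field"
  assumes "keys x \<subseteq> paths G" "keys y \<subseteq> paths G"
  shows "x \<ominus>\<^bsub>path_algebra G\<^esub> y = x - y"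
proof -
  interpret ring "path_algebra G :: ('k, _) module" by (rule ring_path_algebra)
  have "\<ominus>\<^bsub>path_algebra G\<^esub> y = - y"
    using assms by (intro minus_equality) auto
  then show ?thesis by (simp add: a_minus_def)
qed

lemma path_idealI:
  fixes I :: "(('a, 'b) path \<Rightarrow>\<^sub>0 'k::field) set"
  assumes "\<And>x. x \<in> I \<Longrightarrow> keys x \<subseteq> paths G" "0 \<in> I" "\<And>x y. x \<in> I \<Longrightarrow> y \<in> I \<Longrightarrow> x + y \<in> I"
    and "\<And>x y. x \<in> I \<Longrightarrow> keys y \<subseteq> paths G \<Longrightarrow> y \<star> x \<in> I"
    and "\<And>x y. x \<in> I \<Longrightarrow> keys y \<subseteq> paths G \<Longrightarrow> x \<star> y \<in> I"
  shows "ideal I (path_algebra G)"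
proof -
  interpret ring "path_algebra G :: ('k, _) module" by (rule ring_path_algebra)
  \<comment> \<open>Closure under negation is a case of absorption: \<open>- x\<close> is the scalar
    -1 times the unit, multiplied by \<open>x\<close>.\<close>
  have neg: "- x \<in> I" if "x \<in> I" for x
  proof -
    have "- x = scal (- 1) x" by (rule poly_mapping_eqI) simp
    also have "\<dots> = scal (- 1) (\<Sum>v\<in>verts G. single (v, [], v) 1) \<star> x"
      by (simp only: pmul_scal_left one_pmul[OF assms(1)[OF that]])
    finally show ?thesis
      using assms(4)[OF that keys_scal_closed[OF keys_one]] by simp
  qed
  have "\<ominus>\<^bsub>path_algebra G\<^esub> x = - x" if "x \<in> I" for x
    using assms(1)[OF that] by (intro minus_equality) auto
  then have "subgroup I (add_monoid (path_algebra G))"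
    using assms(1,2,3) neg
    by (intro add.subgroupI) (auto simp: a_inv_def[symmetric])
  then show ?thesis
    using assms(4,5) by (intro idealI ring_path_algebra) auto
qed

text \<open>Monomial ideals: spans of sets of paths that are stable under prolongation at both ends.
  They serve as explicit upper bounds for ideals given by generators.\<close>

lemma ideal_keysI:
  assumes "N \<subseteq> paths G"
    and "\<And>u p v q w. (u, p, v) \<in> paths G \<Longrightarrow> (v, q, w) \<in> N \<Longrightarrow> (u, p @ q, w) \<in> N"
    and "\<And>u p v q w. (u, p, v) \<in> N \<Longrightarrow> (v, q, w) \<in> paths G \<Longrightarrow> (u, p @ q, w) \<in> N"
  shows "ideal {x :: _ \<Rightarrow>\<^sub>0 'k::field. keys x \<subseteq> N} (path_algebra G)"
proof (rule path_idealI)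
  fix x y :: "('a, 'b) path \<Rightarrow>\<^sub>0 'k"
  assume *: "x \<in> {x. keys x \<subseteq> N}" "keys y \<subseteq> paths G"
  have x: "p \<in> N" if "p \<in> keys x" for p
    using * that by auto
  have y: "p \<in> paths G" if "p \<in> keys y" for p
    using * that by auto
  have "keys (y \<star> x) \<subseteq> N" "keys (x \<star> y) \<subseteq> N"
    using assms(2)[OF y x] assms(3)[OF x y] by (auto intro!: keys_pmul_subsetI del: subsetI)
  then show "y \<star> x \<in> {x. keys x \<subseteq> N}" "x \<star> y \<in> {x. keys x \<subseteq> N}"
    by simp_all
qed (simp_all add: keys_add_closed order_trans[OF _ assms(1)])

lemma ideal_long_paths:
  "ideal {x :: _ \<Rightarrow>\<^sub>0 'k::field. keys x \<subseteq> {p \<in> paths G. n \<le> length (fst (snd p))}} (path_algebra G)"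
  by (rule ideal_keysI) (auto intro: paths_appendI)

lemma arrow_in_paths: "a \<in> arcs G \<Longrightarrow> (tail G a, [a], head G a) \<in> paths G"
  by (simp add: mem_paths_iff arc_implies_awalk)

section \<open>The arrow ideal and its powers\<close>

lemma ideal_arrow_ideal: "ideal (arrow_ideal G :: (_ \<Rightarrow>\<^sub>0 'k::field) set) (path_algebra G)"
proof -
  interpret ring "path_algebra G :: ('k, _) module" by (rule ring_path_algebra)
  show ?thesis
    unfolding arrow_ideal_def
    by (rule genideal_ideal) (auto simp: arrow_elem_def path_elem_def arrow_in_paths)
qed

lemma arrow_in_arrow_ideal:
  assumes "a \<in> arcs G"
  shows "(arrow_elem G a :: _ \<Rightarrow>\<^sub>0 'k::field) \<in> arrow_ideal G"
proof -
  interpret ring "path_algebra G :: ('k, _) module" by (rule ring_path_algebra)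
  have "(arrow_elem G ` arcs G :: (_ \<Rightarrow>\<^sub>0 'k) set) \<subseteq> arrow_ideal G"
    unfolding arrow_ideal_def
    by (rule genideal_self) (auto simp: arrow_elem_def path_elem_def arrow_in_paths)
  then show ?thesis using assms by blast
qed

lemma ideal_arrow_ideal_power:
  "ideal (arrow_ideal_power G n :: (_ \<Rightarrow>\<^sub>0 'k::field) set) (path_algebra G)"
proof (induction n)
  case 0
  interpret ring "path_algebra G :: ('k, _) module" by (rule ring_path_algebra)
  show ?case using oneideal by (simp only: arrow_ideal_power.simps)
next
  case (Suc n)
  interpret ring "path_algebra G :: ('k, _) module" by (rule ring_path_algebra)
  show ?case
    using ideal_prod_is_ideal[OF ideal_arrow_ideal Suc] by (simp only: arrow_ideal_power.simps)
qed

text \<open>The arrow ideal involves no trivial path, and lengths add under multiplication.\<close>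

lemma arrow_ideal_power_long:
  "(arrow_ideal_power G n :: (_ \<Rightarrow>\<^sub>0 'k::field) set) \<subseteq>
    {x. keys x \<subseteq> {p \<in> paths G. n \<le> length (fst (snd p))}}"
proof (induction n)
  case (Suc n)
  interpret ring "path_algebra G :: ('k, _) module" by (rule ring_path_algebra)
  have J: "(arrow_ideal G :: (_ \<Rightarrow>\<^sub>0 'k) set) \<subseteq>
      {x. keys x \<subseteq> {p \<in> paths G. 1 \<le> length (fst (snd p))}}"
    unfolding arrow_ideal_def
    by (rule genideal_minimal[OF ideal_long_paths])
      (auto simp: arrow_elem_def path_elem_def arrow_in_paths)
  show ?case
  proof
    fix x :: "('a, 'b) path \<Rightarrow>\<^sub>0 'k"
    assume "x \<in> arrow_ideal_power G (Suc n)"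
    then have "x \<in> ideal_prod (path_algebra G) (arrow_ideal G) (arrow_ideal_power G n)"
      by simp
    then show "x \<in> {x. keys x \<subseteq> {p \<in> paths G. Suc n \<le> length (fst (snd p))}}"
    proof induction
      case (prod i j)
      have i: "keys i \<subseteq> {p \<in> paths G. 1 \<le> length (fst (snd p))}"
        using prod(1) J by blast
      have j: "keys j \<subseteq> {p \<in> paths G. n \<le> length (fst (snd p))}"
        using prod(2) Suc by blast
      have "keys (i \<star> j) \<subseteq> {p \<in> paths G. Suc n \<le> length (fst (snd p))}"
      proof (rule keys_pmul_subsetI)
        fix u p v q w assume "(u, p, v) \<in> keys i" "(v, q, w) \<in> keys j"
        then have "(u, p, v) \<in> paths G" "1 \<le> length p" "(v, q, w) \<in> paths G" "n \<le> length q"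
          using i j by auto
        then show "(u, p @ q, w) \<in> {p \<in> paths G. Suc n \<le> length (fst (snd p))}"
          using paths_appendI[of u p v q w] by simp
      qed
      then show ?case by simp
    next
      case (sum x y)
      then show ?case using keys_add_closed by simp
    qed
  qed
qed auto

section \<open>Decomposition and endpoints of paths\<close>

lemma paths_Cons_iff: "(u, a # p, w) \<in> paths G \<longleftrightarrow> a \<in> arcs G \<and> u = tail G a \<and> (head G a, p, w) \<in> paths G"
  by (simp add: mem_paths_iff awalk_Cons_iff)

lemma paths_appendE:
  assumes "(u, p @ q, w) \<in> paths G"
  obtains v where "(u, p, v) \<in> paths G" "(v, q, w) \<in> paths G"
  using assms by (simp add: mem_paths_iff) blast

lemma paths_ends:
  "(u, p, v) \<in> paths G \<Longrightarrow> (u', p, v') \<in> paths G \<Longrightarrow> p \<noteq> [] \<Longrightarrow> u = u' \<and> v = v'"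
  using awalk_ends[of u p v u' v'] by (simp add: mem_paths_iff)

lemma paths_target:
  "(u, p, v) \<in> paths G \<Longrightarrow> (u, p, v') \<in> paths G \<Longrightarrow> v = v'"
  using awalk_ends[of u p v u v'] by (auto simp: mem_paths_iff)

lemma paths_arcs: "(u, p, v) \<in> paths G \<Longrightarrow> set p \<subseteq> arcs G"
  by (simp add: mem_paths_iff awalk_def)

lemma paths_tail_hd: "(u, p, v) \<in> paths G \<Longrightarrow> p \<noteq> [] \<Longrightarrow> u = tail G (hd p)"
  by (cases p) (simp_all add: paths_Cons_iff)

end

section \<open>The symmetric algebra of a set of cycles\<close>

text \<open>What a defining pair with \<mu> = 1 says about its cycles. \<open>S_length\<close> is
  the trace left by (D0): a loop would need a multiplicity above one, so there are no loops among
  the cycles.\<close>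

locale cycle_set = fin_digraph Q for Q :: "('v, 'e) pre_digraph" +
  fixes S :: "'e list set"
  assumes S_path: "C \<in> S \<Longrightarrow> (tail Q (hd C), C, tail Q (hd C)) \<in> paths Q"
    and S_nonempty: "C \<in> S \<Longrightarrow> C \<noteq> []"
    and S_distinct: "C \<in> S \<Longrightarrow> distinct C"
    and S_length: "C \<in> S \<Longrightarrow> length C \<noteq> 1"
    and S_rotate: "C \<in> S \<Longrightarrow> rotate n C \<in> S"
    and S_cover: "a \<in> arcs Q \<Longrightarrow> \<exists>C\<in>S. a \<in> set C"
    and S_disjoint: "C \<in> S \<Longrightarrow> C' \<in> S \<Longrightarrow> set C \<inter> set C' \<noteq> {} \<Longrightarrow> \<exists>n. C' = rotate n C"
begin

lemma S_swap: "p @ q \<in> S \<Longrightarrow> q @ p \<in> S"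
  using S_rotate[of "p @ q" "length p"] by (simp add: rotate_append)

lemma S_swap_iff: "p @ q \<in> S \<longleftrightarrow> q @ p \<in> S"
  using S_swap by blast

text \<open>Two cycles that share an arrow are rotations of each other, and a rotation of a list
  without repetitions preserves the head only if it is trivial.\<close>

lemma S_unique:
  assumes "C \<in> S" "C' \<in> S" "hd C = hd C'"
  shows "C = C'"
proof -
  have ne: "C \<noteq> []" "C' \<noteq> []"
    using assms S_nonempty by auto
  have "hd C \<in> set C \<inter> set C'"
    using ne assms(3) hd_in_set[of C] hd_in_set[of C'] by simp
  then obtain n where n: "C' = rotate n C"
    using S_disjoint[OF assms(1,2)] by blast
  have "C ! (n mod length C) = C ! 0"
    using hd_rotate_conv_nth[OF ne(1), of n] assms(3) ne by (simp add: n hd_conv_nth)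
  moreover have "n mod length C < length C" "0 < length C"
    using ne by simp_all
  ultimately have "n mod length C = 0"
    using S_distinct[OF assms(1)] nth_eq_iff_index_eq by blast
  then show ?thesis by (simp add: n)
qed

text \<open>The first arrow already determines the cycle, so a nonempty piece has a single
  completion. Both the nondegeneracy of the form and condition (S1) come down to this.\<close>

lemma S_cancel_left: "p @ q \<in> S \<Longrightarrow> p @ q' \<in> S \<Longrightarrow> p \<noteq> [] \<Longrightarrow> q = q'"
  using S_unique[of "p @ q" "p @ q'"] by simp

lemma S_cancel_right: "q @ p \<in> S \<Longrightarrow> q' @ p \<in> S \<Longrightarrow> p \<noteq> [] \<Longrightarrow> q = q'"
  using S_cancel_left[of p q q'] S_swap by blast

lemma S_append_iff: "C \<in> S \<Longrightarrow> C @ q \<in> S \<longleftrightarrow> q = []"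
  using S_cancel_left[of C q "[]"] S_nonempty[of C] by auto

lemma S_start: "a \<in> arcs Q \<Longrightarrow> \<exists>p. a # p \<in> S"
proof -
  assume "a \<in> arcs Q"
  then obtain C where C: "C \<in> S" "a \<in> set C"
    using S_cover by blast
  obtain xs ys where "C = xs @ a # ys"
    using split_list[OF C(2)] by blast
  then have "a # ys @ xs \<in> S"
    using C(1) S_swap[of xs "a # ys"] by simp
  then show ?thesis ..
qed

text \<open>Rotation brings any piece of a cycle to the front, so lying on a cycle is the same as
  being completable on the right.\<close>

lemma sublist_S_iff: "(\<exists>C\<in>S. sublist p C) \<longleftrightarrow> (\<exists>q. p @ q \<in> S)"
proof
  assume "\<exists>C\<in>S. sublist p C"
  then obtain xs ys where "xs @ p @ ys \<in> S"
    by (auto simp: sublist_def)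
  then have "p @ ys @ xs \<in> S"
    using S_swap[of xs "p @ ys"] by simp
  then show "\<exists>q. p @ q \<in> S" ..
next
  assume "\<exists>q. p @ q \<in> S"
  then show "\<exists>C\<in>S. sublist p C"
    using sublist_append_rightI by blast
qed

lemma finite_S: "finite S"
proof (rule finite_subset)
  show "S \<subseteq> {C. set C \<subseteq> arcs Q \<and> distinct C}"
    using paths_arcs[OF S_path] S_distinct by blast
qed (rule finite_subset_distinct[OF finite_arcs])

lemma path_in_S:
  "(u, p, v) \<in> paths Q \<Longrightarrow> p \<in> S \<Longrightarrow> u = tail Q (hd p) \<and> v = tail Q (hd p)"
  using paths_ends[OF _ S_path[of p]] S_nonempty[of p] by blast

lemma path_elem_S: "C \<in> S \<Longrightarrow> path_elem Q C = single (tail Q (hd C), C, tail Q (hd C)) 1"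
proof -
  assume C: "C \<in> S"
  then have ne: "C \<noteq> []" by (rule S_nonempty)
  have "(tail Q (hd C), butlast C @ [last C], tail Q (hd C)) \<in> paths Q"
    using S_path[OF C] ne by simp
  then obtain w where "(w, [last C], tail Q (hd C)) \<in> paths Q"
    by (rule paths_appendE)
  then show ?thesis
    by (simp add: path_elem_def paths_Cons_iff paths_Nil)
qed

lemma path_elem_S_snoc:
  "C \<in> S \<Longrightarrow> path_elem Q (C @ [hd C]) = single (tail Q (hd C), C @ [hd C], head Q (hd C)) 1"
  using S_nonempty[of C] by (simp add: path_elem_def)

lemma S_snoc_path:
  assumes "C \<in> S"
  shows "(tail Q (hd C), C @ [hd C], head Q (hd C)) \<in> paths Q"
proof -
  have "hd C \<in> arcs Q"
    using paths_arcs[OF S_path[OF assms]] S_nonempty[OF assms] hd_in_set[of C] by blast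
  then show ?thesis
    using paths_appendI[OF S_path[OF assms] arrow_in_paths[of "hd C"]] by simp
qed

lemma arrow_elem_mult:
  "arrow_elem Q a \<otimes>\<^bsub>path_algebra Q\<^esub> arrow_elem Q b =
    (if head Q a = tail Q b then single (tail Q a, [a, b], head Q b) 1 else 0)"
  by (simp add: arrow_elem_def path_elem_def)

text \<open>The relations written as explicit combinations of paths. The fourth case is due to pairs
  of arrows that do not compose, whose product is zero.\<close>

lemma defining_relations_cases:
  assumes "x \<in> defining_relations Q S"
  obtains (difference) C C' where "C \<in> S" "C' \<in> S" "tail Q (hd C) = tail Q (hd C')"
      "x = single (tail Q (hd C), C, tail Q (hd C)) 1 - single (tail Q (hd C), C', tail Q (hd C)) 1"
  | (full) C where "C \<in> S" "x = single (tail Q (hd C), C @ [hd C], head Q (hd C)) 1"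
  | (pair) a b where "a \<in> arcs Q" "b \<in> arcs Q" "\<nexists>d. [a, b] @ d \<in> S" "head Q a = tail Q b"
      "x = single (tail Q a, [a, b], head Q b) 1"
  | (zero) "x = 0"
proof -
  have "(\<exists>C C'. x = path_elem Q C - path_elem Q C' \<and> C \<in> S \<and> C' \<in> S \<and>
      tail Q (hd C) = tail Q (hd C')) \<or>
    (\<exists>C. x = path_elem Q (C @ [hd C]) \<and> C \<in> S) \<or>
    (\<exists>a b. x = arrow_elem Q a \<otimes>\<^bsub>path_algebra Q\<^esub> arrow_elem Q b \<and> a \<in> arcs Q \<and> b \<in> arcs Q \<and>
      \<not> (\<exists>C\<in>S. sublist [a, b] C))"
    using assms unfolding defining_relations_def by blast
  then show ?thesis
  proof (elim disjE exE conjE)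
    fix C C' assume "x = path_elem Q C - path_elem Q C'" "C \<in> S" "C' \<in> S"
      "tail Q (hd C) = tail Q (hd C')"
    then show ?thesis
      using difference[of C C'] by (simp add: path_elem_S)
  next
    fix C assume "x = path_elem Q (C @ [hd C])" "C \<in> S"
    then show ?thesis
      using full[of C] by (simp add: path_elem_S_snoc)
  next
    fix a b assume "x = arrow_elem Q a \<otimes>\<^bsub>path_algebra Q\<^esub> arrow_elem Q b" "a \<in> arcs Q" "b \<in> arcs Q"
      "\<not> (\<exists>C\<in>S. sublist [a, b] C)"
    then show ?thesis
      using pair[of a b] zero unfolding sublist_S_iff arrow_elem_mult
      by (cases "head Q a = tail Q b") simp_all
  qed
qed

lemma defining_relations_long:
  "(defining_relations Q S :: (_ \<Rightarrow>\<^sub>0 'k::field) set) \<subseteq>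
    {x. keys x \<subseteq> {p \<in> paths Q. 1 \<le> length (fst (snd p))}}"
proof
  fix x :: "('v, 'e) path \<Rightarrow>\<^sub>0 'k"
  assume "x \<in> defining_relations Q S"
  then have "keys x \<subseteq> {p \<in> paths Q. 1 \<le> length (fst (snd p))}"
  proof (cases rule: defining_relations_cases)
    case (difference C C')
    have "length C \<ge> 1" "length C' \<ge> 1"
      using S_nonempty[OF difference(1)] S_nonempty[OF difference(2)] by (simp_all add: Suc_le_eq)
    then show ?thesis
      unfolding difference(4)
      using S_path[OF difference(1)] S_path[OF difference(2)] difference(3)
      by (intro keys_diff_closed) simp_all
  next
    case (full C)
    then show ?thesis
      using S_snoc_path[OF full(1)] by simp
  next
    case (pair a b)
    have "(tail Q a, [a] @ [b], head Q b) \<in> paths Q"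
      using arrow_in_paths[OF pair(1)] arrow_in_paths[OF pair(2)] pair(4)
      by (intro paths_appendI) simp_all
    then show ?thesis
      by (simp add: pair(5))
  qed simp
  then show "x \<in> {x. keys x \<subseteq> {p \<in> paths Q. 1 \<le> length (fst (snd p))}}"
    by simp
qed

lemma defining_relations_subset_carrier:
  "(defining_relations Q S :: (_ \<Rightarrow>\<^sub>0 'k::field) set) \<subseteq> carrier (path_algebra Q)"
proof
  fix x :: "('v, 'e) path \<Rightarrow>\<^sub>0 'k"
  assume "x \<in> defining_relations Q S"
  then have "keys x \<subseteq> {p \<in> paths Q. 1 \<le> length (fst (snd p))}"
    using defining_relations_long by blast
  then show "x \<in> carrier (path_algebra Q)"
    by auto
qed

section \<open>The ideal of relations and the role of indecomposability\<close>

definition relation_ideal :: "(('v, 'e) path \<Rightarrow>\<^sub>0 'k::field) set" where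
  "relation_ideal = genideal (path_algebra Q) (defining_relations Q S)"

lemma ideal_relation_ideal: "ideal (relation_ideal :: (_ \<Rightarrow>\<^sub>0 'k::field) set) (path_algebra Q)"
proof -
  interpret ring "path_algebra Q :: ('k, _) module" by (rule ring_path_algebra)
  show ?thesis
    unfolding relation_ideal_def by (rule genideal_ideal[OF defining_relations_subset_carrier])
qed

lemma defining_relation_in_ideal:
  "(x :: _ \<Rightarrow>\<^sub>0 'k::field) \<in> defining_relations Q S \<Longrightarrow> x \<in> relation_ideal"
proof -
  interpret ring "path_algebra Q :: ('k, _) module" by (rule ring_path_algebra)
  show "x \<in> defining_relations Q S \<Longrightarrow> x \<in> relation_ideal"
    unfolding relation_ideal_def using genideal_self[OF defining_relations_subset_carrier] by blast
qed

lemma relation_ideal_zero: "0 \<in> relation_ideal"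
  using additive_subgroup.zero_closed[OF ideal.axioms(1)[OF ideal_relation_ideal]] by simp

lemma relation_ideal_add: "x \<in> relation_ideal \<Longrightarrow> y \<in> relation_ideal \<Longrightarrow> x + y \<in> relation_ideal"
  using additive_subgroup.a_closed[OF ideal.axioms(1)[OF ideal_relation_ideal], of x y] by simp

lemma relation_ideal_scal: "x \<in> relation_ideal \<Longrightarrow> scal c x \<in> relation_ideal"
proof -
  assume x: "x \<in> relation_ideal"
  interpret algebra_ideal relation_ideal "path_algebra Q"
    by (intro algebra_ideal.intro algebra_ideal_axioms.intro ideal_relation_ideal k_algebra_path_algebra)
  show ?thesis using ideal_smult[OF x] by simp
qed

lemma algebra_ideal_relation_ideal:
  "algebra_ideal (relation_ideal :: (_ \<Rightarrow>\<^sub>0 'k::field) set) (path_algebra Q)"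
  by (intro algebra_ideal.intro algebra_ideal_axioms.intro ideal_relation_ideal k_algebra_path_algebra)

lemma k_algebra_defined_algebra: "k_algebra (defined_algebra Q S :: ('k::field, _) module)"
proof -
  interpret algebra_ideal relation_ideal "path_algebra Q :: ('k, _) module"
    by (rule algebra_ideal_relation_ideal)
  show ?thesis
    using k_algebra_quot unfolding defined_algebra_def relation_ideal_def .
qed

text \<open>Coefficients at trivial paths are therefore invariants of cosets, which is how the
  idempotents of the vertices are told apart from zero and one.\<close>

lemma relation_ideal_long:
  "(relation_ideal :: (_ \<Rightarrow>\<^sub>0 'k::field) set) \<subseteq>
    {x. keys x \<subseteq> {p \<in> paths Q. 1 \<le> length (fst (snd p))}}"
proof -
  interpret ring "path_algebra Q :: ('k, _) module" by (rule ring_path_algebra)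
  show ?thesis
    unfolding relation_ideal_def
    by (rule genideal_minimal[OF ideal_long_paths defining_relations_long])
qed

text \<open>On its cycle every arrow is followed by another one, so a vertex where no arrow starts
  is one where no arrow ends. Its trivial path would be a central idempotent, nonzero and, as there
  are arrows at other vertices, different from one.\<close>

lemma vertex_arrow_if_indecomposable:
  assumes indec: "indecomposable_algebra (defined_algebra Q S :: ('k::field, _) module)"
    and "arcs Q \<noteq> {}" and v: "v \<in> verts Q"
  shows "\<exists>a\<in>arcs Q. tail Q a = v"
proof (rule ccontr)
  assume "\<not> (\<exists>a\<in>arcs Q. tail Q a = v)"
  then have no_tail: "tail Q a \<noteq> v" if "a \<in> arcs Q" for a
    using that by blast
  have no_head: "head Q a \<noteq> v" if a: "a \<in> arcs Q" for a
  proof -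
    obtain p where p: "a # p \<in> S"
      using S_start[OF a] by blast
    then obtain b p' where "p = b # p'"
      using S_length[OF p] by (cases p) simp_all
    then show ?thesis
      using S_path[OF p] no_tail[of b] by (auto simp: paths_Cons_iff)
  qed
  have ends: "u \<noteq> v \<and> w \<noteq> v" if p: "(u, p, w) \<in> paths Q" and ne: "p \<noteq> []" for u p w
  proof
    show "u \<noteq> v"
      using p ne no_tail by (cases p) (auto simp: paths_Cons_iff)
    obtain p' b where p': "p = p' @ [b]"
      using ne by (metis append_butlast_last_id)
    obtain x where "(x, [b], w) \<in> paths Q"
      using p unfolding p' by (rule paths_appendE)
    then show "w \<noteq> v"
      using no_head by (auto simp: paths_Cons_iff paths_Nil)
  qed
  interpret algebra_ideal relation_ideal "path_algebra Q :: ('k, _) module"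
    by (rule algebra_ideal_relation_ideal)
  let ?e = "single (v, [], v) (1 :: 'k)"
  let ?one = "\<Sum>v\<in>verts Q. single (v, [], v) (1 :: 'k)"
  have e: "keys ?e \<subseteq> paths Q"
    using v by (simp add: paths_Nil)
  have one: "keys ?one \<subseteq> paths Q"
    by (rule keys_one)
  \<comment> \<open>The trivial path is the only path that starts or ends at
    \<open>v\<close>.\<close>
  have central: "?e \<star> x = x \<star> ?e" if "keys x \<subseteq> paths Q" for x
    using that
  proof (induction x rule: keys_subset_induct)
    case (single p c)
    obtain u p' w where p: "p = (u, p', w)" by (cases p)
    show ?case
      using single ends[of u p' w] by (cases "p' = []") (auto simp: p paths_Nil)
  qed (simp_all add: pmul_add_left pmul_add_right)
  let ?E = "relation_ideal +>\<^bsub>path_algebra Q\<^esub> ?e"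
  have E: "?E \<in> carrier quot"
    unfolding quot_carrier using e by simp
  have idem: "?E \<otimes>\<^bsub>quot\<^esub> ?E = ?E"
    using quot_mult[of ?e ?e] e by (simp del: quotient_algebra_fields)
  have "?E \<otimes>\<^bsub>quot\<^esub> X = X \<otimes>\<^bsub>quot\<^esub> ?E" if X: "X \<in> carrier quot" for X
  proof -
    obtain x where x: "keys x \<subseteq> paths Q" "X = relation_ideal +>\<^bsub>path_algebra Q\<^esub> x"
      using X unfolding quot_carrier by auto
    show ?thesis
      unfolding x(2) using quot_mult[of ?e x] quot_mult[of x ?e] e x(1) central[OF x(1)]
      by (simp del: quotient_algebra_fields)
  qed
  then have "?E = \<zero>\<^bsub>quot\<^esub> \<or> ?E = \<one>\<^bsub>quot\<^esub>"
    using indec E idem unfolding indecomposable_algebra_def defined_algebra_def relation_ideal_def by blast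
  then have or: "?e - 0 \<in> relation_ideal \<or> ?e - ?one \<in> relation_ideal"
    using coset_eq_iff[of ?e 0] coset_eq_iff[of ?e ?one] e one
      path_algebra_minus[OF e, of 0] path_algebra_minus[OF e one]
    unfolding quot_zero quot_one by simp
  have *: "lookup x (u, [], u) = 0" if "x \<in> relation_ideal" for x :: "_ \<Rightarrow>\<^sub>0 'k" and u
  proof (rule ccontr)
    assume "lookup x (u, [], u) \<noteq> 0"
    then have "(u, [], u) \<in> keys x"
      by (simp add: in_keys_iff)
    moreover have "keys x \<subseteq> {p \<in> paths Q. 1 \<le> length (fst (snd p))}"
      using that relation_ideal_long by blast
    ultimately show False by auto
  qed
  obtain a where a: "a \<in> arcs Q"
    using assms(2) by blast
  \<comment> \<open>The tail of an arrow is a vertex other than \<open>v\<close>, so the unit has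
    coefficient 1 there and \<open>?e\<close> has coefficient 0.\<close>
  have coeff: "lookup (?e - ?one) (tail Q a, [], tail Q a) = - 1"
    using no_tail[OF a] a
    by (simp add: lookup_minus lookup_sum lookup_single when_def sum.delta)
  show False
    using or
  proof
    assume "?e - 0 \<in> relation_ideal"
    from *[OF this, of v] show False by simp
  next
    assume "?e - ?one \<in> relation_ideal"
    from *[OF this, of "tail Q a"] show False unfolding coeff by simp
  qed
qed

lemma verts_nonempty_if_indecomposable:
  assumes "indecomposable_algebra (defined_algebra Q S :: ('k::field, _) module)"
  shows "verts Q \<noteq> {}"
proof
  assume empty: "verts Q = {}"
  interpret algebra_ideal relation_ideal "path_algebra Q :: ('k, _) module"
    by (rule algebra_ideal_relation_ideal)
  have "\<zero>\<^bsub>quot\<^esub> = \<one>\<^bsub>quot\<^esub>"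
    unfolding quot_zero quot_one by (simp add: empty)
  then show False
    using assms unfolding indecomposable_algebra_def defined_algebra_def relation_ideal_def by simp
qed

end

text \<open>An isolated vertex would leave its trivial path in the radical of the form. The added
  assumption excludes this and is supplied by \<open>vertex_arrow_if_indecomposable\<close>.\<close>

locale cycle_quiver = cycle_set Q S for Q :: "('v, 'e) pre_digraph" and S +
  assumes vertex_arrow: "v \<in> verts Q \<Longrightarrow> \<exists>a\<in>arcs Q. tail Q a = v"
begin

lemma S_at_vertex: "v \<in> verts Q \<Longrightarrow> \<exists>C\<in>S. tail Q (hd C) = v"
proof -
  assume "v \<in> verts Q"
  then obtain a where "a \<in> arcs Q" "tail Q a = v"
    using vertex_arrow by blast
  moreover obtain p where "a # p \<in> S"
    using S_start \<open>a \<in> arcs Q\<close> by blast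
  ultimately show ?thesis
    by (intro bexI[of _ "a # p"]) simp_all
qed

lemma complement_path:
  assumes "(u, p, v) \<in> paths Q" "p \<noteq> []" "p @ c \<in> S"
  shows "(v, c, u) \<in> paths Q"
proof -
  have "(tail Q (hd (p @ c)), p @ c, tail Q (hd (p @ c))) \<in> paths Q"
    using assms(3) by (rule S_path)
  then have "(u, p @ c, u) \<in> paths Q"
    using assms(1,2) paths_tail_hd[OF assms(1)] by simp
  then obtain w where w: "(u, p, w) \<in> paths Q" "(w, c, u) \<in> paths Q"
    by (rule paths_appendE)
  then show ?thesis
    using paths_target[OF assms(1) w(1)] by simp
qed

text \<open>The Gram matrix of the symmetrizing form on the basis of paths: the entry is 1 where
  \<open>closes\<close> holds and 0 elsewhere, see \<open>trace_single_pmul\<close>.\<close>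

definition closes :: "('v, 'e) path \<Rightarrow> ('v, 'e) path \<Rightarrow> bool" where
  "closes p q \<longleftrightarrow> snd (snd p) = fst q \<and> fst p = snd (snd q) \<and> fst (snd p) @ fst (snd q) \<in> S"

lemma closes_simp [simp]: "closes (u, p, v) (v', q, w) \<longleftrightarrow> v = v' \<and> u = w \<and> p @ q \<in> S"
  by (simp add: closes_def)

text \<open>The symmetrizing form \<open>t\<close>.\<close>

definition trace :: "(('v, 'e) path \<Rightarrow>\<^sub>0 'k::field) \<Rightarrow> 'k" where
  "trace x = (\<Sum>C\<in>S. lookup x (tail Q (hd C), C, tail Q (hd C)))"

lemma trace_linear [simp]:
  "trace 0 = 0" "trace (x + y) = trace x + trace y" "trace (x - y) = trace x - trace y"
  "trace (scal c x) = c * trace x" "trace (\<Sum>i\<in>F. f i) = (\<Sum>i\<in>F. trace (f i))"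
proof -
  show "trace (\<Sum>i\<in>F. f i) = (\<Sum>i\<in>F. trace (f i))"
    by (simp add: trace_def lookup_sum sum.swap[of _ F])
qed (simp_all add: trace_def lookup_add lookup_minus sum.distrib sum_subtractf sum_distrib_left)

lemma trace_single:
  assumes "(u, p, v) \<in> paths Q"
  shows "trace (single (u, p, v) c) = (if p \<in> S then c else 0)"
proof -
  \<comment> \<open>A nonempty list of arrows determines its endpoints, so the comparison of triples
    reduces to that of lists.\<close>
  have *: "(u, p, v) = (tail Q (hd C), C, tail Q (hd C)) \<longleftrightarrow> p = C" if "C \<in> S" for C
    using path_in_S[OF assms] that by auto
  have "trace (single (u, p, v) c) = (\<Sum>C\<in>S. if p = C then c else 0)"
    unfolding trace_def lookup_single when_def by (rule sum.cong[OF refl]) (simp only: *)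
  then show ?thesis
    using finite_S by simp
qed

lemma trace_single_pmul:
  assumes "p \<in> paths Q" "q \<in> paths Q"
  shows "trace (single p a \<star> single q b) = (if closes p q then a * b else 0)"
proof -
  obtain u p' v v' q' w where pq: "p = (u, p', v)" "q = (v', q', w)"
    by (cases p; cases q)
  show ?thesis
  proof (cases "v = v'")
    case True
    then have path: "(u, p' @ q', w) \<in> paths Q"
      using assms paths_appendI by (simp add: pq)
    have "p' @ q' \<in> S \<Longrightarrow> u = w"
      using path_in_S[OF path] by simp
    then show ?thesis
      using True by (auto simp: pq trace_single[OF path])
  qed (simp add: pq)
qed

lemma closes_commute: "closes p q \<longleftrightarrow> closes q p"
  by (cases p; cases q) (auto intro: S_swap)

lemma trace_commute:
  assumes "keys x \<subseteq> paths Q" "keys y \<subseteq> paths Q"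
  shows "trace (x \<star> y) = trace (y \<star> x)"
  using assms(1)
proof (induction x rule: keys_subset_induct)
  case (single p a)
  show ?case
    using assms(2)
  proof (induction y rule: keys_subset_induct)
    case (single q b)
    then show ?case
      using \<open>p \<in> paths Q\<close> by (simp add: trace_single_pmul closes_commute mult.commute)
  qed (simp_all add: pmul_add_left pmul_add_right)
qed (simp_all add: pmul_add_left pmul_add_right)

text \<open>Pairing with a partner that closes up with \<open>p\<close> alone isolates one
  coefficient. The nondegeneracy arguments all end here.\<close>

lemma trace_pmul_single_eq_lookup:
  assumes "keys x \<subseteq> paths Q" "q \<in> paths Q"
    and "\<And>p'. p' \<in> keys x \<Longrightarrow> closes p' q \<longleftrightarrow> p' = p"
  shows "trace (x \<star> single q 1) = lookup x p"
proof -
  have "trace (x \<star> single q 1) = trace ((\<Sum>r\<in>keys x. single r (lookup x r)) \<star> single q 1)"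
    using poly_mapping_sum_singles[of x] by simp
  also have "\<dots> = (\<Sum>r\<in>keys x. if closes r q then lookup x r else 0)"
    unfolding pmul_sum_left trace_linear
    using assms(1,2) by (intro sum.cong refl) (auto simp: trace_single_pmul)
  also have "\<dots> = (\<Sum>r\<in>keys x. if r = p then lookup x r else 0)"
    using assms(3) by (intro sum.cong refl) simp
  also have "\<dots> = lookup x p"
    by (simp add: in_keys_iff)
  finally show ?thesis .
qed

text \<open>A trivial path is partnered with any cycle at its vertex, a proper piece with the rest
  of its cycle; cancellation in \<open>S\<close> makes the pairing exclusive. Full cycles are left
  out because all cycles at a vertex close up with the same trivial path.\<close>

lemma complement_exists:
  assumes "(u, p, v) \<in> paths Q" "p = [] \<or> (\<exists>c. c \<noteq> [] \<and> p @ c \<in> S)"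
  shows "\<exists>q\<in>paths Q. closes (u, p, v) q \<and> (\<forall>p'\<in>paths Q. closes p' q \<longleftrightarrow> p' = (u, p, v))"
proof (cases "p = []")
  case True
  then have uv: "u = v" "u \<in> verts Q"
    using assms(1) True by (auto simp: paths_Nil)
  then obtain C where C: "C \<in> S" "tail Q (hd C) = u"
    using S_at_vertex by blast
  have path: "(u, C, u) \<in> paths Q"
    using S_path[OF C(1)] C(2) by simp
  have "r @ C \<in> S \<longleftrightarrow> r = []" for r
    using S_append_iff[OF C(1), of r] S_swap_iff[of r C] by simp
  then have "closes p' (u, C, u) \<longleftrightarrow> p' = (u, [], u)" for p'
    by (cases p') auto
  then show ?thesis
    using path by (intro bexI[OF _ path]) (simp add: uv True)
next
  case False
  then obtain c where c: "c \<noteq> []" "p @ c \<in> S"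
    using assms(2) by blast
  have path: "(v, c, u) \<in> paths Q"
    using complement_path[OF assms(1) False c(2)] .
  have "r @ c \<in> S \<longleftrightarrow> r = p" for r
    using c(2) S_cancel_right[OF _ c(2) c(1), of r] by blast
  then have "closes p' (v, c, u) \<longleftrightarrow> p' = (u, p, v)" for p'
    by (cases p') auto
  then show ?thesis
    by (intro bexI[OF _ path]) simp
qed

text \<open>Stated for a subquiver \<open>H\<close> so that it applies both to \<open>Q\<close> and to the quiver obtained by
  removing arrows; in the latter case no cycle of \<open>S\<close> survives and \<open>full\<close> is vacuous.\<close>

lemma path_dichotomy:
  fixes J :: "(('v, 'e) path \<Rightarrow>\<^sub>0 'k::field) set"
  assumes H: "fin_digraph H" "tail H = tail Q" "head H = head Q" "arcs H \<subseteq> arcs Q"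
    and J: "ideal J (path_algebra H)"
    and pairs: "\<And>a b. a \<in> arcs H \<Longrightarrow> b \<in> arcs H \<Longrightarrow> head Q a = tail Q b \<Longrightarrow>
      \<nexists>d. [a, b] @ d \<in> S \<Longrightarrow> single (tail Q a, [a, b], head Q b) 1 \<in> J"
    and full: "\<And>C. C \<in> S \<Longrightarrow> set C \<subseteq> arcs H \<Longrightarrow>
      single (tail Q (hd C), C @ [hd C], head Q (hd C)) 1 \<in> J"
    and p: "(u, p, v) \<in> paths H" "p \<noteq> []"
  shows "single (u, p, v) 1 \<in> J \<or> (\<exists>c. p @ c \<in> S)"
  using p
proof (induction p arbitrary: v rule: rev_induct)
  case (snoc b p)
  interpret H: fin_digraph H by (rule H(1))
  interpret J: ideal J "path_algebra H" by (rule J)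
  obtain m where m: "(u, p, m) \<in> paths H" "(m, [b], v) \<in> paths H"
    using snoc.prems(1) by (rule H.paths_appendE)
  then have b: "b \<in> arcs H" "m = tail Q b" "v = head Q b"
    using H(2,3) by (simp_all add: H.paths_Cons_iff H.paths_Nil)
  show ?case
  proof (cases "p = []")
    case True
    then show ?thesis
      using S_start[of b] b(1) H(4) by auto
  next
    case False
    then obtain p' a where p: "p = p' @ [a]"
      by (metis append_butlast_last_id)
    obtain l where l: "(u, p', l) \<in> paths H" "(l, [a], m) \<in> paths H"
      using m(1) unfolding p by (rule H.paths_appendE)
    then have a: "a \<in> arcs H" "l = tail Q a" "m = head Q a"
      using H(2,3) by (simp_all add: H.paths_Cons_iff H.paths_Nil)
    consider "single (u, p, m) 1 \<in> J" | c where "p @ c \<in> S" "\<nexists>d. [a, b] @ d \<in> S"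
      | c d where "p @ c \<in> S" "[a, b] @ d \<in> S"
      using snoc.IH[OF m(1) False] by blast
    then show ?thesis
    proof cases
      case 1
      have "single (u, p, m) 1 \<star> single (m, [b], v) 1 \<in> J"
        using J.I_r_closed[OF 1, of "single (m, [b], v) 1"] m(2) by simp
      then show ?thesis by simp
    next
      case 2
      have "single (tail Q a, [a, b], head Q b) 1 \<in> J"
        using pairs[OF a(1) b(1)] a b 2 by simp
      then have "single (u, p', l) 1 \<star> single (tail Q a, [a, b], head Q b) 1 \<in> J"
        using J.I_l_closed[of _ "single (u, p', l) 1"] l(1) by (simp del: pmul_single)
      then show ?thesis
        by (simp add: a b p)
    next
      case 3
      \<comment> \<open>Rotated to start with \<open>a\<close>, the cycle through \<open>p\<close>
        and the cycle through \<open>a\<close> and \<open>b\<close> coincide. Thus \<open>b\<close>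
        continues along the cycle of \<open>p\<close>, or, if \<open>c\<close> is empty,
        \<open>p\<close> has gone around once and \<open>b\<close> is its first arrow.\<close>
      then have "[a] @ c @ p' \<in> S" "[a] @ b # d \<in> S"
        using S_swap[of p' "[a] @ c"] by (simp_all add: p)
      then have eq: "c @ p' = b # d"
        by (rule S_cancel_left) simp
      show ?thesis
      proof (cases c)
        case Nil
        then have "p \<in> S" "hd p = b"
          using 3 eq p by simp_all
        then have "single (u, p @ [b], v) 1 \<in> J"
          using full[of p] H.paths_arcs[OF m(1)] H.paths_tail_hd[OF m(1) False] b H(2) by simp
        then show ?thesis ..
      next
        case (Cons b' c')
        then have "(p @ [b]) @ c' \<in> S"
          using 3 eq by simp
        then show ?thesis by blast
      qed
    qed
  qed
qed simp

section \<open>The radical of the symmetrizing form\<close>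

definition radical :: "(('v, 'e) path \<Rightarrow>\<^sub>0 'k::field) set" where
  "radical = {z. keys z \<subseteq> paths Q \<and> (\<forall>y. keys y \<subseteq> paths Q \<longrightarrow> trace (z \<star> y) = 0)}"

text \<open>Multiplication on the right is absorbed by associativity. On the left, symmetry of the
  form moves the factor to the other end.\<close>

lemma ideal_radical: "ideal (radical :: (_ \<Rightarrow>\<^sub>0 'k::field) set) (path_algebra Q)"
proof (rule path_idealI)
  fix x y :: "('v, 'e) path \<Rightarrow>\<^sub>0 'k"
  assume x: "x \<in> radical" and y: "keys y \<subseteq> paths Q"
  have kx: "keys x \<subseteq> paths Q"
    using x by (simp add: radical_def)
  have "trace (y \<star> x \<star> z) = 0" if z: "keys z \<subseteq> paths Q" for z
  proof -
    have "trace (y \<star> x \<star> z) = trace (x \<star> (z \<star> y))"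
      using trace_commute[OF y keys_pmul_closed[OF kx z]] by (simp add: pmul_assoc)
    also have "\<dots> = 0"
      using x keys_pmul_closed[OF z y] by (simp add: radical_def)
    finally show ?thesis .
  qed
  then show "y \<star> x \<in> radical"
    using keys_pmul_closed[OF y kx] by (simp add: radical_def)
  have "trace (x \<star> y \<star> z) = 0" if z: "keys z \<subseteq> paths Q" for z
    using x keys_pmul_closed[OF y z] by (simp add: radical_def pmul_assoc)
  then show "x \<star> y \<in> radical"
    using keys_pmul_closed[OF kx y] by (simp add: radical_def)
qed (simp_all add: radical_def pmul_add_left keys_add_closed)

lemma radicalI:
  assumes "keys z \<subseteq> paths Q" "\<And>q. q \<in> paths Q \<Longrightarrow> trace (z \<star> single q 1) = 0"
  shows "z \<in> radical"
proof -
  have "trace (z \<star> y) = 0" if "keys y \<subseteq> paths Q" for y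
    using that
  proof (induction y rule: keys_subset_induct)
    case (single q c)
    have "z \<star> single q c = scal c (z \<star> single q 1)"
      using pmul_scal_right[of z c "single q 1"] by simp
    then show ?case
      using assms(2)[OF single] by simp
  qed (simp_all add: pmul_add_right)
  then show ?thesis
    using assms(1) by (simp add: radical_def)
qed

text \<open>Two cycles at the same vertex close up with exactly the same paths, namely the trivial
  one there. The paths in the other relations are not completable to a cycle at all.\<close>

lemma defining_relations_subset_radical: "(defining_relations Q S :: (_ \<Rightarrow>\<^sub>0 'k::field) set) \<subseteq> radical"
proof
  fix x :: "('v, 'e) path \<Rightarrow>\<^sub>0 'k"
  assume "x \<in> defining_relations Q S"
  then show "x \<in> radical"
  proof (cases rule: defining_relations_cases)
    case (difference C C')
    let ?v = "tail Q (hd C)"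
    have paths: "(?v, C, ?v) \<in> paths Q" "(?v, C', ?v) \<in> paths Q"
      using S_path[OF difference(1)] S_path[OF difference(2)] difference(3) by simp_all
    show ?thesis
    proof (rule radicalI)
      show "keys x \<subseteq> paths Q"
        unfolding difference(4) using paths by (intro keys_diff_closed) simp_all
      fix q assume "q \<in> paths Q"
      moreover have "closes (?v, C, ?v) q \<longleftrightarrow> closes (?v, C', ?v) q"
        using S_append_iff[OF difference(1)] S_append_iff[OF difference(2)] by (cases q) auto
      ultimately show "trace (x \<star> single q 1) = 0"
        unfolding difference(4) pmul_diff_left using paths by (simp add: trace_single_pmul)
    qed
  next
    case (full C)
    have path: "(tail Q (hd C), C @ [hd C], head Q (hd C)) \<in> paths Q"
      using S_snoc_path[OF full(1)] .
    show ?thesis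
    proof (rule radicalI)
      show "keys x \<subseteq> paths Q"
        using path by (simp add: full(2))
      fix q assume q: "q \<in> paths Q"
      have "\<not> closes (tail Q (hd C), C @ [hd C], head Q (hd C)) q"
        using S_append_iff[OF full(1)] by (cases q) auto
      then show "trace (x \<star> single q 1) = 0"
        using trace_single_pmul[OF path q] by (simp add: full(2))
    qed
  next
    case (pair a b)
    have path: "(tail Q a, [a, b], head Q b) \<in> paths Q"
      using paths_appendI[OF arrow_in_paths[OF pair(1)], of "[b]" "head Q b"]
        arrow_in_paths[OF pair(2)] pair(4) by simp
    show ?thesis
    proof (rule radicalI)
      show "keys x \<subseteq> paths Q"
        using path by (simp add: pair(5))
      fix q assume q: "q \<in> paths Q"
      have "\<not> closes (tail Q a, [a, b], head Q b) q"
        using pair(3) by (cases q) auto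
      then show "trace (x \<star> single q 1) = 0"
        using trace_single_pmul[OF path q] by (simp add: pair(5))
    qed
  next
    case zero
    then show ?thesis
      by (simp add: radical_def)
  qed
qed

section \<open>Normal forms modulo the relations\<close>

definition vertex_cycle :: "'v \<Rightarrow> 'e list" where
  "vertex_cycle v = (SOME C. C \<in> S \<and> tail Q (hd C) = v)"

lemma vertex_cycle:
  assumes "v \<in> verts Q"
  shows "vertex_cycle v \<in> S \<and> tail Q (hd (vertex_cycle v)) = v"
proof -
  have "\<exists>C. C \<in> S \<and> tail Q (hd C) = v"
    using S_at_vertex[OF assms] by blast
  from someI_ex[OF this] show ?thesis
    unfolding vertex_cycle_def .
qed

text \<open>Representatives of a basis of the quotient. All cycles at a vertex become equal there,
  so one of them is kept beside the trivial paths and the proper pieces of cycles.\<close>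

definition normal_paths :: "('v, 'e) path set" where
  "normal_paths = {(u, p, v). (u, p, v) \<in> paths Q \<and>
    (p = [] \<or> (\<exists>c. c \<noteq> [] \<and> p @ c \<in> S) \<or> p = vertex_cycle u)}"

lemma normal_form_single:
  assumes "(u, p, v) \<in> paths Q"
  shows "\<exists>n :: _ \<Rightarrow>\<^sub>0 'k::field. keys n \<subseteq> normal_paths \<and> single (u, p, v) 1 - n \<in> relation_ideal"
proof (cases "(u, p, v) \<in> normal_paths")
  case True
  then show ?thesis
    using relation_ideal_zero by (intro exI[of _ "single (u, p, v) 1"]) simp
next
  case False
  then have ne: "p \<noteq> []" and not_proper: "\<nexists>c. c \<noteq> [] \<and> p @ c \<in> S"
    using assms by (auto simp: normal_paths_def)
  have "single (u, p, v) (1 :: 'k) \<in> relation_ideal \<or> (\<exists>c. p @ c \<in> S)"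
  proof (rule path_dichotomy[OF _ _ _ _ ideal_relation_ideal _ _ assms ne])
    show "fin_digraph Q" by unfold_locales
    fix a b assume *: "a \<in> arcs Q" "b \<in> arcs Q" "head Q a = tail Q b" "\<nexists>d. [a, b] @ d \<in> S"
    have "arrow_elem Q a \<otimes>\<^bsub>path_algebra Q\<^esub> arrow_elem Q b \<in> defining_relations Q S"
      using *(1,2,4) unfolding defining_relations_def sublist_S_iff by blast
    then show "single (tail Q a, [a, b], head Q b) (1 :: 'k) \<in> relation_ideal"
      using *(3) unfolding arrow_elem_mult by (intro defining_relation_in_ideal) simp
  next
    fix C assume C: "C \<in> S"
    have "path_elem Q (C @ [hd C]) \<in> defining_relations Q S"
      using C unfolding defining_relations_def by blast
    then show "single (tail Q (hd C), C @ [hd C], head Q (hd C)) (1 :: 'k) \<in> relation_ideal"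
      unfolding path_elem_S_snoc[OF C] by (rule defining_relation_in_ideal)
  qed simp_all
  then show ?thesis
  proof
    assume "single (u, p, v) (1 :: 'k) \<in> relation_ideal"
    then show ?thesis
      by (intro exI[of _ 0]) simp
  next
    assume "\<exists>c. p @ c \<in> S"
    then have p: "p \<in> S"
      using not_proper by (metis append_Nil2)
    have u: "u \<in> verts Q" "u = tail Q (hd p)" "v = u"
      using paths_verts[OF assms] path_in_S[OF assms p] by simp_all
    have C: "vertex_cycle u \<in> S" "tail Q (hd (vertex_cycle u)) = u"
      using vertex_cycle[OF u(1)] by simp_all
    have "tail Q (hd p) = tail Q (hd (vertex_cycle u))"
      using C(2) u(2) by simp
    then have "path_elem Q p - path_elem Q (vertex_cycle u) \<in> defining_relations Q S"
      using p C(1) unfolding defining_relations_def by blast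
    then have "single (u, p, v) (1 :: 'k) - single (u, vertex_cycle u, u) 1 \<in> relation_ideal"
      using u(2,3) C(2) unfolding path_elem_S[OF p] path_elem_S[OF C(1)]
      by (intro defining_relation_in_ideal) simp
    moreover have "(u, vertex_cycle u, u) \<in> normal_paths"
      using S_path[OF C(1)] C(2) by (simp add: normal_paths_def)
    ultimately show ?thesis
      by (intro exI[of _ "single (u, vertex_cycle u, u) 1"]) simp
  qed
qed

lemma normal_form_exists:
  fixes x :: "('v, 'e) path \<Rightarrow>\<^sub>0 'k::field"
  assumes "keys x \<subseteq> paths Q"
  shows "\<exists>n. keys n \<subseteq> normal_paths \<and> x - n \<in> relation_ideal"
  using assms
proof (induction x rule: keys_subset_induct)
  case zero
  show ?case using relation_ideal_zero by (intro exI[of _ 0]) simp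
next
  case (single p c)
  obtain u p' v where p: "p = (u, p', v)" by (cases p)
  obtain n :: "('v, 'e) path \<Rightarrow>\<^sub>0 'k"
    where n: "keys n \<subseteq> normal_paths" "single p 1 - n \<in> relation_ideal"
    using normal_form_single[of u p' v] single unfolding p by blast
  have "scal c (single p 1 - n) = single p c - scal c n"
    by (rule poly_mapping_eqI) (simp add: lookup_minus lookup_single when_def algebra_simps)
  then have "single p c - scal c n \<in> relation_ideal"
    using relation_ideal_scal[OF n(2), of c] by simp
  then show ?case
    using keys_scal_closed[OF n(1)] by blast
next
  case (add x y)
  then obtain n m where n: "keys n \<subseteq> normal_paths" "x - n \<in> relation_ideal"
    and m: "keys m \<subseteq> normal_paths" "y - m \<in> relation_ideal"
    by blast
  have "(x - n) + (y - m) = (x + y) - (n + m)" by simp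
  then have "(x + y) - (n + m) \<in> relation_ideal"
    using relation_ideal_add[OF n(2) m(2)] by (simp only:)
  then show ?case
    using keys_add_closed[OF n(1) m(1)] by blast
qed

text \<open>Beyond \<open>complement_exists\<close> there is only the chosen cycle of a vertex. Its
  partner is the trivial path, which every cycle at the vertex would close up with, but only one of
  these is normal.\<close>

lemma normal_complement:
  assumes "p \<in> normal_paths"
  shows "\<exists>q\<in>paths Q. \<forall>p'\<in>normal_paths. closes p' q \<longleftrightarrow> p' = p"
proof -
  obtain u p' v where p: "p = (u, p', v)" by (cases p)
  have path: "(u, p', v) \<in> paths Q"
    using assms by (simp add: p normal_paths_def)
  have sub: "normal_paths \<subseteq> paths Q"
    by (auto simp: normal_paths_def)
  show ?thesis
  proof (cases "p' = [] \<or> (\<exists>c. c \<noteq> [] \<and> p' @ c \<in> S)")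
    case True
    then show ?thesis
      using complement_exists[OF path True] sub unfolding p by blast
  next
    case False
    then have p': "p' = vertex_cycle u"
      using assms by (auto simp: p normal_paths_def)
    have u: "u \<in> verts Q"
      using paths_verts[OF path] by simp
    have S: "p' \<in> S"
      using vertex_cycle[OF u] p' by simp
    have v: "v = u"
      using path_in_S[OF path S] by simp
    have "closes r (u, [], u) \<longleftrightarrow> r = p" if r: "r \<in> normal_paths" for r
    proof -
      obtain u' r' v' where r': "r = (u', r', v')" by (cases r)
      have "r' = vertex_cycle u'" if "r' \<in> S"
        using r that S_nonempty[OF that] S_append_iff[OF that] by (auto simp: r' normal_paths_def)
      then show ?thesis
        using S p' v by (auto simp: r' p)
    qed
    then show ?thesis
      using u by (intro bexI[of _ "(u, [], u)"]) (simp_all add: paths_Nil)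
  qed
qed

theorem relation_ideal_eq_radical: "(relation_ideal :: (_ \<Rightarrow>\<^sub>0 'k::field) set) = radical"
proof
  interpret ring "path_algebra Q :: ('k, _) module" by (rule ring_path_algebra)
  show sub: "(relation_ideal :: (_ \<Rightarrow>\<^sub>0 'k) set) \<subseteq> radical"
    unfolding relation_ideal_def
    by (rule genideal_minimal[OF ideal_radical defining_relations_subset_radical])
  show "(radical :: (_ \<Rightarrow>\<^sub>0 'k) set) \<subseteq> relation_ideal"
  proof
    fix z :: "('v, 'e) path \<Rightarrow>\<^sub>0 'k"
    assume z: "z \<in> radical"
    then obtain n where n: "keys n \<subseteq> normal_paths" "z - n \<in> relation_ideal"
      using normal_form_exists[of z] by (auto simp: radical_def)
    have nz: "trace (n \<star> y) = 0" if y: "keys y \<subseteq> paths Q" for y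
    proof -
      have "trace ((z - n) \<star> y) = 0" "trace (z \<star> y) = 0"
        using z sub n(2) y by (auto simp: radical_def)
      then show ?thesis
        by (simp add: pmul_diff_left)
    qed
    have "lookup n p = 0" for p
    proof (rule ccontr)
      assume "lookup n p \<noteq> 0"
      then have "p \<in> normal_paths"
        using n(1) by (auto simp: in_keys_iff)
      then obtain q where q: "q \<in> paths Q" "\<forall>p'\<in>normal_paths. closes p' q \<longleftrightarrow> p' = p"
        using normal_complement by blast
      have "trace (n \<star> single q 1) = lookup n p"
      proof (rule trace_pmul_single_eq_lookup[OF _ q(1)])
        show "keys n \<subseteq> paths Q"
          using n(1) by (auto simp: normal_paths_def)
        show "closes p' q \<longleftrightarrow> p' = p" if "p' \<in> keys n" for p'
          using that n(1) q(2) by blast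
      qed
      then show False
        using nz[of "single q 1"] q(1) \<open>lookup n p \<noteq> 0\<close> by simp
    qed
    then have "n = 0"
      by (intro poly_mapping_eqI) simp
    then show "z \<in> relation_ideal"
      using n(2) by simp
  qed
qed

end

section \<open>Cutting every cycle once\<close>

locale cut_quiver = cycle_quiver Q S for Q :: "('v, 'e) pre_digraph" and S +
  fixes T :: "'e set"
  assumes cut_once: "C \<in> S \<Longrightarrow> \<exists>!a. a \<in> set C \<and> a \<in> T"
begin

lemma S_meets_T: "C \<in> S \<Longrightarrow> set C \<inter> T \<noteq> {}"
  using cut_once[of C] by blast

text \<open>A cut arrow in each piece would have to be the same arrow twice, and a simple cycle has
  no repetitions.\<close>

lemma S_meets_T_once: "p @ q \<in> S \<Longrightarrow> set p \<inter> T = {} \<or> set q \<inter> T = {}"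
proof (rule ccontr)
  assume pq: "p @ q \<in> S" and "\<not> (set p \<inter> T = {} \<or> set q \<inter> T = {})"
  then obtain a b where ab: "a \<in> set p" "a \<in> T" "b \<in> set q" "b \<in> T"
    by blast
  then have "a = b"
    using cut_once[OF pq] by auto
  then show False
    using S_distinct[OF pq] ab by auto
qed

definition cutQ :: "('v, 'e) pre_digraph" where
  "cutQ = Q\<lparr>arcs := arcs Q - T\<rparr>"

lemma cutQ_simps [simp]:
  "verts cutQ = verts Q" "arcs cutQ = arcs Q - T" "tail cutQ = tail Q" "head cutQ = head Q"
  by (simp_all add: cutQ_def)

lemma fin_digraph_cutQ: "fin_digraph cutQ"
  by unfold_locales auto

interpretation cut: fin_digraph cutQ
  by (rule fin_digraph_cutQ)

lemma cas_cutQ: "cut.cas u p v \<longleftrightarrow> cas u p v"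
  by (induction p arbitrary: u) simp_all

lemma paths_cutQ: "(u, p, v) \<in> paths cutQ \<longleftrightarrow> (u, p, v) \<in> paths Q \<and> set p \<inter> T = {}"
  by (auto simp: mem_paths_iff cut.awalk_def awalk_def cas_cutQ)

lemma paths_cutQ_subset: "paths cutQ \<subseteq> paths Q"
  by (auto simp: paths_cutQ)

lemma keys_cutQ: "keys x \<subseteq> paths cutQ \<Longrightarrow> keys x \<subseteq> paths Q"
  using paths_cutQ_subset by (rule order_trans[rotated])

text \<open>Their cosets will be a basis of the cut algebra. For a nonempty good path the completion
  \<open>c\<close> is never empty, since a whole cycle meets \<open>T\<close>; so
  \<open>complement_exists\<close> applies to every good path.\<close>

definition good_paths :: "('v, 'e) path set" where
  "good_paths = {(u, p, v). (u, p, v) \<in> paths cutQ \<and> (p = [] \<or> (\<exists>c. p @ c \<in> S))}"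

lemma good_paths_iff:
  "(u, p, v) \<in> good_paths \<longleftrightarrow> (u, p, v) \<in> paths cutQ \<and> (p = [] \<or> (\<exists>c. p @ c \<in> S))"
  by (simp add: good_paths_def)

lemma good_paths_cutQ: "p \<in> good_paths \<Longrightarrow> p \<in> paths cutQ"
  by (auto simp: good_paths_def)

lemma good_paths_complement:
  assumes "p \<in> good_paths"
  shows "\<exists>q\<in>paths Q. closes p q \<and> (\<forall>p'\<in>paths Q. closes p' q \<longleftrightarrow> p' = p)"
proof -
  obtain u p' v where p: "p = (u, p', v)" by (cases p)
  have path: "(u, p', v) \<in> paths Q" and T: "set p' \<inter> T = {}"
    using good_paths_cutQ[OF assms] by (simp_all add: p paths_cutQ)
  have "p' = [] \<or> (\<exists>c. c \<noteq> [] \<and> p' @ c \<in> S)"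
    using assms S_meets_T T unfolding p good_paths_iff by (metis append_Nil2)
  then show ?thesis
    unfolding p by (rule complement_exists[OF path])
qed

lemma good_paths_length: "(u, p, v) \<in> good_paths \<Longrightarrow> length p \<le> card (arcs Q)"
proof -
  assume g: "(u, p, v) \<in> good_paths"
  then have "set p \<subseteq> arcs Q"
    using paths_arcs by (auto simp: good_paths_iff paths_cutQ)
  moreover have "distinct p"
  proof (cases "p = []")
    case False
    then obtain c where "p @ c \<in> S"
      using g by (auto simp: good_paths_iff)
    then show ?thesis
      using S_distinct[of "p @ c"] by simp
  qed simp
  ultimately show ?thesis
    using card_mono[OF finite_arcs] distinct_card[of p] by metis
qed

lemma finite_good_paths: "finite good_paths"
proof (rule finite_subset)
  show "good_paths \<subseteq> verts Q \<times> {p. set p \<subseteq> arcs Q \<and> length p \<le> card (arcs Q)} \<times> verts Q"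
  proof
    fix r assume r: "r \<in> good_paths"
    obtain u p v where upv: "r = (u, p, v)" by (cases r)
    have "(u, p, v) \<in> paths Q"
      using r by (simp add: upv good_paths_iff paths_cutQ)
    then show "r \<in> verts Q \<times> {p. set p \<subseteq> arcs Q \<and> length p \<le> card (arcs Q)} \<times> verts Q"
      using r good_paths_length[of u p v] paths_verts[of u p v] paths_arcs[of u p v]
      by (simp add: upv)
  qed
qed (intro finite_cartesian_product finite_verts finite_lists_length_le finite_arcs)

section \<open>The ideal of the cut quiver\<close>

definition cut_relations :: "('v, 'e) path set" where
  "cut_relations =
    {p \<in> paths cutQ. length (fst (snd p)) = 2 \<and> \<not> (\<exists>C\<in>S. sublist (fst (snd p)) C)}"

definition cut_ideal :: "(('v, 'e) path \<Rightarrow>\<^sub>0 'k::field) set" where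
  "cut_ideal = genideal (path_algebra cutQ) ((\<lambda>p. single p 1) ` cut_relations)"

lemma cut_relations_subset_carrier:
  "(\<lambda>p. single p (1 :: 'k::field)) ` cut_relations \<subseteq> carrier (path_algebra cutQ)"
  by (auto simp: cut_relations_def)

lemma algebra_ideal_cut_ideal:
  "algebra_ideal (cut_ideal :: (_ \<Rightarrow>\<^sub>0 'k::field) set) (path_algebra cutQ)"
proof -
  interpret ring "path_algebra cutQ :: ('k, _) module" by (rule cut.ring_path_algebra)
  have "ideal (cut_ideal :: (_ \<Rightarrow>\<^sub>0 'k) set) (path_algebra cutQ)"
    unfolding cut_ideal_def by (rule genideal_ideal[OF cut_relations_subset_carrier])
  then show ?thesis
    by (intro algebra_ideal.intro algebra_ideal_axioms.intro cut.k_algebra_path_algebra)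
qed

lemma ideal_cut_ideal: "ideal (cut_ideal :: (_ \<Rightarrow>\<^sub>0 'k::field) set) (path_algebra cutQ)"
  using algebra_ideal_cut_ideal by (rule algebra_ideal.axioms)

lemma cut_relation_in_ideal: "p \<in> cut_relations \<Longrightarrow> single p (1 :: 'k::field) \<in> cut_ideal"
proof -
  interpret ring "path_algebra cutQ :: ('k, _) module" by (rule cut.ring_path_algebra)
  show "p \<in> cut_relations \<Longrightarrow> ?thesis"
    unfolding cut_ideal_def using genideal_self[OF cut_relations_subset_carrier] by blast
qed

text \<open>A path that lies on no cycle must leave the cycles between two consecutive arrows, and
  these two form a relation. Running around a full cycle is impossible without arrows of
  \<open>T\<close>.\<close>

lemma bad_path_in_cut_ideal:
  assumes "p \<in> paths cutQ" "p \<notin> good_paths"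
  shows "single p (1 :: 'k::field) \<in> cut_ideal"
proof -
  obtain u p' v where p: "p = (u, p', v)" by (cases p)
  have "single (u, p', v) (1 :: 'k) \<in> cut_ideal \<or> (\<exists>c. p' @ c \<in> S)"
  proof (rule path_dichotomy[OF fin_digraph_cutQ _ _ _ ideal_cut_ideal])
    fix a b assume ab: "a \<in> arcs cutQ" "b \<in> arcs cutQ" "head Q a = tail Q b" "\<nexists>d. [a, b] @ d \<in> S"
    have "(tail Q a, [a] @ [b], head Q b) \<in> paths cutQ"
      using cut.arrow_in_paths[OF ab(1)] cut.arrow_in_paths[OF ab(2)] ab(3)
      by (intro cut.paths_appendI) simp_all
    then have "(tail Q a, [a, b], head Q b) \<in> cut_relations"
      using ab(4) unfolding cut_relations_def sublist_S_iff by simp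
    then show "single (tail Q a, [a, b], head Q b) (1 :: 'k) \<in> cut_ideal"
      by (rule cut_relation_in_ideal)
  next
    fix C assume "C \<in> S" "set C \<subseteq> arcs cutQ"
    then show "single (tail Q (hd C), C @ [hd C], head Q (hd C)) (1 :: 'k) \<in> cut_ideal"
      using S_meets_T by auto
  qed (use assms p in \<open>simp_all add: good_paths_iff\<close>)
  then show ?thesis
    using assms by (simp add: p good_paths_iff)
qed

text \<open>The bad paths are stable under prolongation, contain the generators and lie in the
  ideal. Membership thus becomes a condition on the support alone.\<close>

lemma cut_ideal_eq: "(cut_ideal :: (_ \<Rightarrow>\<^sub>0 'k::field) set) = {x. keys x \<subseteq> paths cutQ - good_paths}"
proof
  interpret ring "path_algebra cutQ :: ('k, _) module" by (rule cut.ring_path_algebra)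
  interpret algebra_ideal cut_ideal "path_algebra cutQ :: ('k, _) module"
    by (rule algebra_ideal_cut_ideal)
  show "(cut_ideal :: (_ \<Rightarrow>\<^sub>0 'k) set) \<subseteq> {x. keys x \<subseteq> paths cutQ - good_paths}"
    unfolding cut_ideal_def
  proof (rule genideal_minimal[OF cut.ideal_keysI])
    fix u p v q w
    assume *: "(u, p, v) \<in> paths cutQ" "(v, q, w) \<in> paths cutQ - good_paths"
    \<comment> \<open>A cycle starting with \<open>p @ q\<close> could be rotated to start with
      \<open>q\<close>, making \<open>q\<close> good.\<close>
    have "p @ q \<noteq> []" "\<nexists>c. (p @ q) @ c \<in> S"
      using * S_swap[of p "q @ _"] by (auto simp: good_paths_iff)
    then show "(u, p @ q, w) \<in> paths cutQ - good_paths"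
      using * cut.paths_appendI[of u p v q w] by (simp add: good_paths_iff)
  next
    fix u p v q w
    assume *: "(u, p, v) \<in> paths cutQ - good_paths" "(v, q, w) \<in> paths cutQ"
    have "p @ q \<noteq> []" "\<nexists>c. (p @ q) @ c \<in> S"
      using * by (auto simp: good_paths_iff)
    then show "(u, p @ q, w) \<in> paths cutQ - good_paths"
      using * cut.paths_appendI[of u p v q w] by (simp add: good_paths_iff)
  next
    have "p \<notin> good_paths" if "p \<in> cut_relations" for p
      using that unfolding cut_relations_def sublist_S_iff by (cases p) (auto simp: good_paths_iff)
    then show "(\<lambda>p. single p (1 :: 'k)) ` cut_relations \<subseteq> {x. keys x \<subseteq> paths cutQ - good_paths}"
      by (auto simp: cut_relations_def)
  qed simp
  show "{x :: _ \<Rightarrow>\<^sub>0 'k. keys x \<subseteq> paths cutQ - good_paths} \<subseteq> cut_ideal"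
  proof
    fix x :: "('v, 'e) path \<Rightarrow>\<^sub>0 'k"
    assume "x \<in> {x. keys x \<subseteq> paths cutQ - good_paths}"
    then have "keys x \<subseteq> paths cutQ - good_paths" by simp
    then show "x \<in> cut_ideal"
    proof (induction x rule: keys_subset_induct)
      case zero
      then show ?case using zero_closed by simp
    next
      case (single p c)
      then have "scal c (single p 1) \<in> (cut_ideal :: (_ \<Rightarrow>\<^sub>0 'k) set)"
        using ideal_smult[OF bad_path_in_cut_ideal[of p], of c] by simp
      then show ?case by simp
    next
      case (add x y)
      then show ?case
        using additive_subgroup.a_closed[OF ideal.axioms(1)[OF ideal_cut_ideal], of x y] by simp
    qed
  qed
qed

text \<open>Bad paths are pieces of no cycle. Hence pairing with a fixed \<open>x\<close>, which may
  contain cut arrows, descends to a functional on the cut algebra.\<close>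

lemma trace_pmul_cut_ideal:
  fixes y :: "('v, 'e) path \<Rightarrow>\<^sub>0 'k::field"
  assumes "keys x \<subseteq> paths Q" "y \<in> cut_ideal"
  shows "trace (x \<star> y) = 0"
  using assms(1)
proof (induction x rule: keys_subset_induct)
  case (single p a)
  have "keys y \<subseteq> paths cutQ - good_paths"
    using assms(2) by (simp add: cut_ideal_eq)
  then show ?case
  proof (induction y rule: keys_subset_induct)
    case (single q b)
    then have q: "q \<in> paths cutQ" "q \<notin> good_paths" "q \<in> paths Q"
      using paths_cutQ_subset by auto
    obtain u p' v v' q' w where pq: "p = (u, p', v)" "q = (v', q', w)"
      by (cases p; cases q)
    have "p' @ q' \<notin> S"
      using q(1,2) S_swap[of p' q'] by (auto simp: pq good_paths_iff)
    then have "\<not> closes p q"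
      by (simp add: pq)
    then show ?case
      using trace_single_pmul[OF \<open>p \<in> paths Q\<close> q(3), of a b] by (simp del: pmul_single)
  qed (simp_all add: pmul_add_right)
qed (simp_all add: pmul_add_left)

text \<open>The degree zero part is isotropic: a product without cut arrows is never a cycle of
  \<open>S\<close>.\<close>

lemma trace_pmul_cutQ:
  assumes "keys x \<subseteq> paths cutQ" "keys y \<subseteq> paths cutQ"
  shows "trace (x \<star> y) = 0"
  using assms(1)
proof (induction x rule: keys_subset_induct)
  case (single p a)
  show ?case
    using assms(2)
  proof (induction y rule: keys_subset_induct)
    case (single q b)
    obtain u p' v v' q' w where pq: "p = (u, p', v)" "q = (v', q', w)"
      by (cases p; cases q)
    have *: "p \<in> paths Q" "q \<in> paths Q" "set p' \<inter> T = {}" "set q' \<inter> T = {}"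
      using \<open>p \<in> paths cutQ\<close> \<open>q \<in> paths cutQ\<close> by (simp_all add: pq paths_cutQ)
    have "p' @ q' \<notin> S"
      using S_meets_T[of "p' @ q'"] *(3,4) by auto
    then show ?case
      using trace_single_pmul[OF *(1,2), of a b] by (simp add: pq)
  qed (simp_all add: pmul_add_right)
qed (simp_all add: pmul_add_left)

section \<open>Projection onto the paths without cut arrows\<close>

definition proj :: "(('v, 'e) path \<Rightarrow>\<^sub>0 'k::field) \<Rightarrow> ('v, 'e) path \<Rightarrow>\<^sub>0 'k" where
  "proj x = (\<Sum>p\<in>keys x \<inter> paths cutQ. single p (lookup x p))"

lemma lookup_proj: "lookup (proj x) r = (if r \<in> paths cutQ then lookup x r else 0)"
  unfolding proj_def lookup_sum lookup_single when_def
  by (cases "r \<in> keys x \<inter> paths cutQ") (auto simp: in_keys_iff sum.delta)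

lemma proj_linear [simp]:
  "proj 0 = 0" "proj (x + y) = proj x + proj y" "proj (x - y) = proj x - proj y"
  "proj (scal c x) = scal c (proj x)"
  by (rule poly_mapping_eqI; simp add: lookup_proj lookup_add lookup_minus)+

lemma proj_sum: "proj (\<Sum>i\<in>F. f i) = (\<Sum>i\<in>F. proj (f i))"
  by (induction F rule: infinite_finite_induct) simp_all

lemma proj_single: "proj (single p c) = (if p \<in> paths cutQ then single p c else 0)"
  by (rule poly_mapping_eqI) (auto simp: lookup_proj lookup_single when_def)

lemma keys_proj: "keys (proj x) \<subseteq> paths cutQ"
  by (auto simp: in_keys_iff lookup_proj split: if_splits)

lemma proj_id: "keys x \<subseteq> paths cutQ \<Longrightarrow> proj x = x"
  by (rule poly_mapping_eqI) (auto simp: lookup_proj in_keys_iff)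

lemma keys_proj_Q: "keys (proj x) \<subseteq> paths Q"
  using keys_proj by (rule keys_cutQ)

text \<open>A concatenation avoids \<open>T\<close> exactly if both of its pieces do; so the paths
  meeting \<open>T\<close> span an ideal, and \<open>proj\<close> is reduction modulo it.\<close>

lemma proj_pmul:
  assumes "keys x \<subseteq> paths Q" "keys y \<subseteq> paths Q"
  shows "proj (x \<star> y) = proj x \<star> proj y"
  using assms(1)
proof (induction x rule: keys_subset_induct)
  case (single p a)
  show ?case
    using assms(2)
  proof (induction y rule: keys_subset_induct)
    case (single q b)
    obtain u p' v v' q' w where pq: "p = (u, p', v)" "q = (v', q', w)"
      by (cases p; cases q)
    show ?case
    proof (cases "v = v'")
      case True
      then have "(u, p' @ q', w) \<in> paths Q"
        using \<open>p \<in> paths Q\<close> \<open>q \<in> paths Q\<close> paths_appendI by (simp add: pq)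
      then have "(u, p' @ q', w) \<in> paths cutQ \<longleftrightarrow> p \<in> paths cutQ \<and> q \<in> paths cutQ"
        using \<open>p \<in> paths Q\<close> \<open>q \<in> paths Q\<close> by (auto simp: pq paths_cutQ)
      then show ?thesis
        using True by (auto simp: pq proj_single)
    qed (simp add: pq proj_single)
  qed (simp_all add: pmul_add_right)
qed (simp_all add: pmul_add_left)

lemma proj_one: "proj (\<Sum>v\<in>verts Q. single (v, [], v) 1) = (\<Sum>v\<in>verts Q. single (v, [], v) 1)"
  using cut.keys_one by (intro proj_id) simp

text \<open>A cycle in \<open>S\<close> contains exactly one arrow of \<open>T\<close>, so in a product \<open>x x' y\<close> with \<open>y\<close> free of
  such arrows exactly one of the factors \<open>x\<close> and \<open>x'\<close> is free of them.\<close>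

lemma trace_split:
  assumes "keys x \<subseteq> paths Q" "keys x' \<subseteq> paths Q" "keys y \<subseteq> paths cutQ"
  shows "trace (x \<star> x' \<star> y) = trace (proj x \<star> x' \<star> y) + trace (x \<star> proj x' \<star> y)"
  using assms(1)
proof (induction x rule: keys_subset_induct)
  case (single p a)
  show ?case
    using assms(2)
  proof (induction x' rule: keys_subset_induct)
    case (single q b)
    show ?case
      using assms(3)
    proof (induction y rule: keys_subset_induct)
      case (single r c)
      let ?t = "trace (single p a \<star> single q b \<star> single r c)"
      \<comment> \<open>If both of \<open>p\<close> and \<open>q\<close> avoid \<open>T\<close>, the
        product has no cut arrow; if neither does, it has at least two. In both cases it is not a
        cycle, and the right-hand side has to vanish with the left.\<close>
      have *: "?t = 0" if iff: "p \<in> paths cutQ \<longleftrightarrow> q \<in> paths cutQ"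
      proof -
        obtain u p' v v' q' w w' r' z where pqr: "p = (u, p', v)" "q = (v', q', w)" "r = (w', r', z)"
          by (cases p; cases q; cases r)
        show ?thesis
        proof (cases "v = v' \<and> w = w'")
          case True
          have path: "(u, p', v) \<in> paths Q" "(v, q', w) \<in> paths Q" "(w, r', z) \<in> paths Q"
            and T: "set r' \<inter> T = {}" "set p' \<inter> T = {} \<longleftrightarrow> set q' \<inter> T = {}"
            using \<open>p \<in> paths Q\<close> \<open>q \<in> paths Q\<close> \<open>r \<in> paths cutQ\<close> iff True
            by (simp_all add: pqr paths_cutQ)
          have "(p' @ q') @ r' \<notin> S"
          proof
            assume S: "(p' @ q') @ r' \<in> S"
            have "set p' \<inter> T = {} \<or> set (q' @ r') \<inter> T = {}"
              using S by (intro S_meets_T_once) simp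
            then have "set ((p' @ q') @ r') \<inter> T = {}"
              using T by auto
            then show False
              using S_meets_T[OF S] by simp
          qed
          then show ?thesis
            using trace_single[OF paths_appendI[OF paths_appendI[OF path(1,2)] path(3)], of "a * b * c"]
              True by (simp add: pqr)
        qed (auto simp: pqr)
      qed
      show ?case
        using * by (cases "p \<in> paths cutQ"; cases "q \<in> paths cutQ") (simp_all add: proj_single)
    qed (simp_all add: pmul_add_right)
  qed (simp_all add: pmul_add_left pmul_add_right)
qed (simp_all add: pmul_add_left)

section \<open>The isomorphism with the trivial extension\<close>

definition cut_algebra :: "('k::field, (('v, 'e) path \<Rightarrow>\<^sub>0 'k) set) module" where
  "cut_algebra = quotient_algebra (path_algebra cutQ) cut_ideal"

abbreviation coset :: "(('v, 'e) path \<Rightarrow>\<^sub>0 'k::field) \<Rightarrow> (('v, 'e) path \<Rightarrow>\<^sub>0 'k) set" where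
  "coset x \<equiv> cut_ideal +>\<^bsub>path_algebra cutQ\<^esub> x"

lemma k_algebra_cut_algebra: "k_algebra (cut_algebra :: ('k::field, _) module)"
proof -
  interpret algebra_ideal cut_ideal "path_algebra cutQ :: ('k, _) module"
    by (rule algebra_ideal_cut_ideal)
  show ?thesis
    unfolding cut_algebra_def by (rule k_algebra_quot)
qed

lemma cut_algebra_carrier:
  "carrier (cut_algebra :: ('k::field, _) module) = coset ` {y. keys y \<subseteq> paths cutQ}"
proof -
  interpret algebra_ideal cut_ideal "path_algebra cutQ :: ('k, _) module"
    by (rule algebra_ideal_cut_ideal)
  show ?thesis
    unfolding cut_algebra_def quot_carrier by simp
qed

lemma cut_algebra_simps:
  fixes x y :: "('v, 'e) path \<Rightarrow>\<^sub>0 'k::field"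
  assumes "keys x \<subseteq> paths cutQ" "keys y \<subseteq> paths cutQ"
  shows "coset x \<otimes>\<^bsub>cut_algebra\<^esub> coset y = coset (x \<star> y)"
    and "coset x \<oplus>\<^bsub>cut_algebra\<^esub> coset y = coset (x + y)"
    and "c \<odot>\<^bsub>cut_algebra\<^esub> coset x = coset (scal c x)"
    and "coset x = coset y \<longleftrightarrow> x - y \<in> cut_ideal"
proof -
  interpret algebra_ideal cut_ideal "path_algebra cutQ :: ('k, _) module"
    by (rule algebra_ideal_cut_ideal)
  show "coset x \<otimes>\<^bsub>cut_algebra\<^esub> coset y = coset (x \<star> y)"
    "coset x \<oplus>\<^bsub>cut_algebra\<^esub> coset y = coset (x + y)"
    "c \<odot>\<^bsub>cut_algebra\<^esub> coset x = coset (scal c x)"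
    unfolding cut_algebra_def
    using quot_mult[of x y] quot_add[of x y] quot_smult[of x c] assms
    by (simp_all del: quotient_algebra_fields)
  show "coset x = coset y \<longleftrightarrow> x - y \<in> cut_ideal"
    using coset_eq_iff[of x y] cut.path_algebra_minus[OF assms] assms by simp
qed

lemma cut_algebra_zero_one:
  "\<zero>\<^bsub>cut_algebra\<^esub> = (coset 0 :: (('v, 'e) path \<Rightarrow>\<^sub>0 'k::field) set)"
  "\<one>\<^bsub>cut_algebra\<^esub> = (coset (\<Sum>v\<in>verts Q. single (v, [], v) 1) :: (('v, 'e) path \<Rightarrow>\<^sub>0 'k) set)"
proof -
  interpret algebra_ideal cut_ideal "path_algebra cutQ :: ('k, _) module"
    by (rule algebra_ideal_cut_ideal)
  show "\<zero>\<^bsub>cut_algebra\<^esub> = (coset 0 :: (('v, 'e) path \<Rightarrow>\<^sub>0 'k) set)"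
    "\<one>\<^bsub>cut_algebra\<^esub> = (coset (\<Sum>v\<in>verts Q. single (v, [], v) 1) :: (('v, 'e) path \<Rightarrow>\<^sub>0 'k) set)"
    unfolding cut_algebra_def quot_zero quot_one by simp_all
qed

lemma coset_in_carrier: "keys y \<subseteq> paths cutQ \<Longrightarrow> coset y \<in> carrier cut_algebra"
  by (simp add: cut_algebra_carrier)

lemma coset_cases:
  assumes "X \<in> carrier cut_algebra"
  obtains y where "keys y \<subseteq> paths cutQ" "X = coset y"
  using assms unfolding cut_algebra_carrier by blast

lemma coset_bad_path:
  assumes "p \<in> paths cutQ" "p \<notin> good_paths"
  shows "coset (single p c) = coset 0"
  using assms by (subst cut_algebra_simps(4)) (simp_all add: cut_ideal_eq)

section \<open>Finite dimension, (S0), (S1) and admissibility of the cut presentation\<close>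

lemma fd_algebra_cut_algebra: "fd_algebra (cut_algebra :: ('k::field, _) module)"
proof (rule fd_algebraI[OF k_algebra_cut_algebra])
  show "finite ((\<lambda>p. coset (single p (1 :: 'k))) ` good_paths)"
    using finite_good_paths by simp
  show "(\<lambda>p. coset (single p (1 :: 'k))) ` good_paths \<subseteq> carrier cut_algebra"
    by (intro image_subsetI coset_in_carrier) (simp add: good_paths_cutQ)
next
  fix N
  assume B: "(\<lambda>p. coset (single p (1 :: 'k))) ` good_paths \<subseteq> N"
    and zero: "\<zero>\<^bsub>cut_algebra\<^esub> \<in> N"
    and add: "\<And>x y. x \<in> N \<Longrightarrow> y \<in> N \<Longrightarrow> x \<oplus>\<^bsub>cut_algebra\<^esub> y \<in> N"
    and smult: "\<And>c x. x \<in> N \<Longrightarrow> c \<odot>\<^bsub>cut_algebra\<^esub> x \<in> N"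
  have "coset x \<in> N" if "keys x \<subseteq> paths cutQ" for x
    using that
  proof (induction x rule: keys_subset_induct)
    case zero
    then show ?case using \<open>\<zero>\<^bsub>cut_algebra\<^esub> \<in> N\<close> by (simp only: cut_algebra_zero_one)
  next
    case (single p c)
    show ?case
    proof (cases "p \<in> good_paths")
      case True
      then have "c \<odot>\<^bsub>cut_algebra\<^esub> coset (single p 1) \<in> N"
        using B by (intro smult) blast
      moreover have "c \<odot>\<^bsub>cut_algebra\<^esub> coset (single p 1) = coset (single p c)"
        using single by (subst cut_algebra_simps(3)[of _ 0]) simp_all
      ultimately show ?thesis by (simp only:)
    next
      case False
      then show ?thesis
        using zero coset_bad_path[OF single False, of c] by (simp only: cut_algebra_zero_one)
    qed
  next
    case (add x y)
    then show ?case
      using \<open>\<And>x y. x \<in> N \<Longrightarrow> y \<in> N \<Longrightarrow> x \<oplus>\<^bsub>cut_algebra\<^esub> y \<in> N\<close>[of "coset x" "coset y"]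
      by (simp only: cut_algebra_simps(2))
  qed
  then show "carrier cut_algebra \<subseteq> N"
    by (auto simp: cut_algebra_carrier)
qed

lemma cond_S0_cut: "cond_S0 cutQ (cut_ideal :: (_ \<Rightarrow>\<^sub>0 'k::field) set)"
  unfolding cond_S0_def cut_ideal_def
  by (intro exI[of _ cut_relations]) (auto simp: cut_relations_def)

text \<open>Two arrows with product outside the ideal are consecutive on a cycle, and the cycle
  through an arrow is unique up to rotation, which fixes the neighbours of the arrow on both
  sides.\<close>

lemma cond_S1_cut: "cond_S1 cutQ (cut_ideal :: (_ \<Rightarrow>\<^sub>0 'k::field) set)"
proof -
  have *: "\<exists>d. [a, b] @ d \<in> S"
    if "a \<in> arcs cutQ" "b \<in> arcs cutQ"
      "(arrow_elem cutQ a \<otimes>\<^bsub>path_algebra cutQ\<^esub> arrow_elem cutQ b :: _ \<Rightarrow>\<^sub>0 'k) \<notin> cut_ideal" for a b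
  proof -
    have eq: "arrow_elem cutQ a \<otimes>\<^bsub>path_algebra cutQ\<^esub> arrow_elem cutQ b =
        (if head Q a = tail Q b then single (tail Q a, [a, b], head Q b) (1 :: 'k) else 0)"
      by (simp add: arrow_elem_def path_elem_def)
    have "(0 :: _ \<Rightarrow>\<^sub>0 'k) \<in> cut_ideal"
      by (simp add: cut_ideal_eq)
    then have "single (tail Q a, [a, b], head Q b) (1 :: 'k) \<notin> cut_ideal" "head Q a = tail Q b"
      using that(3) unfolding eq by (auto split: if_splits)
    moreover have "(tail Q a, [a] @ [b], head Q b) \<in> paths cutQ"
      using cut.arrow_in_paths[OF that(1)] cut.arrow_in_paths[OF that(2)] \<open>head Q a = tail Q b\<close>
      by (intro cut.paths_appendI) simp_all
    ultimately have "(tail Q a, [a, b], head Q b) \<in> good_paths"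
      using bad_path_in_cut_ideal by fastforce
    then show ?thesis
      by (simp add: good_paths_iff)
  qed
  have right: "b = b'" if "[a, b] @ d \<in> S" "[a, b'] @ d' \<in> S" for a b b' d d'
    using S_cancel_left[of "[a]" "b # d" "b' # d'"] that by simp
  have left: "c = c'" if "[c, a] @ d \<in> S" "[c', a] @ d' \<in> S" for a c c' d d'
  proof -
    have "[a] @ d @ [c] \<in> S" "[a] @ d' @ [c'] \<in> S"
      using that S_swap[of "[c]" "a # d"] S_swap[of "[c']" "a # d'"] by simp_all
    then have "d @ [c] = d' @ [c']"
      by (rule S_cancel_left) simp
    then show ?thesis by simp
  qed
  show ?thesis
    unfolding cond_S1_def using * left right by meson
qed

lemma admissible_cut_ideal: "admissible_ideal cutQ (cut_ideal :: (_ \<Rightarrow>\<^sub>0 'k::field) set)"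
proof -
  interpret ring "path_algebra cutQ :: ('k, _) module" by (rule cut.ring_path_algebra)
  have "(\<lambda>p. single p (1 :: 'k)) ` cut_relations \<subseteq> arrow_ideal_power cutQ 2"
  proof clarify
    fix u p v assume r: "(u, p, v) \<in> cut_relations"
    then obtain a b where p: "p = [a, b]"
      by (auto simp: cut_relations_def numeral_2_eq_2 length_Suc_conv)
    have path: "(u, [a, b], v) \<in> paths cutQ"
      using r by (simp add: cut_relations_def p)
    have ab: "a \<in> arcs cutQ" "b \<in> arcs cutQ" "u = tail Q a" "head Q a = tail Q b" "v = head Q b"
      using path by (auto simp: cut.paths_Cons_iff cut.paths_Nil simp del: cutQ_simps(2))
    let ?one = "\<Sum>v\<in>verts Q. single (v, [], v) (1 :: 'k)"
    \<comment> \<open>The first power is the product of the arrow ideal with the whole algebra, so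
      the arrow \<open>b\<close> enters it as \<open>b\<close> times the unit.\<close>
    have "arrow_elem cutQ b \<star> ?one \<in> arrow_ideal_power cutQ 1"
      using ideal_prod.prod[OF cut.arrow_in_arrow_ideal[OF ab(2)], of ?one "carrier (path_algebra cutQ)"
          "path_algebra cutQ"] cut.keys_one by simp
    moreover have "arrow_elem cutQ b \<star> ?one = (arrow_elem cutQ b :: _ \<Rightarrow>\<^sub>0 'k)"
      using cut.pmul_one[of "arrow_elem cutQ b :: _ \<Rightarrow>\<^sub>0 'k"] cut.arrow_in_paths[OF ab(2)]
      by (simp add: arrow_elem_def path_elem_def)
    ultimately have "(arrow_elem cutQ b :: _ \<Rightarrow>\<^sub>0 'k) \<in> arrow_ideal_power cutQ 1"
      by simp
    then have "arrow_elem cutQ a \<star> arrow_elem cutQ b \<in> (arrow_ideal_power cutQ 2 :: (_ \<Rightarrow>\<^sub>0 'k) set)"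
      using ideal_prod.prod[OF cut.arrow_in_arrow_ideal[OF ab(1)], of "arrow_elem cutQ b :: _ \<Rightarrow>\<^sub>0 'k"
          "arrow_ideal_power cutQ 1" "path_algebra cutQ"] by (simp add: numeral_2_eq_2)
    moreover have "arrow_elem cutQ a \<star> arrow_elem cutQ b = single (u, p, v) (1 :: 'k)"
      using ab by (simp add: arrow_elem_def path_elem_def p)
    ultimately show "single (u, p, v) (1 :: 'k) \<in> arrow_ideal_power cutQ 2"
      by simp
  qed
  then have "(cut_ideal :: (_ \<Rightarrow>\<^sub>0 'k) set) \<subseteq> arrow_ideal_power cutQ 2"
    unfolding cut_ideal_def by (rule genideal_minimal[OF cut.ideal_arrow_ideal_power])
  \<comment> \<open>Good paths do not repeat arrows, so their length is at most
    \<open>card (arcs Q)\<close>. The summand 2 takes longer paths and at the same time secures the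
    lower bound on the exponent in \<open>admissible_ideal\<close>.\<close>
  moreover have "arrow_ideal_power cutQ (card (arcs Q) + 2) \<subseteq> (cut_ideal :: (_ \<Rightarrow>\<^sub>0 'k) set)"
  proof
    fix x :: "('v, 'e) path \<Rightarrow>\<^sub>0 'k"
    assume "x \<in> arrow_ideal_power cutQ (card (arcs Q) + 2)"
    then have x: "keys x \<subseteq> {p \<in> paths cutQ. card (arcs Q) + 2 \<le> length (fst (snd p))}"
      using cut.arrow_ideal_power_long by blast
    have "p \<notin> good_paths" if "p \<in> keys x" for p
      using that x good_paths_length[of "fst p" "fst (snd p)" "snd (snd p)"] by auto
    then show "x \<in> cut_ideal"
      using x by (auto simp: cut_ideal_eq)
  qed
  ultimately show ?thesis
    unfolding admissible_ideal_def using ideal_cut_ideal by (metis le_add2)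
qed

section \<open>The map from the path algebra to the trivial extension\<close>

definition rep :: "(('v, 'e) path \<Rightarrow>\<^sub>0 'k::field) set \<Rightarrow> ('v, 'e) path \<Rightarrow>\<^sub>0 'k" where
  "rep X = (SOME y. keys y \<subseteq> paths cutQ \<and> X = coset y)"

text \<open>Two representatives differ by an element of the cut ideal, which pairs to zero with
  everything. So \<open>rep\<close> can turn the pairing into a function of cosets although it is an
  arbitrary choice.\<close>

lemma trace_pmul_rep:
  fixes x y :: "('v, 'e) path \<Rightarrow>\<^sub>0 'k::field"
  assumes "keys x \<subseteq> paths Q" "keys y \<subseteq> paths cutQ"
  shows "trace (x \<star> rep (coset y)) = trace (x \<star> y)"
proof -
  have "\<exists>z. keys z \<subseteq> paths cutQ \<and> coset y = coset z"
    using assms(2) by blast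
  from someI_ex[OF this] have r: "keys (rep (coset y)) \<subseteq> paths cutQ" "coset y = coset (rep (coset y))"
    unfolding rep_def by simp_all
  then have "y - rep (coset y) \<in> cut_ideal"
    using cut_algebra_simps(4)[OF assms(2) r(1)] by simp
  then show ?thesis
    using trace_pmul_cut_ideal[OF assms(1), of "y - rep (coset y)"] by (simp add: pmul_diff_right)
qed

definition extension_map ::
  "(('v, 'e) path \<Rightarrow>\<^sub>0 'k::field) \<Rightarrow>
    (('v, 'e) path \<Rightarrow>\<^sub>0 'k) set \<times> ((('v, 'e) path \<Rightarrow>\<^sub>0 'k) set \<Rightarrow> 'k)"
  where "extension_map x = (coset (proj x), \<lambda>X\<in>carrier cut_algebra. trace (x \<star> rep X))"

lemma extension_map_eqI:
  fixes x :: "('v, 'e) path \<Rightarrow>\<^sub>0 'k::field"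
  assumes x: "keys x \<subseteq> paths Q"
    and f: "\<And>z. keys z \<subseteq> paths cutQ \<Longrightarrow> trace (x \<star> z) = f (coset z)"
  shows "extension_map x = (coset (proj x), \<lambda>X\<in>carrier cut_algebra. f X)"
proof -
  have "(\<lambda>X\<in>carrier cut_algebra. trace (x \<star> rep X)) = (\<lambda>X\<in>carrier cut_algebra. f X)"
  proof (rule restrict_ext)
    fix X :: "(('v, 'e) path \<Rightarrow>\<^sub>0 'k) set"
    assume "X \<in> carrier cut_algebra"
    then obtain z where z: "keys z \<subseteq> paths cutQ" "X = coset z"
      by (rule coset_cases)
    show "trace (x \<star> rep X) = f X"
      unfolding z(2) trace_pmul_rep[OF x z(1)] by (rule f[OF z(1)])
  qed
  then show ?thesis
    by (simp only: extension_map_def)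
qed

text \<open>The two conditions say that both components of \<open>extension_map\<close> vanish at
  \<open>z\<close>. A test path meeting \<open>T\<close> closes up only with paths avoiding
  \<open>T\<close>, so it sees nothing but \<open>proj z\<close>; conversely the partners of good
  paths force the support of \<open>proj z\<close> to be bad.\<close>

lemma radical_iff:
  fixes z :: "('v, 'e) path \<Rightarrow>\<^sub>0 'k::field"
  assumes z: "keys z \<subseteq> paths Q"
  shows "z \<in> radical \<longleftrightarrow>
    proj z \<in> cut_ideal \<and> (\<forall>y. keys y \<subseteq> paths cutQ \<longrightarrow> trace (z \<star> y) = 0)"
proof
  assume "z \<in> radical"
  then have rad: "trace (z \<star> y) = 0" if "keys y \<subseteq> paths Q" for y
    using that by (simp add: radical_def)
  have "p \<notin> good_paths" if p: "p \<in> keys (proj z)" for p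
  proof
    assume "p \<in> good_paths"
    then obtain q where q: "q \<in> paths Q" "\<forall>p'\<in>paths Q. closes p' q \<longleftrightarrow> p' = p"
      using good_paths_complement by blast
    have "trace (z \<star> single q 1) = lookup z p"
      using z q(2) by (intro trace_pmul_single_eq_lookup[OF z q(1)]) blast
    moreover have "lookup z p \<noteq> 0"
      using p by (auto simp: in_keys_iff lookup_proj split: if_splits)
    ultimately show False
      using rad[of "single q 1"] q(1) by simp
  qed
  then have "proj z \<in> cut_ideal"
    using keys_proj[of z] by (auto simp: cut_ideal_eq)
  then show "proj z \<in> cut_ideal \<and> (\<forall>y. keys y \<subseteq> paths cutQ \<longrightarrow> trace (z \<star> y) = 0)"
    using rad keys_cutQ by blast
next
  assume *: "proj z \<in> cut_ideal \<and> (\<forall>y. keys y \<subseteq> paths cutQ \<longrightarrow> trace (z \<star> y) = 0)"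
  show "z \<in> radical"
  proof (rule radicalI[OF z])
    fix q assume q: "q \<in> paths Q"
    show "trace (z \<star> single q 1) = 0"
    proof (cases "q \<in> paths cutQ")
      case True
      then show ?thesis using * by simp
    next
      case False
      have "trace (x \<star> single q 1) = trace (proj x \<star> single q 1)" if "keys x \<subseteq> paths Q" for x :: "_ \<Rightarrow>\<^sub>0 'k"
        using that
      proof (induction x rule: keys_subset_induct)
        case (single p a)
        have "\<not> closes p q" if "p \<notin> paths cutQ"
        proof -
          obtain u p' v v' q' w where pq: "p = (u, p', v)" "q = (v', q', w)"
            by (cases p; cases q)
          then have "set p' \<inter> T \<noteq> {}" "set q' \<inter> T \<noteq> {}"
            using q False single that by (simp_all add: paths_cutQ)
          then show ?thesis
            using S_meets_T_once[of p' q'] by (auto simp: pq)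
        qed
        then show ?case
          using trace_single_pmul[OF single q, of a 1] by (simp add: proj_single)
      qed (simp_all add: pmul_add_left)
      then have "trace (z \<star> single q 1) = trace (proj z \<star> single q 1)"
        using z by blast
      also have "\<dots> = trace (single q 1 \<star> proj z)"
        using q by (intro trace_commute keys_proj_Q) simp
      also have "\<dots> = 0"
        using q * by (intro trace_pmul_cut_ideal) simp_all
      finally show ?thesis .
    qed
  qed
qed

lemma extension_map_in_carrier:
  fixes x :: "('v, 'e) path \<Rightarrow>\<^sub>0 'k::field"
  assumes x: "keys x \<subseteq> paths Q"
  shows "extension_map x \<in> carrier (trivial_extension cut_algebra)"
proof -
  let ?f = "\<lambda>X\<in>carrier cut_algebra. trace (x \<star> rep X)"
  have "?f (X \<oplus>\<^bsub>cut_algebra\<^esub> Y) = ?f X + ?f Y"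
    if X: "X \<in> carrier cut_algebra" and Y: "Y \<in> carrier cut_algebra" for X Y
  proof -
    obtain y where y: "keys y \<subseteq> paths cutQ" "X = coset y"
      using X by (rule coset_cases)
    obtain z where z: "keys z \<subseteq> paths cutQ" "Y = coset z"
      using Y by (rule coset_cases)
    show ?thesis
      using y(1) z(1) unfolding y(2) z(2)
      by (simp add: cut_algebra_simps coset_in_carrier keys_add_closed trace_pmul_rep[OF x] pmul_add_right)
  qed
  moreover have "?f (c \<odot>\<^bsub>cut_algebra\<^esub> X) = c * ?f X" if X: "X \<in> carrier cut_algebra" for c X
  proof -
    obtain y where y: "keys y \<subseteq> paths cutQ" "X = coset y"
      using X by (rule coset_cases)
    show ?thesis
      using y(1) unfolding y(2)
      by (simp add: cut_algebra_simps[OF _ y(1)] coset_in_carrier keys_scal_closed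
          trace_pmul_rep[OF x] pmul_scal_right)
  qed
  ultimately have "?f \<in> dual_space cut_algebra"
    unfolding dual_space_def by simp
  then show ?thesis
    using coset_in_carrier[OF keys_proj, of x]
    by (simp add: trivial_extension_def extension_map_def)
qed

text \<open>In the second component \<open>trace_split\<close> yields one summand for each of the
  two bimodule actions. Symmetry of the form moves \<open>proj x\<close> behind the argument, where
  its left action on the functional of \<open>y\<close> places it.\<close>

lemma extension_map_mult:
  fixes x y :: "('v, 'e) path \<Rightarrow>\<^sub>0 'k::field"
  assumes x: "keys x \<subseteq> paths Q" and y: "keys y \<subseteq> paths Q"
  shows "extension_map (x \<star> y) = extension_map x \<otimes>\<^bsub>trivial_extension cut_algebra\<^esub> extension_map y"
proof -
  let ?f = "\<lambda>x. \<lambda>X\<in>carrier cut_algebra. trace (x \<star> rep X)"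
  have "trace (x \<star> y \<star> rep X) =
      ?f y (X \<otimes>\<^bsub>cut_algebra\<^esub> coset (proj x)) + ?f x (coset (proj y) \<otimes>\<^bsub>cut_algebra\<^esub> X)"
    if X: "X \<in> carrier cut_algebra" for X
  proof -
    obtain z where z: "keys z \<subseteq> paths cutQ" "X = coset z"
      using X by (rule coset_cases)
    have zx: "keys (z \<star> proj x) \<subseteq> paths cutQ" and yz: "keys (proj y \<star> z) \<subseteq> paths cutQ"
      by (rule cut.keys_pmul_closed[OF z(1) keys_proj], rule cut.keys_pmul_closed[OF keys_proj z(1)])
    have "trace (x \<star> y \<star> rep X) = trace (x \<star> y \<star> z)"
      using trace_pmul_rep[OF keys_pmul_closed[OF x y] z(1)] by (simp add: z(2))
    also have "\<dots> = trace (proj x \<star> (y \<star> z)) + trace (x \<star> (proj y \<star> z))"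
      using trace_split[OF x y z(1)] by (simp add: pmul_assoc)
    also have "trace (proj x \<star> (y \<star> z)) = trace (y \<star> (z \<star> proj x))"
      using trace_commute[OF keys_proj_Q keys_pmul_closed[OF y keys_cutQ[OF z(1)]], of x]
      by (simp add: pmul_assoc)
    also have "\<dots> = ?f y (X \<otimes>\<^bsub>cut_algebra\<^esub> coset (proj x))"
      using zx by (simp add: z(2) cut_algebra_simps[OF z(1) keys_proj] coset_in_carrier trace_pmul_rep[OF y])
    also have "trace (x \<star> (proj y \<star> z)) = ?f x (coset (proj y) \<otimes>\<^bsub>cut_algebra\<^esub> X)"
      using yz by (simp add: z(2) cut_algebra_simps[OF keys_proj z(1)] coset_in_carrier trace_pmul_rep[OF x])
    finally show ?thesis .
  qed
  then have "(\<lambda>X\<in>carrier cut_algebra. trace (x \<star> y \<star> rep X)) = (\<lambda>X\<in>carrier cut_algebra.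
      ?f y (X \<otimes>\<^bsub>cut_algebra\<^esub> coset (proj x)) + ?f x (coset (proj y) \<otimes>\<^bsub>cut_algebra\<^esub> X))"
    by (rule restrict_ext)
  then show ?thesis
    by (simp only: extension_map_def proj_pmul[OF x y] cut_algebra_simps(1)[OF keys_proj keys_proj]
        trivial_extension_mult[OF k_algebraD(1)[OF k_algebra_cut_algebra]
          coset_in_carrier[OF keys_proj] coset_in_carrier[OF keys_proj]])
qed

lemma extension_map_add:
  "extension_map (x + y) = extension_map x \<oplus>\<^bsub>trivial_extension cut_algebra\<^esub> extension_map y"
  by (simp add: extension_map_def trivial_extension_def cut_algebra_simps keys_proj pmul_add_left
      cong: restrict_cong)

lemma extension_map_scal:
  "extension_map (scal c x) = c \<odot>\<^bsub>trivial_extension cut_algebra\<^esub> extension_map x"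
  by (simp add: extension_map_def trivial_extension_def cut_algebra_simps(3)[OF keys_proj keys_proj]
      pmul_scal_left cong: restrict_cong)

lemma extension_map_one:
  "extension_map (\<Sum>v\<in>verts Q. single (v, [], v) 1) = \<one>\<^bsub>trivial_extension cut_algebra\<^esub>"
proof -
  let ?one = "\<Sum>v\<in>verts Q. single (v, [], v) 1 :: ('v, 'e) path \<Rightarrow>\<^sub>0 'k::field"
  have one: "keys ?one \<subseteq> paths cutQ"
    using cut.keys_one by simp
  \<comment> \<open>The unit avoids \<open>T\<close>, so by isotropy of the degree zero part its
    functional is zero, as in the unit of the trivial extension.\<close>
  have "extension_map ?one = (coset (proj ?one), \<lambda>X\<in>carrier cut_algebra. 0)"
    by (rule extension_map_eqI[OF keys_one]) (rule trace_pmul_cutQ[OF one])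
  then show ?thesis
    by (simp only: trivial_extension_def cut_algebra_zero_one monoid.simps proj_one)
qed

lemma extension_map_kernel:
  fixes x y :: "('v, 'e) path \<Rightarrow>\<^sub>0 'k::field"
  assumes x: "keys x \<subseteq> paths Q" and y: "keys y \<subseteq> paths Q"
  shows "extension_map x = extension_map y \<longleftrightarrow> x - y \<in> relation_ideal"
proof -
  let ?f = "\<lambda>x. \<lambda>X\<in>carrier cut_algebra. trace (x \<star> rep X)"
  have "coset (proj x) = coset (proj y) \<longleftrightarrow> proj (x - y) \<in> cut_ideal"
    using cut_algebra_simps(4)[OF keys_proj keys_proj] by simp
  moreover have "?f x = ?f y \<longleftrightarrow> (\<forall>z. keys z \<subseteq> paths cutQ \<longrightarrow> trace ((x - y) \<star> z) = 0)"
  proof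
    assume eq: "?f x = ?f y"
    show "\<forall>z. keys z \<subseteq> paths cutQ \<longrightarrow> trace ((x - y) \<star> z) = 0"
    proof (intro allI impI)
      fix z :: "('v, 'e) path \<Rightarrow>\<^sub>0 'k"
      assume z: "keys z \<subseteq> paths cutQ"
      have "?f x (coset z) = ?f y (coset z)"
        by (simp only: eq)
      then show "trace ((x - y) \<star> z) = 0"
        using z by (simp add: coset_in_carrier trace_pmul_rep[OF x] trace_pmul_rep[OF y] pmul_diff_left)
    qed
  next
    assume *: "\<forall>z. keys z \<subseteq> paths cutQ \<longrightarrow> trace ((x - y) \<star> z) = 0"
    show "?f x = ?f y"
    proof (rule restrict_ext)
      fix X :: "(('v, 'e) path \<Rightarrow>\<^sub>0 'k) set"
      assume "X \<in> carrier cut_algebra"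
      then obtain z where z: "keys z \<subseteq> paths cutQ" "X = coset z"
        by (rule coset_cases)
      then have "trace ((x - y) \<star> z) = 0"
        using * by blast
      then show "trace (x \<star> rep X) = trace (y \<star> rep X)"
        unfolding z(2) trace_pmul_rep[OF x z(1)] trace_pmul_rep[OF y z(1)] by (simp add: pmul_diff_left)
    qed
  qed
  ultimately show ?thesis
    unfolding relation_ideal_eq_radical radical_iff[OF keys_diff_closed[OF x y]] extension_map_def
    by simp
qed

text \<open>A dual basis argument: \<open>w\<close> places the value of \<open>f\<close> at a good
  path on the partner of that path. A good path and its partner form a cycle, so the partner meets
  \<open>T\<close> and \<open>w\<close> does not affect the first component. Conversely
  \<open>y\<close> avoids \<open>T\<close> and contributes nothing to the functional.\<close>

lemma extension_map_surj:
  fixes f :: "(('v, 'e) path \<Rightarrow>\<^sub>0 'k::field) set \<Rightarrow> 'k"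
  assumes y: "keys y \<subseteq> paths cutQ" and f: "f \<in> dual_space cut_algebra"
  shows "\<exists>x. keys x \<subseteq> paths Q \<and> extension_map x = (coset y, f)"
proof -
  have "\<forall>p\<in>good_paths. \<exists>q. q \<in> paths Q \<and> closes p q \<and> (\<forall>p'\<in>paths Q. closes p' q \<longleftrightarrow> p' = p)"
    using good_paths_complement by blast
  then obtain comp where comp: "comp p \<in> paths Q" "closes p (comp p)"
      "p' \<in> paths Q \<Longrightarrow> closes p' (comp p) \<longleftrightarrow> p' = p"
    if "p \<in> good_paths" for p p'
    by metis
  have f_add: "f (coset (a + b)) = f (coset a) + f (coset b)"
    if "keys a \<subseteq> paths cutQ" "keys b \<subseteq> paths cutQ" for a b
    using f coset_in_carrier[OF that(1)] coset_in_carrier[OF that(2)] unfolding dual_space_def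
    by (simp add: cut_algebra_simps(2)[OF that, symmetric])
  have f_scal: "f (coset (scal c a)) = c * f (coset a)" if "keys a \<subseteq> paths cutQ" for c a
    using f coset_in_carrier[OF that] unfolding dual_space_def
    by (simp add: cut_algebra_simps(3)[OF that that, symmetric])
  have f_zero: "f (coset 0) = 0"
    using f_scal[of 0 0] by simp
  define w where "w = (\<Sum>p\<in>good_paths. single (comp p) (f (coset (single p 1))))"
  have keys_w: "keys w \<subseteq> paths Q"
  proof
    fix r assume "r \<in> keys w"
    then have "(\<Sum>p\<in>good_paths. lookup (single (comp p) (f (coset (single p 1)))) r) \<noteq> 0"
      by (simp add: in_keys_iff w_def lookup_sum)
    then obtain p where p: "p \<in> good_paths" "lookup (single (comp p) (f (coset (single p 1)))) r \<noteq> 0"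
      by (rule sum.not_neutral_contains_not_neutral)
    then have "r = comp p"
      by (simp add: lookup_single when_def split: if_splits)
    then show "r \<in> paths Q"
      using comp(1)[OF p(1)] by simp
  qed
  have "comp p \<notin> paths cutQ" if p: "p \<in> good_paths" for p
  proof
    assume *: "comp p \<in> paths cutQ"
    obtain u p' v v' q' w where pq: "p = (u, p', v)" "comp p = (v', q', w)"
      by (cases p; cases "comp p")
    have "p' @ q' \<in> S"
      using comp(2)[OF p] unfolding pq(2) by (simp add: pq(1))
    moreover have "set p' \<inter> T = {}" "set q' \<inter> T = {}"
      using good_paths_cutQ[OF p] *[unfolded pq(2)] by (simp_all add: pq(1) paths_cutQ)
    ultimately show False
      using S_meets_T[of "p' @ q'"] by auto
  qed
  then have proj_w: "proj w = 0"
    by (simp add: w_def proj_sum proj_single)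
  have trace_w: "trace (w \<star> z) = f (coset z)" if "keys z \<subseteq> paths cutQ" for z
    using that
  proof (induction z rule: keys_subset_induct)
    case zero
    then show ?case by (simp add: f_zero)
  next
    case (single q c)
    have q: "q \<in> paths Q"
      using single paths_cutQ_subset by blast
    show ?case
    proof (cases "q \<in> good_paths")
      case True
      have "trace (w \<star> single q c) =
          (\<Sum>p\<in>good_paths. if p = q then f (coset (single p 1)) * c else 0)"
        unfolding w_def pmul_sum_left trace_linear
      proof (rule sum.cong[OF refl])
        fix p assume p: "p \<in> good_paths"
        show "trace (single (comp p) (f (coset (single p 1))) \<star> single q c) =
            (if p = q then f (coset (single p 1)) * c else 0)"
          unfolding trace_single_pmul[OF comp(1)[OF p] q] closes_commute[of "comp p"]
            comp(3)[OF p q] by auto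
      qed
      also have "\<dots> = c * f (coset (single q 1))"
        using True finite_good_paths by simp
      also have "\<dots> = f (coset (single q c))"
        using f_scal[of "single q 1" c] single by simp
      finally show ?thesis .
    next
      case False
      then have "single q c \<in> cut_ideal"
        using single by (simp add: cut_ideal_eq)
      then show ?thesis
        using trace_pmul_cut_ideal[OF keys_w] coset_bad_path[OF single False, of c] f_zero by simp
    qed
  next
    case (add a b)
    then show ?case by (simp add: pmul_add_right f_add)
  qed
  have "proj (y + w) = y"
    using proj_id[OF y] proj_w by simp
  moreover have "extension_map (y + w) = (coset (proj (y + w)), \<lambda>X\<in>carrier cut_algebra. f X)"
  proof (rule extension_map_eqI)
    show "keys (y + w) \<subseteq> paths Q"
      using keys_cutQ[OF y] keys_w by (rule keys_add_closed)
    show "trace ((y + w) \<star> z) = f (coset z)" if "keys z \<subseteq> paths cutQ" for z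
      using trace_pmul_cutQ[OF y that] trace_w[OF that] by (simp add: pmul_add_left)
  qed
  moreover have "(\<lambda>X\<in>carrier cut_algebra. f X) = f"
    using f unfolding dual_space_def by (intro extensional_restrict) simp
  ultimately show ?thesis
    using keys_add_closed[OF keys_cutQ[OF y] keys_w] by auto
qed

theorem defined_algebra_isomorphic_trivial_extension:
  "algebra_isomorphic (defined_algebra Q S :: ('k::field, _) module)
    (trivial_extension (cut_algebra :: ('k, _) module))"
proof -
  interpret algebra_ideal relation_ideal "path_algebra Q :: ('k, _) module"
    by (rule algebra_ideal_relation_ideal)
  have "algebra_isomorphic quot (trivial_extension (cut_algebra :: ('k, _) module))"
  proof (rule quot_isomorphicI[of extension_map])
    have "extension_map ` {x. keys x \<subseteq> paths Q} = carrier (trivial_extension (cut_algebra :: ('k, _) module))"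
    proof (intro subset_antisym subsetI)
      fix Y assume "Y \<in> extension_map ` {x :: _ \<Rightarrow>\<^sub>0 'k. keys x \<subseteq> paths Q}"
      then show "Y \<in> carrier (trivial_extension cut_algebra)"
        using extension_map_in_carrier by blast
    next
      fix Y assume "Y \<in> carrier (trivial_extension (cut_algebra :: ('k, _) module))"
      then obtain X f where Y: "Y = (X, f)" "X \<in> carrier cut_algebra" "f \<in> dual_space cut_algebra"
        by (auto simp: trivial_extension_def)
      from Y(2) obtain y where y: "keys y \<subseteq> paths cutQ" "X = coset y"
        by (rule coset_cases)
      obtain x where x: "keys x \<subseteq> paths Q" "extension_map x = (coset y, f)"
        using extension_map_surj[OF y(1) Y(3)] by blast
      have "Y = extension_map x"
        by (simp only: x(2) Y(1) y(2))
      then show "Y \<in> extension_map ` {x. keys x \<subseteq> paths Q}"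
        using x(1) by (intro image_eqI) simp_all
    qed
    then show "extension_map ` carrier (path_algebra Q) =
        carrier (trivial_extension (cut_algebra :: ('k, _) module))"
      by simp
  qed (simp_all add: extension_map_mult extension_map_add extension_map_scal extension_map_one
      extension_map_kernel path_algebra_minus)
  then show ?thesis
    unfolding defined_algebra_def relation_ideal_def .
qed

end

section \<open>Relabelling quivers\<close>

text \<open>As a sum of singles this is linear for arbitrary maps, even where several paths are sent
  to one. Injectivity on vertices enters only when products are compared.\<close>

definition push :: "('v \<Rightarrow> 'w) \<Rightarrow> ('e \<Rightarrow> 'f) \<Rightarrow> (('v, 'e) path \<Rightarrow>\<^sub>0 'k::field) \<Rightarrow> ('w, 'f) path \<Rightarrow>\<^sub>0 'k" where
  "push f g x = (\<Sum>p\<in>keys x. single (f (fst p), map g (fst (snd p)), f (snd (snd p))) (lookup x p))"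

lemma push_eq:
  assumes "finite P" "keys x \<subseteq> P"
  shows "push f g x = (\<Sum>p\<in>P. single (f (fst p), map g (fst (snd p)), f (snd (snd p))) (lookup x p))"
  unfolding push_def using assms by (intro sum.mono_neutral_left) (auto simp: in_keys_iff)

lemma push_zero [simp]: "push f g 0 = 0"
  by (simp add: push_def)

lemma push_add [simp]: "push f g (x + y) = push f g x + push f g y"
proof -
  have *: "push f g z = (\<Sum>p\<in>keys x \<union> keys y.
      single (f (fst p), map g (fst (snd p)), f (snd (snd p))) (lookup z p))"
    if "keys z \<subseteq> keys x \<union> keys y" for z
    using that by (intro push_eq) simp_all
  show ?thesis
    unfolding *[OF keys_add] *[OF Un_upper1] *[OF Un_upper2]
    by (simp add: lookup_add single_add sum.distrib)
qed

lemma push_diff [simp]: "push f g (x - y) = push f g x - push f g y"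
  using push_add[of f g "x - y" y] by (simp add: eq_diff_eq)

lemma push_sum: "push f g (\<Sum>i\<in>F. h i) = (\<Sum>i\<in>F. push f g (h i))"
  by (induction F rule: infinite_finite_induct) simp_all

lemma push_single [simp]: "push f g (single (u, p, v) c) = single (f u, map g p, f v) c"
  by (cases "c = 0") (simp_all add: push_def)

lemma push_scal [simp]: "push f g (scal c x) = scal c (push f g x)"
proof (induction x rule: poly_mapping_single_induct)
  case (single p d)
  then show ?case by (cases p) simp
qed (simp_all add: scal_add)

text \<open>The inverse maps belong to the data, so exchanging the two quivers gives another
  instance and every result is available in both directions.\<close>

locale quiver_iso = Q: fin_digraph Q + R: fin_digraph R
  for Q :: "('v, 'e) pre_digraph" and R :: "('w, 'f) pre_digraph" +
  fixes f :: "'v \<Rightarrow> 'w" and g :: "'e \<Rightarrow> 'f" and f' :: "'w \<Rightarrow> 'v" and g' :: "'f \<Rightarrow> 'e"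
  assumes f_verts: "v \<in> verts Q \<Longrightarrow> f v \<in> verts R \<and> f' (f v) = v"
    and f'_verts: "w \<in> verts R \<Longrightarrow> f' w \<in> verts Q \<and> f (f' w) = w"
    and g_arcs: "a \<in> arcs Q \<Longrightarrow>
      g a \<in> arcs R \<and> g' (g a) = a \<and> tail R (g a) = f (tail Q a) \<and> head R (g a) = f (head Q a)"
    and g'_arcs: "b \<in> arcs R \<Longrightarrow>
      g' b \<in> arcs Q \<and> g (g' b) = b \<and> tail Q (g' b) = f' (tail R b) \<and> head Q (g' b) = f' (head R b)"
begin

lemma flip: "quiver_iso R Q f' g' f g"
  by unfold_locales (use f_verts f'_verts g_arcs g'_arcs in auto)

lemma push_path: "(u, p, v) \<in> paths Q \<Longrightarrow> (f u, map g p, f v) \<in> paths R"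
proof (induction p arbitrary: u)
  case Nil
  then show ?case by (auto simp: Q.paths_Nil R.paths_Nil f_verts)
next
  case (Cons a p)
  then show ?case
    using g_arcs[of a] by (simp add: Q.paths_Cons_iff R.paths_Cons_iff)
qed

lemma keys_push: "keys x \<subseteq> paths Q \<Longrightarrow> keys (push f g x) \<subseteq> paths R"
proof (induction x rule: keys_subset_induct)
  case (single p c)
  then show ?case using push_path by (cases p) simp
qed (simp_all add: keys_add_closed)

lemma map_g'_g: "set p \<subseteq> arcs Q \<Longrightarrow> map g' (map g p) = p"
  using g_arcs by (simp add: map_idI subset_iff)

lemma push_push:
  assumes "keys x \<subseteq> paths Q"
  shows "push f' g' (push f g x) = x"
  using assms
proof (induction x rule: keys_subset_induct)
  case (single p c)
  obtain u p' v where p: "p = (u, p', v)" by (cases p)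
  have "u \<in> verts Q" "v \<in> verts Q" "set p' \<subseteq> arcs Q"
    using single Q.paths_verts[of u p' v] Q.paths_arcs[of u p' v] by (simp_all add: p)
  then show ?case
    using f_verts map_g'_g[of p'] by (simp add: p)
qed simp_all

lemma push_pmul:
  assumes "keys x \<subseteq> paths Q" "keys y \<subseteq> paths Q"
  shows "push f g (x \<star> y) = push f g x \<star> push f g y"
  using assms(1)
proof (induction x rule: keys_subset_induct)
  case (single p a)
  show ?case
    using assms(2)
  proof (induction y rule: keys_subset_induct)
    case (single q b)
    obtain u p' v v' q' w where pq: "p = (u, p', v)" "q = (v', q', w)"
      by (cases p; cases q)
    have "v \<in> verts Q" "v' \<in> verts Q"
      using \<open>p \<in> paths Q\<close> \<open>q \<in> paths Q\<close> Q.paths_verts by (auto simp: pq)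
    then have "f v = f v' \<longleftrightarrow> v = v'"
      using f_verts by metis
    then show ?case
      by (simp add: pq)
  qed (simp_all add: pmul_add_right)
qed (simp_all add: pmul_add_left)

lemma push_one:
  "push f g (\<Sum>v\<in>verts Q. single (v, [], v) (1 :: 'k::field)) = (\<Sum>v\<in>verts R. single (v, [], v) 1)"
proof -
  have "inj_on f (verts Q)"
    using f_verts by (metis inj_onI)
  moreover have "f ` verts Q = verts R"
    using f_verts f'_verts by (auto simp: image_iff) metis
  ultimately have "(\<Sum>v\<in>verts R. single (v, [] :: 'f list, v) (1 :: 'k)) =
      (\<Sum>v\<in>verts Q. single (f v, [], f v) 1)"
    using sum.reindex[of f "verts Q" "\<lambda>v. single (v, [] :: 'f list, v) (1 :: 'k)"] by simp
  then show ?thesis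
    by (simp add: push_sum)
qed

lemma push_path_elem:
  assumes "p \<noteq> []" "set p \<subseteq> arcs Q"
  shows "push f g (path_elem Q p) = path_elem R (map g p)"
proof -
  have "hd p \<in> arcs Q" "last p \<in> arcs Q"
    using assms hd_in_set last_in_set by blast+
  then show ?thesis
    using assms(1) g_arcs by (simp add: path_elem_def hd_map last_map)
qed

lemma push_defining_relations:
  assumes S: "\<And>C. C \<in> S \<Longrightarrow> C \<noteq> [] \<and> set C \<subseteq> arcs Q"
    and x: "(x :: _ \<Rightarrow>\<^sub>0 'k::field) \<in> defining_relations Q S"
  shows "push f g x \<in> defining_relations R (map g ` S)"
proof -
  have tail: "tail R (hd (map g C)) = f (tail Q (hd C))" if "C \<in> S" for C
  proof -
    have "hd C \<in> arcs Q"
      using S[OF that] hd_in_set by blast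
    then show ?thesis
      using S[OF that] g_arcs by (simp add: hd_map)
  qed
  have "(\<exists>C C'. x = path_elem Q C - path_elem Q C' \<and> C \<in> S \<and> C' \<in> S \<and>
      tail Q (hd C) = tail Q (hd C')) \<or>
    (\<exists>C. x = path_elem Q (C @ [hd C]) \<and> C \<in> S) \<or>
    (\<exists>a b. x = arrow_elem Q a \<otimes>\<^bsub>path_algebra Q\<^esub> arrow_elem Q b \<and> a \<in> arcs Q \<and> b \<in> arcs Q \<and>
      \<not> (\<exists>C\<in>S. sublist [a, b] C))"
    using x unfolding defining_relations_def by blast
  then show ?thesis
  proof (elim disjE exE conjE)
    fix C C'
    assume *: "x = path_elem Q C - path_elem Q C'" "C \<in> S" "C' \<in> S" "tail Q (hd C) = tail Q (hd C')"
    have "push f g x = path_elem R (map g C) - path_elem R (map g C')"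
      using *(1) S[OF *(2)] S[OF *(3)] by (simp add: push_path_elem)
    moreover have "tail R (hd (map g C)) = tail R (hd (map g C'))"
      using *(4) tail[OF *(2)] tail[OF *(3)] by simp
    moreover have "map g C \<in> map g ` S" "map g C' \<in> map g ` S"
      using *(2,3) by simp_all
    ultimately show ?thesis
      unfolding defining_relations_def by blast
  next
    fix C assume *: "x = path_elem Q (C @ [hd C])" "C \<in> S"
    have "set (C @ [hd C]) \<subseteq> arcs Q"
      using S[OF *(2)] hd_in_set[of C] by auto
    then have "push f g x = path_elem R (map g C @ [hd (map g C)])"
      using *(1) S[OF *(2)] push_path_elem[of "C @ [hd C]"] by (simp add: hd_map)
    moreover have "map g C \<in> map g ` S"
      using *(2) by simp
    ultimately show ?thesis
      unfolding defining_relations_def by blast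
  next
    fix a b
    assume *: "x = arrow_elem Q a \<otimes>\<^bsub>path_algebra Q\<^esub> arrow_elem Q b" "a \<in> arcs Q" "b \<in> arcs Q"
      "\<not> (\<exists>C\<in>S. sublist [a, b] C)"
    have keys: "keys (arrow_elem Q c :: _ \<Rightarrow>\<^sub>0 'k) \<subseteq> paths Q" if "c \<in> arcs Q" for c
      using Q.arrow_in_paths[OF that] by (simp add: arrow_elem_def path_elem_def)
    have push: "push f g (arrow_elem Q c :: _ \<Rightarrow>\<^sub>0 'k) = arrow_elem R (g c)" if "c \<in> arcs Q" for c
      using push_path_elem[of "[c]"] that by (simp add: arrow_elem_def)
    have "push f g x = arrow_elem R (g a) \<otimes>\<^bsub>path_algebra R\<^esub> arrow_elem R (g b)"
      using *(1) push_pmul[OF keys keys] push *(2,3) by simp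
    moreover have "g a \<in> arcs R" "g b \<in> arcs R"
      using g_arcs *(2,3) by simp_all
    \<comment> \<open>Relabelling back by \<open>g'\<close> would turn a cycle through the two
      images into one through \<open>a\<close> and \<open>b\<close>.\<close>
    moreover have "\<not> (\<exists>D\<in>map g ` S. sublist [g a, g b] D)"
    proof
      assume "\<exists>D\<in>map g ` S. sublist [g a, g b] D"
      then obtain C where C: "C \<in> S" "sublist [g a, g b] (map g C)"
        by blast
      have "sublist (map g' [g a, g b]) (map g' (map g C))"
        using C(2) by (rule map_mono_sublist)
      then have "sublist [a, b] C"
        using map_g'_g[of C] S[OF C(1)] g_arcs *(2,3) by simp
      then show False
        using *(4) C(1) by blast
    qed
    ultimately show ?thesis
      unfolding defining_relations_def by blast
  qed
qed

lemma cycle_set_image: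
  assumes "cycle_set Q S"
  shows "cycle_set R (map g ` S)"
proof -
  interpret cycle_set Q S by fact
  have arcs: "set C \<subseteq> arcs Q" if "C \<in> S" for C
    using Q.paths_arcs[OF S_path[OF that]] .
  have inj: "inj_on g (arcs Q)"
    using g_arcs by (metis inj_onI)
  show ?thesis
  proof
    fix D assume "D \<in> map g ` S"
    then obtain C where C: "D = map g C" "C \<in> S" by blast
    have hd: "hd C \<in> arcs Q"
      using arcs[OF C(2)] hd_in_set[OF S_nonempty[OF C(2)]] by blast
    show "(tail R (hd D), D, tail R (hd D)) \<in> paths R"
      using push_path[OF S_path[OF C(2)]] S_nonempty[OF C(2)] g_arcs[OF hd] by (simp add: C(1) hd_map)
    show "D \<noteq> []"
      using S_nonempty[OF C(2)] by (simp add: C(1))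
    show "distinct D"
      using S_distinct[OF C(2)] inj_on_subset[OF inj arcs[OF C(2)]] by (simp add: C(1) distinct_map)
    show "length D \<noteq> 1"
      using S_length[OF C(2)] by (simp add: C(1))
    show "rotate n D \<in> map g ` S" for n
      using S_rotate[OF C(2), of n] by (simp add: C(1) rotate_map)
    fix D' assume "D' \<in> map g ` S" and meet: "set D \<inter> set D' \<noteq> {}"
    then obtain C' where C': "D' = map g C'" "C' \<in> S" by blast
    have "set C \<inter> set C' \<noteq> {}"
    proof -
      obtain c c' where c: "c \<in> set C" "c' \<in> set C'" "g c = g c'"
        using meet by (auto simp: C(1) C'(1))
      then have "c = c'"
        using inj arcs[OF C(2)] arcs[OF C'(2)] by (meson inj_onD subsetD)
      then show ?thesis
        using c by blast
    qed
    then obtain n where "C' = rotate n C"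
      using S_disjoint[OF C(2) C'(2)] by blast
    then show "\<exists>n. D' = rotate n D"
      by (auto simp: C(1) C'(1) rotate_map)
  next
    fix b assume b: "b \<in> arcs R"
    then obtain C where "C \<in> S" "g' b \<in> set C"
      using S_cover g'_arcs by blast
    then show "\<exists>D\<in>map g ` S. b \<in> set D"
      using g'_arcs[OF b] by (metis image_eqI list.set_map)
  qed
qed

text \<open>The elements sent into the ideal of the target form an ideal containing the relations of
  the source, hence everything these generate.\<close>

lemma push_ideal:
  assumes "cycle_set Q S"
    and x: "(x :: _ \<Rightarrow>\<^sub>0 'k::field) \<in> cycle_set.relation_ideal Q S"
  shows "push f g x \<in> cycle_set.relation_ideal R (map g ` S)"
proof -
  interpret S: cycle_set Q S by fact
  interpret S': cycle_set R "map g ` S" using assms(1) by (rule cycle_set_image)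
  interpret I: ideal S'.relation_ideal "path_algebra R :: ('k, _) module"
    by (rule S'.ideal_relation_ideal)
  interpret ring "path_algebra Q :: ('k, _) module" by (rule Q.ring_path_algebra)
  let ?J = "{x :: _ \<Rightarrow>\<^sub>0 'k. keys x \<subseteq> paths Q \<and> push f g x \<in> S'.relation_ideal}"
  have "ideal ?J (path_algebra Q)"
  proof (rule Q.path_idealI)
    fix x y :: "('v, 'e) path \<Rightarrow>\<^sub>0 'k"
    assume x: "x \<in> ?J" and y: "keys y \<subseteq> paths Q"
    have "push f g y \<star> push f g x \<in> S'.relation_ideal" "push f g x \<star> push f g y \<in> S'.relation_ideal"
      using I.I_l_closed[of "push f g x" "push f g y"] I.I_r_closed[of "push f g x" "push f g y"]
        x keys_push[OF y] by simp_all
    then show "y \<star> x \<in> ?J" "x \<star> y \<in> ?J"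
      using x y by (simp_all add: push_pmul Q.keys_pmul_closed)
  qed (auto simp: keys_add_closed S'.relation_ideal_zero S'.relation_ideal_add)
  moreover have "defining_relations Q S \<subseteq> ?J"
  proof
    fix x :: "('v, 'e) path \<Rightarrow>\<^sub>0 'k"
    assume x: "x \<in> defining_relations Q S"
    have "C \<noteq> [] \<and> set C \<subseteq> arcs Q" if "C \<in> S" for C
      using S.S_nonempty[OF that] Q.paths_arcs[OF S.S_path[OF that]] by simp
    then have "push f g x \<in> defining_relations R (map g ` S)"
      using x by (rule push_defining_relations)
    moreover have "x \<in> carrier (path_algebra Q)"
      using x S.defining_relations_subset_carrier by blast
    ultimately show "x \<in> ?J"
      using S'.defining_relation_in_ideal by simp
  qed
  ultimately have "S.relation_ideal \<subseteq> ?J"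
    unfolding S.relation_ideal_def by (rule genideal_minimal)
  then show ?thesis
    using x by blast
qed

theorem defined_algebra_isomorphic:
  assumes "cycle_set Q S"
  shows "algebra_isomorphic (defined_algebra Q S :: ('k::field, _) module)
    (defined_algebra R (map g ` S) :: ('k, _) module)"
proof -
  interpret S: cycle_set Q S by fact
  interpret S': cycle_set R "map g ` S" using assms by (rule cycle_set_image)
  interpret A: algebra_ideal S.relation_ideal "path_algebra Q :: ('k, _) module"
    by (rule S.algebra_ideal_relation_ideal)
  interpret B: algebra_ideal S'.relation_ideal "path_algebra R :: ('k, _) module"
    by (rule S'.algebra_ideal_relation_ideal)
  interpret flip: quiver_iso R Q f' g' f g by (rule flip)
  have arcs: "set C \<subseteq> arcs Q" if "C \<in> S" for C
    using Q.paths_arcs[OF S.S_path[OF that]] .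
  have S: "map g' ` map g ` S = S"
    using map_g'_g[OF arcs] by (simp add: image_image)
  let ?h = "\<lambda>x. S'.relation_ideal +>\<^bsub>path_algebra R\<^esub> push f g x"
  have ker: "?h x = ?h y \<longleftrightarrow> x - y \<in> S.relation_ideal"
    if x: "keys x \<subseteq> paths Q" and y: "keys y \<subseteq> paths Q" for x y :: "_ \<Rightarrow>\<^sub>0 'k"
  proof -
    have "?h x = ?h y \<longleftrightarrow> push f g (x - y) \<in> S'.relation_ideal"
      using B.coset_eq_iff[of "push f g x" "push f g y"] keys_push[OF x] keys_push[OF y]
        R.path_algebra_minus[OF keys_push[OF x] keys_push[OF y]] by simp
    moreover have "push f g (x - y) \<in> S'.relation_ideal \<longleftrightarrow> x - y \<in> S.relation_ideal"
    proof
      assume "push f g (x - y) \<in> S'.relation_ideal"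
      \<comment> \<open>This direction is \<open>push_ideal\<close> for the inverse relabelling,
        which carries the relabelled cycles back to \<open>S\<close>.\<close>
      from flip.push_ideal[OF S'.cycle_set_axioms this]
      show "x - y \<in> S.relation_ideal"
        unfolding S push_push[OF keys_diff_closed[OF x y]] .
    next
      assume "x - y \<in> S.relation_ideal"
      then show "push f g (x - y) \<in> S'.relation_ideal"
        by (rule push_ideal[OF assms])
    qed
    ultimately show ?thesis by simp
  qed
  have "algebra_isomorphic A.quot B.quot"
  proof (rule A.quot_isomorphicI[of ?h])
    have "?h ` {x :: _ \<Rightarrow>\<^sub>0 'k. keys x \<subseteq> paths Q} = carrier B.quot"
    proof (intro subset_antisym subsetI)
      fix Y assume "Y \<in> ?h ` {x :: _ \<Rightarrow>\<^sub>0 'k. keys x \<subseteq> paths Q}"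
      then show "Y \<in> carrier B.quot"
        unfolding B.quot_carrier using keys_push by auto
    next
      fix Y assume "Y \<in> carrier B.quot"
      then obtain y where y: "keys y \<subseteq> paths R" "Y = S'.relation_ideal +>\<^bsub>path_algebra R\<^esub> y"
        unfolding B.quot_carrier by auto
      have "keys (push f' g' y) \<subseteq> paths Q"
        using flip.keys_push[OF y(1)] .
      moreover have "Y = ?h (push f' g' y)"
        by (simp only: y(2) flip.push_push[OF y(1)])
      ultimately show "Y \<in> ?h ` {x :: _ \<Rightarrow>\<^sub>0 'k. keys x \<subseteq> paths Q}"
        by (intro image_eqI) simp_all
    qed
    then show "?h ` carrier (path_algebra Q :: ('k, _) module) = carrier B.quot"
      by simp
  next
    fix x y :: "('v, 'e) path \<Rightarrow>\<^sub>0 'k" and c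
    assume "x \<in> carrier (path_algebra Q)" "y \<in> carrier (path_algebra Q)"
    then have xy: "keys x \<subseteq> paths Q" "keys y \<subseteq> paths Q" by simp_all
    note carr = keys_push[OF xy(1)] keys_push[OF xy(2)]
    show "?h (x \<otimes>\<^bsub>path_algebra Q\<^esub> y) = ?h x \<otimes>\<^bsub>B.quot\<^esub> ?h y"
      using B.quot_mult[of "push f g x" "push f g y"] carr push_pmul[OF xy]
      by (simp del: quotient_algebra_fields)
    show "?h (x \<oplus>\<^bsub>path_algebra Q\<^esub> y) = ?h x \<oplus>\<^bsub>B.quot\<^esub> ?h y"
      using B.quot_add[of "push f g x" "push f g y"] carr by (simp del: quotient_algebra_fields)
    show "?h x = ?h y \<longleftrightarrow> x \<ominus>\<^bsub>path_algebra Q\<^esub> y \<in> S.relation_ideal"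
      using ker[OF xy] Q.path_algebra_minus[OF xy] by simp
  next
    fix x :: "('v, 'e) path \<Rightarrow>\<^sub>0 'k" and c
    assume "x \<in> carrier (path_algebra Q)"
    then have x: "keys (push f g x) \<subseteq> paths R"
      using keys_push by simp
    show "?h (c \<odot>\<^bsub>path_algebra Q\<^esub> x) = c \<odot>\<^bsub>B.quot\<^esub> ?h x"
      using B.quot_smult[of "push f g x" c] x by (simp del: quotient_algebra_fields)
  next
    show "?h \<one>\<^bsub>path_algebra Q\<^esub> = \<one>\<^bsub>B.quot\<^esub>"
      unfolding B.quot_one by (simp add: push_one)
  qed
  then show ?thesis
    unfolding defined_algebra_def S.relation_ideal_def S'.relation_ideal_def .
qed

end

lemma quiver_iso_nat:
  fixes Q :: "('v, 'e) pre_digraph"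
  assumes "fin_digraph Q"
  shows "\<exists>(R :: (nat, nat) pre_digraph) f g f' g'. quiver_iso Q R f g f' g'"
proof -
  interpret fin_digraph Q by fact
  obtain f :: "'v \<Rightarrow> nat" where f: "inj_on f (verts Q)"
    using finite_imp_inj_to_nat_seg[OF finite_verts] by blast
  obtain g :: "'e \<Rightarrow> nat" where g: "inj_on g (arcs Q)"
    using finite_imp_inj_to_nat_seg[OF finite_arcs] by blast
  let ?f' = "inv_into (verts Q) f" and ?g' = "inv_into (arcs Q) g"
  let ?R = "\<lparr>verts = f ` verts Q, arcs = g ` arcs Q,
    tail = \<lambda>b. f (tail Q (?g' b)), head = \<lambda>b. f (head Q (?g' b))\<rparr>"
  have inv: "v \<in> verts Q \<Longrightarrow> ?f' (f v) = v" "a \<in> arcs Q \<Longrightarrow> ?g' (g a) = a" for v a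
    using f g by simp_all
  have "quiver_iso Q ?R f g ?f' ?g'"
    by unfold_locales (auto simp: inv)
  then show ?thesis by blast
qed

section \<open>Algebras of defining pairs\<close>

lemma cycle_set_defining_pair:
  assumes "fin_digraph Q" "defining_pair Q S \<mu>" "\<forall>C\<in>S. \<mu> C = 1"
  shows "cycle_set Q S"
proof -
  interpret fin_digraph Q by fact
  have S: "simple_cycle Q C" "length C \<noteq> 1" "rotate n C \<in> S" if "C \<in> S" for C n
    using assms(2,3) that unfolding defining_pair_def by force+
  have cover: "\<exists>C\<in>S. a \<in> set C" if "a \<in> arcs Q" for a
    using assms(2) that unfolding defining_pair_def by blast
  have disjoint: "\<exists>n. C' = rotate n C" if "C \<in> S" "C' \<in> S" "set C \<inter> set C' \<noteq> {}" for C C'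
    using assms(2) that unfolding defining_pair_def by blast
  show ?thesis
  proof
    fix C assume C: "C \<in> S"
    then obtain v where v: "C \<noteq> []" "distinct C" "(v, C, v) \<in> paths Q"
      using S(1)[OF C] by (auto simp: simple_cycle_def mem_paths_iff)
    show "(tail Q (hd C), C, tail Q (hd C)) \<in> paths Q"
      using v(3) paths_tail_hd[OF v(3,1)] by simp
    show "C \<noteq> []" "distinct C" "length C \<noteq> 1" "rotate n C \<in> S" for n
      using v S(2,3)[OF C] by simp_all
  qed (use cover disjoint in blast)+
qed

text \<open>Indecomposability is used twice: on the given algebra, to place every vertex on a cycle,
  and through the isomorphism, to pass to the cut algebra.\<close>

lemma trivial_extension_of_almost_gentle:
  fixes Q :: "('v, 'e) pre_digraph"
  assumes Q: "fin_digraph Q" "arcs Q \<noteq> {}" "defining_pair Q S \<mu>" "\<forall>C\<in>S. \<mu> C = 1"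
    and indec: "indecomposable_algebra (defined_algebra Q S :: ('k::field, _) module)"
  shows "\<exists>A :: ('k, ((nat, nat) path \<Rightarrow>\<^sub>0 'k) set) module.
    almost_gentle A \<and>
    algebra_isomorphic (defined_algebra Q S :: ('k, _) module) (trivial_extension A)"
proof -
  have S: "cycle_set Q S"
    using Q by (intro cycle_set_defining_pair)
  interpret S: cycle_set Q S by (rule S)
  obtain R :: "(nat, nat) pre_digraph" and f g f' g' where iso: "quiver_iso Q R f g f' g'"
    using quiver_iso_nat[OF Q(1)] by blast
  interpret iso: quiver_iso Q R f g f' g' by (rule iso)
  let ?S = "map g ` S"
  interpret S': cycle_set R ?S by (rule iso.cycle_set_image[OF S])
  \<comment> \<open>The least arrow depends only on the set of arrows of a cycle, so rotations have
    the same one, while cycles that are not rotations of each other share no arrow. Hence each cycle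
    contains exactly one element of \<open>?T\<close>.\<close>
  let ?T = "Min ` set ` ?S"
  interpret cut: cut_quiver R ?S ?T
  proof unfold_locales
    fix w assume w: "w \<in> verts R"
    then obtain a where a: "a \<in> arcs Q" "tail Q a = f' w"
      using S.vertex_arrow_if_indecomposable[OF indec Q(2)] iso.f'_verts by blast
    then show "\<exists>b\<in>arcs R. tail R b = w"
      using iso.g_arcs[OF a(1)] iso.f'_verts[OF w] by (intro bexI[of _ "g a"]) simp_all
  next
    fix C assume C: "C \<in> ?S"
    show "\<exists>!a. a \<in> set C \<and> a \<in> ?T"
    proof (rule ex1I)
      show "Min (set C) \<in> set C \<and> Min (set C) \<in> ?T"
        using C S'.S_nonempty[OF C] by simp
      fix a assume a: "a \<in> set C \<and> a \<in> ?T"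
      then obtain C' where C': "C' \<in> ?S" "a = Min (set C')"
        by blast
      then have "a \<in> set C'"
        using S'.S_nonempty[OF C'(1)] by simp
      then obtain n where "C' = rotate n C"
        using S'.S_disjoint[OF C C'(1)] a by blast
      then show "a = Min (set C)"
        using C'(2) by simp
    qed
  qed
  let ?A = "cut.cut_algebra :: ('k, _) module"
  have T: "algebra_isomorphic (defined_algebra Q S :: ('k, _) module) (trivial_extension ?A)"
    using iso.defined_algebra_isomorphic[OF S] cut.defined_algebra_isomorphic_trivial_extension
    by (rule algebra_isomorphic_trans)
  have A: "indecomposable_algebra ?A"
    using indecomposable_if_trivial_extension[OF cut.k_algebra_cut_algebra T indec
        k_algebraD(1)[OF S.k_algebra_defined_algebra]] .
  have "almost_gentle ?A"
    unfolding almost_gentle_def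
  proof (intro conjI exI)
    show "indecomposable_algebra (quotient_algebra (path_algebra cut.cutQ) (cut.cut_ideal :: (_ \<Rightarrow>\<^sub>0 'k) set))"
      using A unfolding cut.cut_algebra_def .
    show "morita_equivalent ?A (quotient_algebra (path_algebra cut.cutQ) (cut.cut_ideal :: (_ \<Rightarrow>\<^sub>0 'k) set))"
      unfolding cut.cut_algebra_def by (rule morita_equivalent_refl)
  qed (rule cut.fd_algebra_cut_algebra A cut.fin_digraph_cutQ cut.admissible_cut_ideal
      cut.cond_S1_cut cut.cond_S0_cut)+
  then show ?thesis
    using T by blast
qed

section \<open>Brauer configuration algebras\<close>

lemma (in fin_digraph) paths_chainI:
  "p \<noteq> [] \<Longrightarrow> set p \<subseteq> arcs G \<Longrightarrow>
    (\<And>k. Suc k < length p \<Longrightarrow> head G (p ! k) = tail G (p ! Suc k)) \<Longrightarrow>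
    (tail G (hd p), p, head G (last p)) \<in> paths G"
proof (induction p)
  case (Cons a p)
  show ?case
  proof (cases p)
    case Nil
    then show ?thesis
      using Cons.prems(2) arrow_in_paths by simp
  next
    case (Cons b q)
    have "head G (p ! k) = tail G (p ! Suc k)" if "Suc k < length p" for k
      using Cons.prems(3)[of "Suc k"] that by simp
    then have "(tail G (hd p), p, head G (last p)) \<in> paths G"
      using Cons.IH Cons.prems(2) \<open>p = b # q\<close> by simp
    moreover have "head G a = tail G b"
      using Cons.prems(3)[of 0] \<open>p = b # q\<close> by simp
    ultimately show ?thesis
      using Cons.prems(2) \<open>p = b # q\<close> by (simp add: paths_Cons_iff)
  qed
qed simp

locale unit_brauer_configuration =
  fixes \<Gamma> :: "('a, 'p) brauer_configuration"
  assumes configuration: "brauer_configuration \<Gamma>"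
    and unit: "\<alpha> \<in> vertices \<Gamma> \<Longrightarrow> multiplicity_fun \<Gamma> \<alpha> = 1"
begin

abbreviation "Q \<equiv> brauer_quiver \<Gamma>"

lemma finite_polygons: "finite (polygons \<Gamma>)"
  and finite_vertices: "finite (vertices \<Gamma>)"
  using configuration by (simp_all add: brauer_configuration_def)

lemma orientation:
  assumes "\<alpha> \<in> vertices \<Gamma>"
  shows "distinct (orientation \<Gamma> \<alpha>)"
    and "set (orientation \<Gamma> \<alpha>) = (SIGMA V:polygons \<Gamma>. {..<count (corners \<Gamma> V) \<alpha>})"
  using assms configuration by (auto simp: brauer_configuration_def)

lemma length_orientation:
  assumes "\<alpha> \<in> vertices \<Gamma>"
  shows "length (orientation \<Gamma> \<alpha>) = valency \<Gamma> \<alpha>"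
proof -
  have "length (orientation \<Gamma> \<alpha>) = card (SIGMA V:polygons \<Gamma>. {..<count (corners \<Gamma> V) \<alpha>})"
    using distinct_card[OF orientation(1)[OF assms]] orientation(2)[OF assms] by simp
  then show ?thesis
    using finite_polygons by (simp add: valency_def)
qed

lemma orientation_polygon:
  assumes "\<alpha> \<in> vertices \<Gamma>" "i < valency \<Gamma> \<alpha>"
  shows "fst (orientation \<Gamma> \<alpha> ! i) \<in> polygons \<Gamma>"
proof -
  have "orientation \<Gamma> \<alpha> ! i \<in> set (orientation \<Gamma> \<alpha>)"
    using assms length_orientation by simp
  then show ?thesis
    unfolding orientation(2)[OF assms(1)] by (cases "orientation \<Gamma> \<alpha> ! i") simp
qed

text \<open>Every vertex occurs in a polygon, so its valency is positive; with multiplicity one,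
  being truncated means having valency one. The lower bound keeps special cycles from being loops,
  as (D0) demands.\<close>

lemma nontruncatedD:
  assumes "\<alpha> \<in> nontruncated \<Gamma>"
  shows "\<alpha> \<in> vertices \<Gamma>" "2 \<le> valency \<Gamma> \<alpha>" "multiplicity_fun \<Gamma> \<alpha> = 1"
proof -
  show v: "\<alpha> \<in> vertices \<Gamma>"
    using assms by (simp add: nontruncated_def)
  then obtain V where V: "V \<in> polygons \<Gamma>" "\<alpha> \<in># corners \<Gamma> V"
    using configuration unfolding brauer_configuration_def by blast
  then have "(V, 0) \<in> set (orientation \<Gamma> \<alpha>)"
    using orientation(2)[OF v] by simp
  then have "0 < length (orientation \<Gamma> \<alpha>)"
    by (rule length_pos_if_in_set)
  then have "valency \<Gamma> \<alpha> \<noteq> 0"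
    using length_orientation[OF v] by simp
  then show "2 \<le> valency \<Gamma> \<alpha>"
    using assms unit[OF v] by (simp add: nontruncated_def)
  show "multiplicity_fun \<Gamma> \<alpha> = 1"
    using unit[OF v] .
qed

lemma quiver_simps [simp]:
  "verts Q = polygons \<Gamma>"
  "(\<alpha>, i) \<in> arcs Q \<longleftrightarrow> \<alpha> \<in> nontruncated \<Gamma> \<and> i < valency \<Gamma> \<alpha>"
  "tail Q (\<alpha>, i) = fst (orientation \<Gamma> \<alpha> ! i)"
  "head Q (\<alpha>, i) = fst (orientation \<Gamma> \<alpha> ! (Suc i mod valency \<Gamma> \<alpha>))"
  by (simp_all add: brauer_quiver_def)

lemma fin_digraph_Q: "fin_digraph Q"
proof
  fix e assume e: "e \<in> arcs Q"
  obtain \<alpha> i where ai: "e = (\<alpha>, i)" by (cases e)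
  then have *: "\<alpha> \<in> nontruncated \<Gamma>" "i < valency \<Gamma> \<alpha>"
    using e by simp_all
  then show "tail Q e \<in> verts Q" "head Q e \<in> verts Q"
    using orientation_polygon nontruncatedD(1) by (simp_all add: ai)
next
  have "arcs Q = (SIGMA \<alpha>:nontruncated \<Gamma>. {..<valency \<Gamma> \<alpha>})"
    by auto
  moreover have "finite (nontruncated \<Gamma>)"
    using finite_vertices by (simp add: nontruncated_def)
  ultimately show "finite (arcs Q)"
    by simp
qed (simp add: finite_polygons)

interpretation fin_digraph Q
  by (rule fin_digraph_Q)

section \<open>The special cycles as a defining pair\<close>

abbreviation base_cycle :: "'a \<Rightarrow> ('a \<times> nat) list" where
  "base_cycle \<alpha> \<equiv> map (Pair \<alpha>) [0..<valency \<Gamma> \<alpha>]"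

definition cycles :: "('a \<times> nat) list set" where
  "cycles = (\<Union>\<alpha>\<in>nontruncated \<Gamma>. special_cycles \<Gamma> \<alpha>)"

lemma special_cycles_iff:
  "C \<in> special_cycles \<Gamma> \<alpha> \<longleftrightarrow> (\<exists>i<valency \<Gamma> \<alpha>. C = rotate i (base_cycle \<alpha>))"
  by (auto simp: special_cycles_def)

lemma rotate_base_cycle_path:
  assumes \<alpha>: "\<alpha> \<in> nontruncated \<Gamma>"
  shows "(tail Q (hd (rotate i (base_cycle \<alpha>))), rotate i (base_cycle \<alpha>),
    tail Q (hd (rotate i (base_cycle \<alpha>)))) \<in> paths Q"
proof -
  let ?n = "valency \<Gamma> \<alpha>" and ?C = "rotate i (base_cycle \<alpha>)"
  have n: "2 \<le> ?n"
    using nontruncatedD(2)[OF \<alpha>] .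
  then have ne: "?C \<noteq> []" by simp
  have nth: "?C ! k = (\<alpha>, (i + k) mod ?n)" if "k < ?n" for k
    using that n by (simp add: nth_rotate)
  have "(tail Q (hd ?C), ?C, head Q (last ?C)) \<in> paths Q"
  proof (rule paths_chainI[OF ne])
    show "set ?C \<subseteq> arcs Q"
      using \<alpha> by auto
    show "head Q (?C ! k) = tail Q (?C ! Suc k)" if "Suc k < length ?C" for k
      using that nth[of k] nth[of "Suc k"] by (simp add: mod_Suc_eq)
  qed
  moreover have "head Q (last ?C) = tail Q (hd ?C)"
  proof -
    have "hd ?C = ?C ! 0" "last ?C = ?C ! (?n - 1)"
      using ne by (simp_all add: hd_conv_nth last_conv_nth)
    moreover have "Suc ((i + (?n - 1)) mod ?n) mod ?n = i mod ?n"
      using n by (simp add: mod_Suc_eq)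
    ultimately show ?thesis
      using nth[of 0] nth[of "?n - 1"] n by simp
  qed
  ultimately show ?thesis by simp
qed

lemma defining_pair_cycles: "defining_pair Q cycles (\<lambda>_. 1)"
proof -
  have cycles: "\<exists>\<alpha> i. \<alpha> \<in> nontruncated \<Gamma> \<and> i < valency \<Gamma> \<alpha> \<and> C = rotate i (base_cycle \<alpha>)"
    if "C \<in> cycles" for C
    using that by (auto simp: cycles_def special_cycles_iff)
  have rotate: "rotate i (base_cycle \<alpha>) \<in> cycles" if \<alpha>: "\<alpha> \<in> nontruncated \<Gamma>" for \<alpha> i
  proof -
    have "i mod valency \<Gamma> \<alpha> < valency \<Gamma> \<alpha>"
      using nontruncatedD(2)[OF \<alpha>] by simp
    moreover have "rotate i (base_cycle \<alpha>) = rotate (i mod valency \<Gamma> \<alpha>) (base_cycle \<alpha>)"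
      using rotate_conv_mod[of i "base_cycle \<alpha>"] by simp
    ultimately have "rotate i (base_cycle \<alpha>) \<in> special_cycles \<Gamma> \<alpha>"
      unfolding special_cycles_iff by blast
    then show ?thesis
      using \<alpha> unfolding cycles_def by blast
  qed
  show ?thesis
    unfolding defining_pair_def
  proof (intro conjI ballI allI impI)
    fix C assume "C \<in> cycles"
    then obtain \<alpha> i where C: "\<alpha> \<in> nontruncated \<Gamma>" "i < valency \<Gamma> \<alpha>" "C = rotate i (base_cycle \<alpha>)"
      using cycles by blast
    have "C \<noteq> []" "distinct C"
      using C(2) by (simp_all add: C(3) distinct_map inj_on_def)
    moreover have "\<exists>v. (v, C, v) \<in> paths Q"
      using rotate_base_cycle_path[OF C(1), of i] C(3) by blast
    ultimately show "simple_cycle Q C"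
      by (simp add: simple_cycle_def mem_paths_iff)
    show "rotate n C \<in> cycles" for n
      using rotate[OF C(1), of "n + i"] by (simp add: C(3) rotate_rotate)
    show "1 < (1 :: nat)" if "length C = 1"
      using that nontruncatedD(2)[OF C(1)] by (simp add: C(3))
    fix C' assume "C' \<in> cycles" and meet: "set C \<inter> set C' \<noteq> {}"
    then obtain \<beta> j where C': "\<beta> \<in> nontruncated \<Gamma>" "j < valency \<Gamma> \<beta>" "C' = rotate j (base_cycle \<beta>)"
      using cycles by blast
    have "\<alpha> = \<beta>"
      using meet by (auto simp: C(3) C'(3))
    \<comment> \<open>As \<open>C\<close> is the base cycle rotated by \<open>i\<close>, rotating by
      the valency minus \<open>i\<close> completes a full turn, and \<open>j\<close> further steps
      lead to \<open>C'\<close>.\<close>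
    have "rotate (j + (valency \<Gamma> \<alpha> - i)) C = rotate (j + valency \<Gamma> \<alpha>) (base_cycle \<alpha>)"
      using C(2) by (simp add: C(3) rotate_rotate)
    also have "\<dots> = rotate j (base_cycle \<alpha>)"
      using rotate_conv_mod[of "j + valency \<Gamma> \<alpha>" "base_cycle \<alpha>"] rotate_conv_mod[of j "base_cycle \<alpha>"]
      by simp
    finally show "\<exists>n. C' = rotate n C"
      unfolding C'(3) \<open>\<alpha> = \<beta>\<close> by metis
  next
    fix a assume a: "a \<in> arcs Q"
    obtain \<alpha> i where ai: "a = (\<alpha>, i)" by (cases a)
    then have "\<alpha> \<in> nontruncated \<Gamma>" "a \<in> set (rotate 0 (base_cycle \<alpha>))"
      using a by simp_all
    then show "\<exists>C\<in>cycles. a \<in> set C"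
      using rotate by blast
  qed simp_all
qed

lemma cycle_power_unit: "\<alpha> \<in> nontruncated \<Gamma> \<Longrightarrow> cycle_power C (multiplicity_fun \<Gamma> \<alpha>) = C"
  using nontruncatedD(3) by (simp add: cycle_power_def)

text \<open>Powers with exponent one are the cycles themselves, and the exception for loops is void
  because special cycles of nontruncated vertices have at least two arrows.\<close>

lemma brauer_relations_eq:
  "(brauer_relations \<Gamma> :: (_ \<Rightarrow>\<^sub>0 'k::field) set) = defining_relations Q cycles"
proof -
  have no_loop: "[a] \<notin> special_cycles \<Gamma> \<alpha>" if \<alpha>: "\<alpha> \<in> nontruncated \<Gamma>" for \<alpha> a
  proof
    assume "[a] \<in> special_cycles \<Gamma> \<alpha>"
    then obtain i where "[a] = rotate i (base_cycle \<alpha>)"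
      unfolding special_cycles_iff by blast
    then have "length (rotate i (base_cycle \<alpha>)) = 1"
      by (metis One_nat_def length_Cons list.size(3))
    then show False
      using nontruncatedD(2)[OF \<alpha>] by simp
  qed
  have differences: "{path_elem Q (cycle_power C (multiplicity_fun \<Gamma> \<alpha>)) -
       path_elem Q (cycle_power C' (multiplicity_fun \<Gamma> \<beta>)) :: _ \<Rightarrow>\<^sub>0 'k | \<alpha> \<beta> C C'.
       \<alpha> \<in> nontruncated \<Gamma> \<and> \<beta> \<in> nontruncated \<Gamma> \<and>
       C \<in> special_cycles \<Gamma> \<alpha> \<and> C' \<in> special_cycles \<Gamma> \<beta> \<and> tail Q (hd C) = tail Q (hd C')} =
    {path_elem Q C - path_elem Q C' | C C'.
       C \<in> cycles \<and> C' \<in> cycles \<and> tail Q (hd C) = tail Q (hd C')}" (is "?A = ?B")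
  proof (intro subset_antisym subsetI)
    fix x assume "x \<in> ?A"
    then obtain \<alpha> \<beta> C C' where *: "\<alpha> \<in> nontruncated \<Gamma>" "\<beta> \<in> nontruncated \<Gamma>"
      "C \<in> special_cycles \<Gamma> \<alpha>" "C' \<in> special_cycles \<Gamma> \<beta>" "tail Q (hd C) = tail Q (hd C')"
      "x = path_elem Q (cycle_power C (multiplicity_fun \<Gamma> \<alpha>)) -
        path_elem Q (cycle_power C' (multiplicity_fun \<Gamma> \<beta>))"
      by blast
    have "x = path_elem Q C - path_elem Q C'"
      using *(6) unfolding cycle_power_unit[OF *(1)] cycle_power_unit[OF *(2)] .
    moreover have "C \<in> cycles" "C' \<in> cycles"
      using *(1-4) unfolding cycles_def by blast+
    ultimately show "x \<in> ?B"
      using *(5) by blast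
  next
    fix x assume "x \<in> ?B"
    then obtain C C' where *: "C \<in> cycles" "C' \<in> cycles" "tail Q (hd C) = tail Q (hd C')"
      "x = path_elem Q C - path_elem Q C'"
      by blast
    obtain \<alpha> where \<alpha>: "\<alpha> \<in> nontruncated \<Gamma>" "C \<in> special_cycles \<Gamma> \<alpha>"
      using *(1) unfolding cycles_def by blast
    obtain \<beta> where \<beta>: "\<beta> \<in> nontruncated \<Gamma>" "C' \<in> special_cycles \<Gamma> \<beta>"
      using *(2) unfolding cycles_def by blast
    have "x = path_elem Q (cycle_power C (multiplicity_fun \<Gamma> \<alpha>)) -
        path_elem Q (cycle_power C' (multiplicity_fun \<Gamma> \<beta>))"
      using *(4) unfolding cycle_power_unit[OF \<alpha>(1)] cycle_power_unit[OF \<beta>(1)] .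
    then show "x \<in> ?A"
      using \<alpha> \<beta> *(3) by blast
  qed
  have full: "{path_elem Q (cycle_power C (multiplicity_fun \<Gamma> \<alpha>) @ [hd C]) :: _ \<Rightarrow>\<^sub>0 'k | \<alpha> C.
       \<alpha> \<in> nontruncated \<Gamma> \<and> C \<in> special_cycles \<Gamma> \<alpha>} =
    {path_elem Q (C @ [hd C]) | C. C \<in> cycles}" (is "?A = ?B")
  proof (intro subset_antisym subsetI)
    fix x assume "x \<in> ?A"
    then obtain \<alpha> C where *: "\<alpha> \<in> nontruncated \<Gamma>" "C \<in> special_cycles \<Gamma> \<alpha>"
      "x = path_elem Q (cycle_power C (multiplicity_fun \<Gamma> \<alpha>) @ [hd C])"
      by blast
    have "x = path_elem Q (C @ [hd C])"
      using *(3) unfolding cycle_power_unit[OF *(1)] .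
    then show "x \<in> ?B"
      using *(1,2) unfolding cycles_def by blast
  next
    fix x assume "x \<in> ?B"
    then obtain C where *: "C \<in> cycles" "x = path_elem Q (C @ [hd C])"
      by blast
    obtain \<alpha> where \<alpha>: "\<alpha> \<in> nontruncated \<Gamma>" "C \<in> special_cycles \<Gamma> \<alpha>"
      using *(1) unfolding cycles_def by blast
    have "x = path_elem Q (cycle_power C (multiplicity_fun \<Gamma> \<alpha>) @ [hd C])"
      using *(2) unfolding cycle_power_unit[OF \<alpha>(1)] .
    then show "x \<in> ?A"
      using \<alpha> by blast
  qed
  have pairs: "(\<exists>\<alpha>\<in>nontruncated \<Gamma>. \<exists>C\<in>special_cycles \<Gamma> \<alpha>. sublist [a, b] C) \<longleftrightarrow>
      (\<exists>C\<in>cycles. sublist [a, b] C)" for a b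
    unfolding cycles_def by blast
  have loops: "(a = b \<and> (\<exists>\<alpha>\<in>nontruncated \<Gamma>. [a] \<in> special_cycles \<Gamma> \<alpha>)) \<longleftrightarrow> False" for a b
    using no_loop by blast
  show ?thesis
    unfolding brauer_relations_def defining_relations_def differences full pairs loops
    by (simp only: not_False_eq_True simp_thms)
qed

lemma brauer_configuration_algebra_eq:
  "brauer_configuration_algebra \<Gamma> = defined_algebra Q cycles"
  by (simp only: brauer_configuration_algebra_def defined_algebra_def brauer_relations_eq)

text \<open>Each polygon is required to contain a vertex that is not truncated, and such a vertex
  contributes arrows.\<close>

lemma arcs_nonempty:
  assumes "polygons \<Gamma> \<noteq> {}"
  shows "arcs Q \<noteq> {}"
proof -
  obtain V where V: "V \<in> polygons \<Gamma>"
    using assms by blast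
  then obtain \<alpha> where \<alpha>: "\<alpha> \<in># corners \<Gamma> V" "valency \<Gamma> \<alpha> * multiplicity_fun \<Gamma> \<alpha> > 1"
    using configuration unfolding brauer_configuration_def by blast
  have "\<alpha> \<in> vertices \<Gamma>"
    using configuration V \<alpha>(1) unfolding brauer_configuration_def by blast
  then have "(\<alpha>, 0) \<in> arcs Q"
    using \<alpha>(2) by (auto simp: nontruncated_def intro: Nat.gr0I)
  then show ?thesis by blast
qed

lemma trivial_extension_of_almost_gentle_brauer:
  assumes indec: "indecomposable_algebra (brauer_configuration_algebra \<Gamma> :: ('k::field, _) module)"
  shows "\<exists>A :: ('k, ((nat, nat) path \<Rightarrow>\<^sub>0 'k) set) module.
    almost_gentle A \<and>
    algebra_isomorphic (brauer_configuration_algebra \<Gamma> :: ('k, _) module) (trivial_extension A)"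
proof -
  have set: "cycle_set Q cycles"
    using cycle_set_defining_pair[OF fin_digraph_Q defining_pair_cycles] by simp
  \<comment> \<open>Without polygons the algebra would be zero, which does not count as
    indecomposable.\<close>
  have "polygons \<Gamma> \<noteq> {}"
    using cycle_set.verts_nonempty_if_indecomposable[OF set] indec
    unfolding brauer_configuration_algebra_eq by simp
  then show ?thesis
    using trivial_extension_of_almost_gentle[OF fin_digraph_Q arcs_nonempty defining_pair_cycles] indec
    unfolding brauer_configuration_algebra_eq by simp
qed

end

theorem corollary5p7:
  shows
    "(\<forall>(Q :: ('v, 'e) pre_digraph) S \<mu>.
        fin_digraph Q \<and> arcs Q \<noteq> {} \<and> defining_pair Q S \<mu> \<and> (\<forall>C\<in>S. \<mu> C = 1) \<and>
        indecomposable_algebra (defined_algebra Q S :: ('k::field, _) module) \<longrightarrow>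
        (\<exists>A :: ('k, ((nat, nat) path \<Rightarrow>\<^sub>0 'k) set) module.
           almost_gentle A \<and>
           algebra_isomorphic (defined_algebra Q S) (trivial_extension A)))
   \<and> (\<forall>\<Gamma> :: ('a, 'p) brauer_configuration.
        brauer_configuration \<Gamma> \<and> (\<forall>\<alpha>\<in>vertices \<Gamma>. multiplicity_fun \<Gamma> \<alpha> = 1) \<and>
        indecomposable_algebra (brauer_configuration_algebra \<Gamma> :: ('k, _) module) \<longrightarrow>
        (\<exists>A :: ('k, ((nat, nat) path \<Rightarrow>\<^sub>0 'k) set) module.
           almost_gentle A \<and>
           algebra_isomorphic (brauer_configuration_algebra \<Gamma>) (trivial_extension A)))"
proof (intro conjI allI impI; elim conjE)
  fix Q :: "('v, 'e) pre_digraph" and S \<mu>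
  assume "fin_digraph Q" "arcs Q \<noteq> {}" "defining_pair Q S \<mu>" "\<forall>C\<in>S. \<mu> C = 1"
    "indecomposable_algebra (defined_algebra Q S :: ('k, _) module)"
  then show "\<exists>A :: ('k, ((nat, nat) path \<Rightarrow>\<^sub>0 'k) set) module.
      almost_gentle A \<and> algebra_isomorphic (defined_algebra Q S) (trivial_extension A)"
    by (rule trivial_extension_of_almost_gentle)
next
  fix \<Gamma> :: "('a, 'p) brauer_configuration"
  assume \<Gamma>: "brauer_configuration \<Gamma>" "\<forall>\<alpha>\<in>vertices \<Gamma>. multiplicity_fun \<Gamma> \<alpha> = 1"
    and indec: "indecomposable_algebra (brauer_configuration_algebra \<Gamma> :: ('k, _) module)"
  have "unit_brauer_configuration \<Gamma>"
    using \<Gamma> by (simp add: unit_brauer_configuration_def)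
  then show "\<exists>A :: ('k, ((nat, nat) path \<Rightarrow>\<^sub>0 'k) set) module.
      almost_gentle A \<and> algebra_isomorphic (brauer_configuration_algebra \<Gamma>) (trivial_extension A)"
    using indec by (rule unit_brauer_configuration.trivial_extension_of_almost_gentle_brauer)
qed

end
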